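(* Let $\Delta$ be a simple $2$-dimensional polytope. There exists a nonconstant affine function that is mass linear on $\Delta$ if and only if $\Delta$ is a triangle, a trapezoid or a parallelogram. Moreover, every nonconstant mass linear function on such a $\Delta$ is inessential. The same statement holds in the smooth case, i.e. when $\Delta$ is a smooth $2$-dimensional polytope and "inessential" is taken in the sense of smooth polytopes.
   Context: Polytopes. Let $\mathfrak t$ be a finite-dimensional real vector space with dual $\mathfrak t^*$ and pairing $\langle\cdot,\cdot\rangle$ (here $\dim\mathfrak t=2$). A polytope is a bounded set $\Delta=\bigcap_{i=1}^N\{x\in\mathfrak t^*\mid\langle\eta_i,x\rangle\le\kappa_i\}$ with outward conormals $\eta_i\in\mathfrak t$ and support numbers $\kappa_i\in\mathbb R$, where $\Delta$ affinely spans $\mathfrak t^*$ and each facet $F_i=\Delta\cap\{\langle\eta_i,x\rangle=\kappa_i\}$ affinely spans a hyperplane. It is simple if exactly $\dim\mathfrak t$ facets meet at each vertex. Given an integer lattice $\ell\subset\mathfrak t$, $\Delta$ is smooth if the outward conormals can be chosen in $\ell$ and, at each vertex, the primitive outward conormals of the facets meeting there form a basis of $\ell$. A trapezoid is a quadrilateral with two parallel sides. Mass linearity. With the $\eta_i$ fixed, for $\kappa'\in\mathbb R^N$ let $\Delta(\kappa')=\bigcap_i\{\langle\eta_i,x\rangle\le\kappa'_i\}$. The chamber $\mathcal C_\Delta\subset\mathbb R^N$ is the connected component containing $\kappa$ of the set of $\kappa'$ for which $\Delta(\kappa')$ is a simple polytope (with $N$ facets, that is, $\Delta(\kappa')$ affinely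 spans $\mathfrak t^*$, each of the $N$ sets $\Delta(\kappa')\cap\{\langle\eta_i,x\rangle=\kappa'_i\}$ affinely spans a hyperplane, and exactly $\dim\mathfrak t$ of these $N$ facets meet at each vertex). Let $c_\Delta(\kappa')$ be the center of mass of $\Delta(\kappa')$. An affine function $H:\mathfrak t^*\to\mathbb R$ is mass linear on $\Delta$ if there are constants $\gamma_i,C\in\mathbb R$ with $H(c_\Delta(\kappa'))=\sum_i\gamma_i\kappa'_i+C$ for all $\kappa'\in\mathcal C_\Delta$. Elements of $\mathfrak t$ are regarded as linear functions on $\mathfrak t^*$. Equivalence of facets. A symmetry of a polytope is an affine map $a:\mathfrak t^*\to\mathfrak t^*$ taking the polytope to itself; for smooth polytopes only those $a$ whose associated linear map induces an automorphism of the integer lattice are allowed. A robust symmetry of $\Delta$ is a linear map $\hat a:\mathfrak t^*\to\mathfrak t^*$ such that for every $\kappa'\in\mathcal C_\Delta$ there is a symmetry $a_{\kappa'}$ of $\Delta(\kappa')$ with associated linear map $\hat a$. Facets $F_i$, $F_j$ are equivalent if there is a robust symmetry $\hat a$ such that each $a_{\kappa'}$ takes $F_i(\kappa')$ to $F_j(\kappa')$. Conormals are normalized so that for every robust symmetry $\hat a$ and every $i$ there is $j$ with $\hat a^*(\eta_i)=\eta_j$ (this is always possible); for smooth polytopes the $\eta_i$ are the primitive outward conormals. Inessential. Let $\mathcal I$ be the set of equivalence classes of facets, each viewed as a subset of $\{1,\dots,N\}$. $H\in\mathfrak t$ is inessential if $H=\sum_i\beta_i\eta_i$ with $\beta_i\in\mathbb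 R$ and $\sum_{i\in I}\beta_i=0$ for every $I\in\mathcal I$; an affine function is inessential if its linear part is. Otherwise it is essential. *)

theory Defs
  imports "HOL-Analysis.Analysis"
begin

text \<open>
  A Euclidean space \<^typ>\<open>'a\<close> plays the role of both the vector space and its dual: the pairing
  is the inner product, so the transpose of a linear map is \<^const>\<open>adjoint\<close>. The facets of a
  polytope are indexed by a finite type \<^typ>\<open>'n\<close>, and the support numbers form a vector in
  \<open>real ^ 'n\<close>, whose topology is used to define the chamber.
\<close>

subsection \<open>Polytopes given by conormals and support numbers\<close>

definition poly_set :: "('n::finite \<Rightarrow> 'a::euclidean_space) \<Rightarrow> real^'n \<Rightarrow> 'a set" where
  "poly_set \<eta> \<kappa> = (\<Inter>i. {x. \<eta> i \<bullet> x \<le> \<kappa> $ i})"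

definition poly_facet :: "('n::finite \<Rightarrow> 'a::euclidean_space) \<Rightarrow> real^'n \<Rightarrow> 'n \<Rightarrow> 'a set" where
  "poly_facet \<eta> \<kappa> i = poly_set \<eta> \<kappa> \<inter> {x. \<eta> i \<bullet> x = \<kappa> $ i}"

definition spans_hyperplane :: "'a::euclidean_space set \<Rightarrow> bool" where
  "spans_hyperplane F \<longleftrightarrow> (\<exists>a b. a \<noteq> 0 \<and> affine hull F = {x. a \<bullet> x = b})"

definition is_polytope :: "('n::finite \<Rightarrow> 'a::euclidean_space) \<Rightarrow> real^'n \<Rightarrow> bool" where
  "is_polytope \<eta> \<kappa> \<longleftrightarrow>
     bounded (poly_set \<eta> \<kappa>) \<and> affine hull (poly_set \<eta> \<kappa>) = UNIV \<and>
     (\<forall>i. spans_hyperplane (poly_facet \<eta> \<kappa> i))"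

definition facets_at :: "('n::finite \<Rightarrow> 'a::euclidean_space) \<Rightarrow> real^'n \<Rightarrow> 'a \<Rightarrow> 'n set" where
  "facets_at \<eta> \<kappa> v = {i. v \<in> poly_facet \<eta> \<kappa> i}"

text \<open>
  Since facets are counted by their indices, simplicity excludes listing a facet twice
  (in dimension at least one).
\<close>

definition simple_polytope :: "('n::finite \<Rightarrow> 'a::euclidean_space) \<Rightarrow> real^'n \<Rightarrow> bool" where
  "simple_polytope \<eta> \<kappa> \<longleftrightarrow>
     is_polytope \<eta> \<kappa> \<and>
     (\<forall>v. v extreme_point_of poly_set \<eta> \<kappa> \<longrightarrow> card (facets_at \<eta> \<kappa> v) = DIM('a))"

subsection \<open>Lattices and smooth polytopes\<close>

definition int_span :: "'a::euclidean_space set \<Rightarrow> 'a set" where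
  "int_span B = {\<Sum>b\<in>B. of_int (c b) *\<^sub>R b | c :: 'a \<Rightarrow> int. True}"

definition lattice_basis :: "'a::euclidean_space set \<Rightarrow> 'a set \<Rightarrow> bool" where
  "lattice_basis B L \<longleftrightarrow> independent B \<and> span B = UNIV \<and> L = int_span B"

definition integer_lattice :: "'a::euclidean_space set \<Rightarrow> bool" where
  "integer_lattice L \<longleftrightarrow> (\<exists>B. lattice_basis B L)"

definition primitive_in :: "'a::euclidean_space set \<Rightarrow> 'a \<Rightarrow> bool" where
  "primitive_in L u \<longleftrightarrow>
     u \<in> L \<and> u \<noteq> 0 \<and> (\<forall>w\<in>L. \<forall>k::nat. u = of_nat k *\<^sub>R w \<longrightarrow> k = 1)"

text \<open>For a smooth polytope the conormals are required to be the primitive outward ones.\<close>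

definition smooth_polytope ::
  "'a::euclidean_space set \<Rightarrow> ('n::finite \<Rightarrow> 'a) \<Rightarrow> real^'n \<Rightarrow> bool" where
  "smooth_polytope L \<eta> \<kappa> \<longleftrightarrow>
     simple_polytope \<eta> \<kappa> \<and> (\<forall>i. primitive_in L (\<eta> i)) \<and>
     (\<forall>v. v extreme_point_of poly_set \<eta> \<kappa> \<longrightarrow> lattice_basis (\<eta> ` facets_at \<eta> \<kappa> v) L)"

subsection \<open>Polygons\<close>

definition sides :: "'a::euclidean_space set \<Rightarrow> 'a set set" where
  "sides P = {F. F facet_of P}"

definition polygon_with :: "nat \<Rightarrow> 'a::euclidean_space set \<Rightarrow> bool" where
  "polygon_with k P \<longleftrightarrow> polytope P \<and> aff_dim P = 2 \<and> card (sides P) = k"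

definition parallel_sides :: "'a::euclidean_space set \<Rightarrow> 'a set \<Rightarrow> bool" where
  "parallel_sides F G \<longleftrightarrow> F \<noteq> G \<and> affine_parallel (affine hull F) (affine hull G)"

definition is_triangle :: "'a::euclidean_space set \<Rightarrow> bool" where
  "is_triangle P \<longleftrightarrow> polygon_with 3 P"

definition is_trapezoid :: "'a::euclidean_space set \<Rightarrow> bool" where
  "is_trapezoid P \<longleftrightarrow>
     polygon_with 4 P \<and> (\<exists>F\<in>sides P. \<exists>G\<in>sides P. parallel_sides F G)"

definition is_parallelogram :: "'a::euclidean_space set \<Rightarrow> bool" where
  "is_parallelogram P \<longleftrightarrow>
     polygon_with 4 P \<and> (\<forall>F\<in>sides P. \<exists>G\<in>sides P. parallel_sides F G)"

subsection \<open>Mass linear functions\<close>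

definition chamber :: "('n::finite \<Rightarrow> 'a::euclidean_space) \<Rightarrow> real^'n \<Rightarrow> (real^'n) set" where
  "chamber \<eta> \<kappa> = connected_component_set {\<kappa>'. simple_polytope \<eta> \<kappa>'} \<kappa>"

definition center_of_mass :: "'a::euclidean_space set \<Rightarrow> 'a" where
  "center_of_mass S = (1 / measure lborel S) *\<^sub>R (LINT x:S|lborel. x)"

definition affine_with_linear_part :: "'a::euclidean_space \<Rightarrow> ('a \<Rightarrow> real) \<Rightarrow> bool" where
  "affine_with_linear_part h H \<longleftrightarrow> (\<exists>c. \<forall>x. H x = h \<bullet> x + c)"

definition mass_linear ::
  "('n::finite \<Rightarrow> 'a::euclidean_space) \<Rightarrow> real^'n \<Rightarrow> ('a \<Rightarrow> real) \<Rightarrow> bool" where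
  "mass_linear \<eta> \<kappa> H \<longleftrightarrow>
     (\<exists>h. affine_with_linear_part h H) \<and>
     (\<exists>(\<gamma> :: 'n \<Rightarrow> real) C. \<forall>\<kappa>'\<in>chamber \<eta> \<kappa>.
        H (center_of_mass (poly_set \<eta> \<kappa>')) = (\<Sum>i\<in>UNIV. \<gamma> i * \<kappa>' $ i) + C)"

subsection \<open>Robust symmetries and equivalent facets\<close>

text \<open>
  The parameter \<open>G\<close> is the set of maps allowed as linear parts of symmetries: \<^const>\<open>UNIV\<close> for
  simple polytopes and \<open>lattice_maps L\<close> for smooth polytopes. Since the lattice lies in the space
  of conormals, while symmetries act on the dual space, the lattice condition is on the transpose.
\<close>

definition lattice_maps :: "'a::euclidean_space set \<Rightarrow> ('a \<Rightarrow> 'a) set" where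
  "lattice_maps L = {f. linear f \<and> bij_betw (adjoint f) L L}"

definition symmetry_of :: "'a::euclidean_space set \<Rightarrow> ('a \<Rightarrow> 'a) \<Rightarrow> ('a \<Rightarrow> 'a) \<Rightarrow> bool" where
  "symmetry_of S f a \<longleftrightarrow> linear f \<and> (\<exists>v. \<forall>x. a x = f x + v) \<and> a ` S = S"

definition robust_symmetry ::
  "('a \<Rightarrow> 'a) set \<Rightarrow> ('n::finite \<Rightarrow> 'a::euclidean_space) \<Rightarrow> real^'n \<Rightarrow> ('a \<Rightarrow> 'a) \<Rightarrow> bool" where
  "robust_symmetry G \<eta> \<kappa> f \<longleftrightarrow>
     f \<in> G \<and> linear f \<and> (\<forall>\<kappa>'\<in>chamber \<eta> \<kappa>. \<exists>a. symmetry_of (poly_set \<eta> \<kappa>') f a)"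

text \<open>
  A symmetry of a polytope is determined by its linear part (it fixes the center of mass), so the
  quantification over \<open>a\<close> below is over exactly one map for each \<open>\<kappa>'\<close>.
\<close>

definition equivalent_facets ::
  "('a \<Rightarrow> 'a) set \<Rightarrow> ('n::finite \<Rightarrow> 'a::euclidean_space) \<Rightarrow> real^'n \<Rightarrow> ('n \<times> 'n) set" where
  "equivalent_facets G \<eta> \<kappa> =
     {(i, j). \<exists>f. robust_symmetry G \<eta> \<kappa> f \<and>
        (\<forall>\<kappa>'\<in>chamber \<eta> \<kappa>. \<forall>a. symmetry_of (poly_set \<eta> \<kappa>') f a \<longrightarrow>
           a ` poly_facet \<eta> \<kappa>' i = poly_facet \<eta> \<kappa>' j)}"

definition normalized ::
  "('a \<Rightarrow> 'a) set \<Rightarrow> ('n::finite \<Rightarrow> 'a::euclidean_space) \<Rightarrow> real^'n \<Rightarrow> bool" where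
  "normalized G \<eta> \<kappa> \<longleftrightarrow>
     (\<forall>f. robust_symmetry G \<eta> \<kappa> f \<longrightarrow> (\<forall>i. \<exists>j. adjoint f (\<eta> i) = \<eta> j))"

text \<open>
  The following notion is meaningful for conormals that are \<^const>\<open>normalized\<close>; the primitive
  conormals of a smooth polytope are so with respect to \<^const>\<open>lattice_maps\<close>.
\<close>

definition inessential ::
  "('a \<Rightarrow> 'a) set \<Rightarrow> ('n::finite \<Rightarrow> 'a::euclidean_space) \<Rightarrow> real^'n \<Rightarrow> ('a \<Rightarrow> real) \<Rightarrow> bool" where
  "inessential G \<eta> \<kappa> H \<longleftrightarrow>
     (\<exists>h (\<beta> :: 'n \<Rightarrow> real). affine_with_linear_part h H \<and>
        h = (\<Sum>i\<in>UNIV. \<beta> i *\<^sub>R \<eta> i) \<and>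
        (\<forall>I \<in> UNIV // equivalent_facets G \<eta> \<kappa>. (\<Sum>i\<in>I. \<beta> i) = 0))"

end

theory Submission imports Defs begin

text \<open>
  Why the theorem holds. Let \<open>V(\<kappa>)\<close> be the area of the polygon with support numbers \<open>\<kappa>\<close>, and suppose
  that the linear form \<open>h\<close> takes the value \<open>L(\<kappa>) = \<Sum>i. \<gamma> i * \<kappa> i + C\<close> at the center of mass throughout the
  chamber, so that the moment of \<open>h\<close> is \<open>V * L\<close>. Everything follows from first and second
  differences of \<open>V\<close> and of the moment when facets are moved outwards; no differentiation or
  explicit integration is needed.

  If the facets \<open>i\<close> and \<open>j\<close> do not meet, then for small \<open>s\<close> and \<open>t\<close> the polygon with facet \<open>i\<close> moved by
  \<open>s\<close> and facet \<open>j\<close> moved by \<open>t\<close> is the union of the two polygons with one facet moved, whose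
  intersection is the original one. Area and moment are additive, so their mixed differences
  vanish, and the product rule applied to \<open>V * L\<close> gives
  \<open>s * \<gamma> i * \<Delta>\<^sub>j V + t * \<gamma> j * \<Delta>\<^sub>i V = 0\<close> (lemma \<open>nonadjacent_relation\<close>). If \<open>i\<close> and \<open>j\<close> do meet, then a
  small parallelogram appears at the common vertex, and the mixed difference of \<open>V\<close> is positive
  (\<open>area_mixed_adjacent\<close>). Moving a third facet \<open>k\<close> that meets \<open>i\<close> but not \<open>j\<close> therefore changes
  \<open>\<Delta>\<^sub>i V\<close> and not \<open>\<Delta>\<^sub>j V\<close>, which forces \<open>\<gamma> i = \<gamma> j = 0\<close> (\<open>coefficients_vanish\<close>). In a polygon with at least
  five sides every facet \<open>i\<close> has such a \<open>j\<close> and \<open>k\<close>, because each facet has exactly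
  two neighbours and the boundary is connected; so all \<open>\<gamma> i\<close> vanish. Translating the polygon shows that
  \<open>h = \<Sum>i. \<gamma> i *\<^sub>R \<eta> i\<close> (\<open>linear_part_eq\<close>), hence \<open>h = 0\<close>.

  In a quadrilateral the same relation for opposite facets \<open>i\<close> and \<open>j\<close> with nonzero coefficients says
  that \<open>V\<close> grows at a constant rate when facet \<open>i\<close> moves; translating the polygon back along one neighbour
  of \<open>i\<close> turns this into a statement about the other neighbour, namely that the two are parallel
  (\<open>neighbours_parallel\<close>). So the quadrilateral is a trapezoid.

  Conversely, whenever all conormals except \<open>\<eta> i\<close> and \<open>\<eta> j\<close> vanish on some \<open>w \<noteq> 0\<close>, which is the
  case in a triangle for any \<open>i\<close>, \<open>j\<close> and in a trapezoid for suitable ones, there is an affine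
  skew reflection along \<open>w\<close> that exchanges the facets \<open>i\<close> and \<open>j\<close> for all support numbers at once (locale
  \<open>facet_reflection\<close>). It preserves the area, hence fixes the center of mass, and this makes
  \<open>\<eta> i - c *\<^sub>R \<eta> j\<close> mass linear for the appropriate \<open>c > 0\<close>. Its linear part is a robust symmetry;
  if the conormals are normalized, or primitive in the smooth case, then \<open>c = 1\<close> and the linear part is
  admissible (\<open>normalized_factor\<close>, \<open>smooth_factor\<close>), so that \<open>i\<close> and \<open>j\<close> are equivalent. In a triangle all facets are then
  equivalent and \<open>\<Sum>i. \<eta> i = 0\<close>, so the coefficients \<open>\<gamma>\<close> can be shifted to have sum zero. In a
  quadrilateral, two opposite coefficients either both vanish, or the reflection exists and gives
  \<open>\<Delta>\<^sub>i V = \<Delta>\<^sub>j V\<close>, so that \<open>\<gamma> i + \<gamma> j = 0\<close> by the relation above. In both cases \<open>h\<close> is inessential.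
\<close>

section \<open>Invariance of Lebesgue measure under affine involutions of the plane\<close>

lemma emeasure_box_linear_involution:
  fixes f :: "real^2 \<Rightarrow> real^2"
  assumes "linear f" "\<And>x. f (f x) = x"
  shows "emeasure lborel (f -` box l u) = emeasure lborel (box l u)"
proof -
  have inv: "f -` S = f ` S" for S
    using assms(2) by (auto simp: image_iff) metis
  have "matrix f ** matrix f = mat 1"
    using assms matrix_compose[of f f] by (simp add: o_def flip: matrix_id_mat_1 id_def)
  then have "det (matrix f) * det (matrix f) = 1"
    by (metis det_I det_mul)
  then have det: "\<bar>det (matrix f)\<bar> = 1"
    by (metis abs_mult abs_one abs_mult_self_eq power2_eq_square real_sqrt_abs real_sqrt_one)
  have bm: "f \<in> borel_measurable borel"
    using assms(1) by (simp add: borel_measurable_continuous_onI linear_continuous_on linear_conv_bounded_linear)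
  have meas: "f ` box l u \<in> lmeasurable"
    using measurable_linear_image[OF assms(1)] by blast
  have b: "f ` box l u \<in> sets borel"
    using measurable_sets[OF bm, of "box l u"] by (simp add: inv)
  have "measure lebesgue (f ` box l u) = measure lebesgue (box l u)"
    using measure_linear_image[OF assms(1), of "box l u"] det by simp
  then have "emeasure lebesgue (f ` box l u) = emeasure lebesgue (box l u)"
    by (simp add: emeasure_eq_measure2 meas)
  then show ?thesis
    using b by (simp add: inv)
qed

lemma lborel_distr_linear_involution_vec:
  fixes f :: "real^2 \<Rightarrow> real^2"
  assumes "linear f" "\<And>x. f (f x) = x"
  shows "distr lborel borel f = lborel"
proof (rule sym, rule lborel_eqI)
  have bm: "f \<in> borel_measurable borel"
    using assms(1) by (simp add: borel_measurable_continuous_onI linear_continuous_on linear_conv_bounded_linear)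
  fix l u :: "real^2" assume "\<And>b. b \<in> Basis \<Longrightarrow> l \<bullet> b \<le> u \<bullet> b"
  then show "emeasure (distr lborel borel f) (box l u) = (\<Prod>b\<in>Basis. (u - l) \<bullet> b)"
    using bm by (simp add: emeasure_distr emeasure_box_linear_involution[OF assms])
qed simp

text \<open>The case of a general Euclidean plane is reduced to \<open>real ^ 2\<close>, for which the change of variables
  formula for linear maps is available, by the coordinate isomorphisms \<open>g\<close> and \<open>h\<close>.\<close>

lemma lborel_distr_linear_involution:
  fixes f :: "'a::euclidean_space \<Rightarrow> 'a"
  assumes "DIM('a) = 2" "linear f" "\<And>x. f (f x) = x"
  shows "distr lborel borel f = lborel"
proof -
  obtain b where b: "bij_betw b (UNIV :: 2 set) (Basis :: 'a set)"
    using assms(1) finite_same_card_bij[of "UNIV :: 2 set" "Basis :: 'a set"] by auto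
  define g :: "real^2 \<Rightarrow> 'a" where "g y = (\<Sum>i\<in>UNIV. (y $ i) *\<^sub>R b i)" for y
  define h :: "'a \<Rightarrow> real^2" where "h x = (\<chi> i. x \<bullet> b i)" for x
  have bB: "b i \<in> Basis" for i using b by (auto simp: bij_betw_def)
  have binj: "b i = b j \<longleftrightarrow> i = j" for i j using b by (auto simp: bij_betw_def inj_def)
  have gb: "g y \<bullet> b i = y $ i" for y i
    by (simp add: g_def inner_sum_left inner_Basis bB binj if_distrib cong: if_cong)
  have hg: "h (g y) = y" for y by (simp add: h_def gb)
  have gh: "g (h x) = x" for x
  proof (rule euclidean_eqI)
    fix c :: 'a assume "c \<in> Basis"
    then obtain i where "c = b i" using b by (auto simp: bij_betw_def)
    then show "g (h x) \<bullet> c = x \<bullet> c" by (simp add: gb) (simp add: h_def)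
  qed
  have lg: "linear g" unfolding g_def
    by (intro linearI) (simp_all add: scaleR_add_left sum.distrib scaleR_sum_right)
  have lh: "linear h" unfolding h_def
    by (intro linearI) (simp_all add: vec_eq_iff inner_add_left)
  have bm: "g \<in> borel_measurable borel" "h \<in> borel_measurable borel" "f \<in> borel_measurable borel"
    using lg lh assms(2)
    by (simp_all add: borel_measurable_continuous_onI linear_continuous_on linear_conv_bounded_linear)
  have lbg: "lborel = distr lborel borel g"
  proof (rule lborel_eqI)
    fix l u :: 'a assume lu: "\<And>b. b \<in> Basis \<Longrightarrow> l \<bullet> b \<le> u \<bullet> b"
    have pre: "g -` box l u = box (h l) (h u)"
    proof -
      have "g y \<in> box l u \<longleftrightarrow> y \<in> box (h l) (h u)" for y
      proof -
        have "g y \<in> box l u \<longleftrightarrow> (\<forall>i. l \<bullet> b i < g y \<bullet> b i \<and> g y \<bullet> b i < u \<bullet> b i)"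
          unfolding mem_box bij_betw_imp_surj_on[OF b, symmetric] by simp
        then show ?thesis by (simp only: gb) (simp add: mem_box_cart h_def)
      qed
      then show ?thesis by auto
    qed
    have "emeasure (distr lborel borel g) (box l u) = emeasure lborel (box (h l) (h u))"
      using bm by (simp add: emeasure_distr pre)
    also have "\<dots> = (\<Prod>c\<in>Basis. (h u - h l) \<bullet> c)"
      using lu bB by (subst emeasure_lborel_box) (auto simp: Basis_vec_def inner_axis h_def)
    also have "(\<Prod>c\<in>Basis. (h u - h l) \<bullet> c) = (\<Prod>i\<in>(UNIV::2 set). (u - l) \<bullet> b i)"
    proof -
      have "(\<Prod>c\<in>(Basis::(real^2) set). (h u - h l) \<bullet> c) = (\<Prod>i\<in>UNIV. (h u - h l) \<bullet> axis i 1)"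
        unfolding Basis_vec_def
        by (simp add: UNION_singleton_eq_range)
          (subst prod.reindex, auto simp: inj_def axis_eq_axis)
      then show ?thesis by (simp add: inner_axis h_def inner_diff_left)
    qed
    also have "\<dots> = (\<Prod>c\<in>Basis. (u - l) \<bullet> c)"
      by (rule prod.reindex_bij_betw[OF b])
    finally show "emeasure (distr lborel borel g) (box l u) = (\<Prod>c\<in>Basis. (u - l) \<bullet> c)" .
  qed simp
  define F where "F = h \<circ> f \<circ> g"
  have F: "distr lborel borel F = lborel"
  proof (rule lborel_distr_linear_involution_vec)
    show "linear F" unfolding F_def using lg lh assms(2) by (intro linear_compose)
    show "F (F x) = x" for x by (simp add: F_def gh hg assms(3))
  qed
  have bmF: "F \<in> borel_measurable borel" unfolding F_def using bm by measurable
  have "distr lborel borel f = distr (distr lborel borel g) borel f"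
    using lbg by simp
  also have "\<dots> = distr lborel borel (f \<circ> g)" using bm by (simp add: distr_distr)
  also have "f \<circ> g = g \<circ> F" by (simp add: F_def fun_eq_iff gh)
  also have "distr lborel borel (g \<circ> F) = distr (distr lborel borel F) borel g"
    using bm bmF by (simp add: distr_distr)
  finally show ?thesis using F lbg by simp
qed

lemma lborel_distr_affine_involution:
  fixes f :: "'a::euclidean_space \<Rightarrow> 'a"
  assumes "DIM('a) = 2" "linear f" "\<And>x. f (f x) = x"
  shows "distr lborel borel (\<lambda>x. f x + v) = lborel"
proof -
  have bm: "f \<in> borel_measurable borel"
    using assms(2) by (simp add: borel_measurable_continuous_onI linear_continuous_on linear_conv_bounded_linear)
  have "lborel = distr lborel borel ((+) v)" by (rule lborel_distr_plus[symmetric])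
  also have "\<dots> = distr (distr lborel borel f) borel ((+) v)"
    by (simp add: lborel_distr_linear_involution[OF assms])
  also have "\<dots> = distr lborel borel (\<lambda>x. f x + v)"
    using bm by (subst distr_distr) (auto simp: o_def add.commute)
  finally show ?thesis by simp
qed

section \<open>Linear algebra in the plane\<close>

lemma orthogonal_parallel_2d:
  fixes u v y :: "'a::euclidean_space"
  assumes "DIM('a) = 2" "y \<noteq> 0" "u \<noteq> 0" "u \<bullet> y = 0" "v \<bullet> y = 0"
  shows "\<exists>c. v = c *\<^sub>R u"
proof (rule ccontr)
  assume no: "\<not> ?thesis"
  then have "u \<noteq> v" using scaleR_one by metis
  have "independent {v, u}"
  proof (rule independent_insertI)
    show "v \<notin> span {u}" using no by (auto simp: span_singleton)
    show "independent {u}" using assms(3) by simp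
  qed
  moreover have "{v, u} \<subseteq> {x. y \<bullet> x = 0}" using assms by (simp add: inner_commute)
  ultimately have "card {v, u} \<le> dim {x. y \<bullet> x = 0}"
    using independent_card_le_dim by blast
  then show False using \<open>u \<noteq> v\<close> assms(1,2) by (simp add: dim_hyperplane)
qed

lemma independent_functionals_2d:
  fixes u v :: "'a::euclidean_space"
  assumes dim: "DIM('a) = 2" and "u \<noteq> 0" "\<nexists>c. v = c *\<^sub>R u"
  obtains w where "u \<bullet> w = a" "v \<bullet> w = b"
proof -
  have "v \<noteq> 0" using assms(3) scaleR_zero_left by metis
  obtain y where y: "y \<noteq> 0" "orthogonal u y"
    using orthogonal_to_vector_exists[of u] dim by auto
  obtain z where z: "z \<noteq> 0" "orthogonal v z"
    using orthogonal_to_vector_exists[of v] dim by auto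
  have "v \<bullet> y \<noteq> 0"
    using orthogonal_parallel_2d[OF dim y(1) assms(2), of v] y(2) assms(3) by (auto simp: orthogonal_def)
  moreover have "u \<bullet> z \<noteq> 0"
    using orthogonal_parallel_2d[OF dim z(1) assms(2), of v] z(2) assms(3) by (auto simp: orthogonal_def)
  ultimately show ?thesis
    using y(2) z(2)
    by (intro that[of "(a / (u \<bullet> z)) *\<^sub>R z + (b / (v \<bullet> y)) *\<^sub>R y"])
      (auto simp: orthogonal_def inner_add_right)
qed

section \<open>Polyhedra with fixed conormals\<close>

lemma mem_poly_set: "x \<in> poly_set \<eta> \<kappa> \<longleftrightarrow> (\<forall>k. \<eta> k \<bullet> x \<le> \<kappa> $ k)"
  by (auto simp: poly_set_def)

lemma mem_poly_facet: "x \<in> poly_facet \<eta> \<kappa> i \<longleftrightarrow> (\<forall>k. \<eta> k \<bullet> x \<le> \<kappa> $ k) \<and> \<eta> i \<bullet> x = \<kappa> $ i"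
  by (auto simp: poly_facet_def mem_poly_set)

lemma closed_poly_set [simp]: "closed (poly_set \<eta> \<kappa>)"
  unfolding poly_set_def by (auto intro: closed_halfspace_le)

lemma polyhedron_poly_set: "polyhedron (poly_set \<eta> \<kappa>)"
  unfolding poly_set_def by (auto intro: polyhedron_halfspace_le)

lemma convex_poly_set [simp]: "convex (poly_set \<eta> \<kappa>)"
  using polyhedron_poly_set polyhedron_imp_convex by blast

lemma poly_facet_face_of: "poly_facet \<eta> \<kappa> i face_of poly_set \<eta> \<kappa>"
  unfolding poly_facet_def by (rule face_of_Int_supporting_hyperplane_le) (auto simp: mem_poly_set)

lemma strict_imp_interior:
  assumes "\<And>k. \<eta> k \<bullet> x < \<kappa> $ k"
  shows "x \<in> interior (poly_set \<eta> \<kappa>)"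
proof -
  have "{x. \<forall>k. \<eta> k \<bullet> x < \<kappa> $ k} = (\<Inter>k. {x. \<eta> k \<bullet> x < \<kappa> $ k})" by auto
  then have "open {x. \<forall>k. \<eta> k \<bullet> x < \<kappa> $ k}"
    by (simp add: open_INT open_halfspace_lt)
  moreover have "{x. \<forall>k. \<eta> k \<bullet> x < \<kappa> $ k} \<subseteq> poly_set \<eta> \<kappa>"
    by (auto simp: mem_poly_set less_imp_le)
  ultimately show ?thesis using assms by (auto simp: interior_def)
qed

lemma bounded_imp_no_recession:
  assumes bd: "bounded (poly_set \<eta> \<kappa>)" and ne: "x \<in> poly_set \<eta> \<kappa>"
    and y: "\<forall>k. \<eta> k \<bullet> y \<le> 0"
  shows "y = 0"
proof (rule ccontr)
  assume "y \<noteq> 0"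
  obtain B where B: "\<And>x. x \<in> poly_set \<eta> \<kappa> \<Longrightarrow> norm x \<le> B"
    using bd by (auto simp: bounded_iff)
  define t where "t = (B + norm x + 1) / norm y"
  have B0: "B \<ge> 0" using B[OF ne] norm_ge_zero order_trans by blast
  then have t: "t \<ge> 0" by (simp add: t_def)
  have "x + t *\<^sub>R y \<in> poly_set \<eta> \<kappa>"
    unfolding mem_poly_set inner_add_right inner_scaleR_right
  proof
    fix k
    have "t * (\<eta> k \<bullet> y) \<le> 0" using t y by (simp add: mult_nonneg_nonpos)
    moreover have "\<eta> k \<bullet> x \<le> \<kappa> $ k" using ne by (simp add: mem_poly_set)
    ultimately show "\<eta> k \<bullet> x + t * (\<eta> k \<bullet> y) \<le> \<kappa> $ k" by simp
  qed
  then have "norm (x + t *\<^sub>R y) \<le> B" by (rule B)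
  moreover have "norm (t *\<^sub>R y) \<le> norm (x + t *\<^sub>R y) + norm x"
    by (metis add_diff_cancel_left' norm_triangle_ineq4)
  moreover have "norm (t *\<^sub>R y) = B + norm x + 1"
    using B0 \<open>y \<noteq> 0\<close> by (simp add: t_def)
  ultimately show False by simp
qed

lemma poly_set_locally_uniformly_bounded:
  fixes \<eta> :: "'n::finite \<Rightarrow> 'a::euclidean_space"
  assumes rec: "\<And>y. (\<forall>k. \<eta> k \<bullet> y \<le> 0) \<Longrightarrow> y = 0"
  obtains B where "\<And>\<kappa>'. dist \<kappa>' \<kappa> \<le> 1 \<Longrightarrow> poly_set \<eta> \<kappa>' \<subseteq> cball 0 B"
proof -
  \<comment> \<open>\<open>g\<close> is positively homogeneous and positive away from 0, hence bounded below by a positive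
    multiple of the norm.\<close>
  define g where "g y = (\<Sum>k\<in>UNIV. max 0 (\<eta> k \<bullet> y))" for y
  have g_scale: "g (c *\<^sub>R y) = c * g y" if "c \<ge> 0" for c y
  proof -
    have "max 0 (c * a) = c * max 0 a" for a :: real
      using that by (auto simp: max_def mult_le_0_iff zero_le_mult_iff)
    then show ?thesis by (simp add: g_def sum_distrib_left)
  qed
  have "continuous_on (sphere 0 1) g" unfolding g_def by (intro continuous_intros)
  then obtain y0 where y0: "y0 \<in> sphere 0 1" "\<And>y. y \<in> sphere 0 1 \<Longrightarrow> g y0 \<le> g y"
    using continuous_attains_inf[of "sphere (0::'a) 1" g] by auto
  have "g y0 > 0"
  proof (rule ccontr)
    assume "\<not> ?thesis"
    moreover have "g y0 \<ge> 0" by (simp add: g_def sum_nonneg)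
    ultimately have "g y0 = 0" by simp
    then have "max 0 (\<eta> k \<bullet> y0) = 0" for k
      unfolding g_def by (subst (asm) sum_nonneg_eq_0_iff) auto
    then have "\<eta> k \<bullet> y0 \<le> 0" for k by (metis max.cobounded2)
    then show False using rec[of y0] y0(1) by simp
  qed
  define B where "B = (\<Sum>k\<in>UNIV. \<bar>\<kappa> $ k\<bar> + 1) / g y0"
  have "norm x \<le> B" if d: "dist \<kappa>' \<kappa> \<le> 1" and x: "x \<in> poly_set \<eta> \<kappa>'" for \<kappa>' x
  proof (cases "x = 0")
    case True then show ?thesis using \<open>g y0 > 0\<close> by (simp add: B_def sum_nonneg)
  next
    case False
    then have "g y0 \<le> g ((1 / norm x) *\<^sub>R x)" by (intro y0(2)) simp
    also have "g ((1 / norm x) *\<^sub>R x) = g x / norm x"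
      by (subst g_scale) auto
    finally have "norm x * g y0 \<le> g x" using False by (simp add: pos_le_divide_eq mult.commute)
    also have "g x \<le> (\<Sum>k\<in>UNIV. \<bar>\<kappa> $ k\<bar> + 1)"
      unfolding g_def
    proof (rule sum_mono)
      fix k
      have "\<bar>\<kappa>' $ k - \<kappa> $ k\<bar> \<le> 1"
        using d component_le_norm_cart[of "\<kappa>' - \<kappa>" k] by (simp add: dist_norm)
      moreover have "\<eta> k \<bullet> x \<le> \<kappa>' $ k" using x by (simp add: mem_poly_set)
      ultimately show "max 0 (\<eta> k \<bullet> x) \<le> \<bar>\<kappa> $ k\<bar> + 1" by linarith
    qed
    finally show ?thesis using \<open>g y0 > 0\<close> by (simp add: B_def pos_le_divide_eq)
  qed
  then show ?thesis by (intro that[of B]) auto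
qed

lemma bounded_if_no_recession:
  fixes \<eta> :: "'n::finite \<Rightarrow> 'a::euclidean_space"
  assumes "\<And>y. (\<forall>k. \<eta> k \<bullet> y \<le> 0) \<Longrightarrow> y = 0"
  shows "bounded (poly_set \<eta> \<kappa>)"
  using poly_set_locally_uniformly_bounded[of \<eta> \<kappa>] assms
  by (metis bounded_cball bounded_subset dist_self zero_le_one)

text \<open>Incidences can only appear in the limit: constraints that are not tight simultaneously
  at \<open>\<kappa>\<close> are not tight simultaneously for nearby support numbers.\<close>

lemma eventually_no_contact:
  fixes \<eta> :: "'n::finite \<Rightarrow> 'a::euclidean_space"
  assumes rec: "\<And>y. (\<forall>k. \<eta> k \<bullet> y \<le> 0) \<Longrightarrow> y = 0"
    and no: "\<not> (\<exists>x\<in>poly_set \<eta> \<kappa>. \<forall>i\<in>J. \<eta> i \<bullet> x = \<kappa> $ i)"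
  shows "\<forall>\<^sub>F \<kappa>' in nhds \<kappa>. \<not> (\<exists>x\<in>poly_set \<eta> \<kappa>'. \<forall>i\<in>J. \<eta> i \<bullet> x = \<kappa>' $ i)"
proof -
  obtain B where B: "\<And>\<kappa>'. dist \<kappa>' \<kappa> \<le> 1 \<Longrightarrow> poly_set \<eta> \<kappa>' \<subseteq> cball 0 B"
    using poly_set_locally_uniformly_bounded[OF rec] by blast
  define T where "T = {z :: 'a \<times> (real^'n). (\<forall>k. \<eta> k \<bullet> fst z \<le> snd z $ k) \<and>
      (\<forall>i. i \<in> J \<longrightarrow> \<eta> i \<bullet> fst z = snd z $ i)}"
  have "closed T" unfolding T_def
    by (intro closed_Collect_conj closed_Collect_all closed_Collect_imp closed_Collect_le closed_Collect_eq
        continuous_intros) auto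
  then have cl: "closed {\<kappa>'. \<exists>x. x \<in> cball 0 B \<and> (x, \<kappa>') \<in> T}"
    by (intro closed_compact_projection) auto
  have "\<kappa> \<notin> {\<kappa>'. \<exists>x. x \<in> cball 0 B \<and> (x, \<kappa>') \<in> T}"
    using no by (auto simp: T_def mem_poly_set)
  then have "\<forall>\<^sub>F \<kappa>' in nhds \<kappa>. \<kappa>' \<in> - {\<kappa>'. \<exists>x. x \<in> cball 0 B \<and> (x, \<kappa>') \<in> T}"
    using cl by (intro eventually_nhds_in_open) auto
  moreover have "\<forall>\<^sub>F \<kappa>' in nhds \<kappa>. dist \<kappa>' \<kappa> < 1"
    using eventually_nhds_metric zero_less_one by blast
  ultimately show ?thesis
  proof eventually_elim
    case (elim \<kappa>')
    show ?case
    proof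
      assume "\<exists>x\<in>poly_set \<eta> \<kappa>'. \<forall>i\<in>J. \<eta> i \<bullet> x = \<kappa>' $ i"
      then obtain x where x: "x \<in> poly_set \<eta> \<kappa>'" "\<forall>i\<in>J. \<eta> i \<bullet> x = \<kappa>' $ i" by blast
      then have "x \<in> cball 0 B" using B elim by (meson less_imp_le subsetD)
      then show False using x elim by (auto simp: T_def mem_poly_set)
    qed
  qed
qed

text \<open>A point at which exactly the constraints in \<open>J\<close> are tight can be moved along with the
  support numbers, provided that the conormals in \<open>J\<close> have a dual system \<open>W\<close>.\<close>

lemma eventually_contact:
  fixes \<eta> :: "'n::finite \<Rightarrow> 'a::euclidean_space"
  assumes W: "\<And>i j. i \<in> J \<Longrightarrow> j \<in> J \<Longrightarrow> \<eta> i \<bullet> W j = (if i = j then 1 else 0)"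
    and p: "\<And>i. i \<in> J \<Longrightarrow> \<eta> i \<bullet> p = \<kappa> $ i" "\<And>k. k \<notin> J \<Longrightarrow> \<eta> k \<bullet> p < \<kappa> $ k"
  shows "\<forall>\<^sub>F \<kappa>' in nhds \<kappa>. \<exists>p'. (\<forall>i\<in>J. \<eta> i \<bullet> p' = \<kappa>' $ i) \<and> (\<forall>k. k \<notin> J \<longrightarrow> \<eta> k \<bullet> p' < \<kappa>' $ k)"
proof -
  define q where "q \<kappa>' = p + (\<Sum>j\<in>J. (\<kappa>' $ j - \<kappa> $ j) *\<^sub>R W j)" for \<kappa>' :: "real^'n"
  have tight: "\<eta> i \<bullet> q \<kappa>' = \<kappa>' $ i" if "i \<in> J" for i \<kappa>'
    using that p(1)[OF that] by (simp add: q_def inner_add_right inner_sum_right W if_distrib[of "(*) _"] cong: if_cong)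
  have "\<forall>\<^sub>F \<kappa>' in nhds \<kappa>. \<kappa>' \<in> {\<kappa>'. \<eta> k \<bullet> q \<kappa>' < \<kappa>' $ k}" if "k \<notin> J" for k
  proof (rule eventually_nhds_in_open)
    show "open {\<kappa>'. \<eta> k \<bullet> q \<kappa>' < \<kappa>' $ k}"
      unfolding q_def by (intro open_Collect_less continuous_intros)
    show "\<kappa> \<in> {\<kappa>'. \<eta> k \<bullet> q \<kappa>' < \<kappa>' $ k}" using p(2)[OF that] by (simp add: q_def)
  qed
  then have "\<forall>\<^sub>F \<kappa>' in nhds \<kappa>. \<forall>k. k \<notin> J \<longrightarrow> \<eta> k \<bullet> q \<kappa>' < \<kappa>' $ k"
    by (intro eventually_all_finite) (simp add: eventually_mono)
  then show ?thesis by (rule eventually_mono) (use tight in blast)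
qed

text \<open>A point that can be moved in a direction and its opposite without leaving the tight facets is
  not a vertex.\<close>

lemma not_extreme_point_poly_set:
  fixes \<eta> :: "'n::finite \<Rightarrow> 'a::euclidean_space"
  assumes v: "v \<in> poly_set \<eta> \<kappa>" and "y \<noteq> 0"
    and y: "\<And>k. k \<in> facets_at \<eta> \<kappa> v \<Longrightarrow> \<eta> k \<bullet> y = 0"
  shows "\<not> v extreme_point_of poly_set \<eta> \<kappa>"
proof
  assume ext: "v extreme_point_of poly_set \<eta> \<kappa>"
  have "\<forall>\<^sub>F t in at_right 0. \<eta> k \<bullet> (v + t *\<^sub>R y) \<le> \<kappa> $ k \<and> \<eta> k \<bullet> (v - t *\<^sub>R y) \<le> \<kappa> $ k" for k
  proof (cases "k \<in> facets_at \<eta> \<kappa> v")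
    case True
    then show ?thesis
      using v y[OF True] by (auto simp: mem_poly_set inner_add_right inner_diff_right)
  next
    case False
    then have "\<eta> k \<bullet> v < \<kappa> $ k"
      using v by (auto simp: facets_at_def mem_poly_facet mem_poly_set less_le)
    moreover have "((\<lambda>t. \<eta> k \<bullet> (v + t *\<^sub>R y)) \<longlongrightarrow> \<eta> k \<bullet> (v + 0 *\<^sub>R y)) (at_right 0)"
      "((\<lambda>t. \<eta> k \<bullet> (v - t *\<^sub>R y)) \<longlongrightarrow> \<eta> k \<bullet> (v - 0 *\<^sub>R y)) (at_right 0)"
      by (intro tendsto_intros)+
    ultimately have "\<forall>\<^sub>F t in at_right 0. \<eta> k \<bullet> (v + t *\<^sub>R y) < \<kappa> $ k"
      "\<forall>\<^sub>F t in at_right 0. \<eta> k \<bullet> (v - t *\<^sub>R y) < \<kappa> $ k"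
      by (auto intro: order_tendstoD)
    then show ?thesis by eventually_elim auto
  qed
  then have "\<forall>\<^sub>F t in at_right 0. \<forall>k. \<eta> k \<bullet> (v + t *\<^sub>R y) \<le> \<kappa> $ k \<and> \<eta> k \<bullet> (v - t *\<^sub>R y) \<le> \<kappa> $ k"
    by (intro eventually_all_finite)
  moreover have "\<forall>\<^sub>F t in at_right 0. (t::real) > 0" by (rule eventually_at_right_less)
  ultimately obtain t where t: "t > 0"
    "\<forall>k. \<eta> k \<bullet> (v + t *\<^sub>R y) \<le> \<kappa> $ k \<and> \<eta> k \<bullet> (v - t *\<^sub>R y) \<le> \<kappa> $ k"
    by (metis (mono_tags, lifting) eventually_conj eventually_happens' trivial_limit_at_right_real)
  define u where "u = t *\<^sub>R y"
  have "u \<noteq> 0" using t(1) \<open>y \<noteq> 0\<close> by (simp add: u_def)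
  have "v \<in> open_segment (v - u) (v + u)"
    unfolding in_segment
  proof (intro conjI exI[of _ "1/2"])
    have "(v + u) - (v - u) = 2 *\<^sub>R u" by (simp add: scaleR_2)
    then have "(v + u) - (v - u) \<noteq> 0" using \<open>u \<noteq> 0\<close> by (simp only: scaleR_eq_0_iff) simp
    then show "v - u \<noteq> v + u" by (metis right_minus_eq)
    show "v = (1 - 1 / 2) *\<^sub>R (v - u) + (1 / 2) *\<^sub>R (v + u)"
      by (simp add: scaleR_add_right scaleR_diff_right flip: scaleR_add_left)
  qed auto
  moreover have "v - u \<in> poly_set \<eta> \<kappa>" "v + u \<in> poly_set \<eta> \<kappa>"
    using t(2) by (simp_all add: mem_poly_set u_def)
  ultimately show False
    using ext unfolding extreme_point_of_def by blast
qed

text \<open>A description of simple polygons by conditions that are stable under small changes of the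
  support numbers.\<close>

lemma simple_polytopeI:
  fixes \<eta> :: "'n::finite \<Rightarrow> 'a::euclidean_space"
  assumes dim: "DIM('a) = 2"
    and nz: "\<And>i. \<eta> i \<noteq> 0"
    and rec: "\<And>y. (\<forall>k. \<eta> k \<bullet> y \<le> 0) \<Longrightarrow> y = 0"
    and inner: "\<And>k. \<eta> k \<bullet> x0 < \<kappa> $ k"
    and facet: "\<And>i. \<exists>p. \<eta> i \<bullet> p = \<kappa> $ i \<and> (\<forall>k. k \<noteq> i \<longrightarrow> \<eta> k \<bullet> p < \<kappa> $ k)"
    and triple: "\<And>i j k. i \<noteq> j \<Longrightarrow> i \<noteq> k \<Longrightarrow> j \<noteq> k \<Longrightarrow>
      \<not> (\<exists>x\<in>poly_set \<eta> \<kappa>. \<forall>m\<in>{i, j, k}. \<eta> m \<bullet> x = \<kappa> $ m)"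
  shows "simple_polytope \<eta> \<kappa>"
  unfolding simple_polytope_def is_polytope_def
proof (intro conjI allI impI)
  show "bounded (poly_set \<eta> \<kappa>)" using rec by (rule bounded_if_no_recession)
  have "interior (poly_set \<eta> \<kappa>) \<noteq> {}" using strict_imp_interior[OF inner] by blast
  then show "affine hull poly_set \<eta> \<kappa> = UNIV" by (rule affine_hull_nonempty_interior)
next
  fix i
  obtain p where p: "\<eta> i \<bullet> p = \<kappa> $ i" "\<And>k. k \<noteq> i \<Longrightarrow> \<eta> k \<bullet> p < \<kappa> $ k" using facet by blast
  let ?L = "{x. \<eta> i \<bullet> x = \<kappa> $ i}" and ?U = "{x. \<forall>k. k \<noteq> i \<longrightarrow> \<eta> k \<bullet> x < \<kappa> $ k}"
  have "?U = (\<Inter>k\<in>-{i}. {x. \<eta> k \<bullet> x < \<kappa> $ k})" by auto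
  then have "open ?U" by (simp add: open_INT open_halfspace_lt)
  then have "affine hull (?L \<inter> ?U) = affine hull ?L"
    using p by (intro affine_hull_affine_Int_open affine_hyperplane) auto
  moreover have "?L \<inter> ?U \<subseteq> poly_facet \<eta> \<kappa> i"
    by (auto simp: mem_poly_facet) (metis order.refl less_imp_le)
  moreover have "poly_facet \<eta> \<kappa> i \<subseteq> ?L" by (auto simp: mem_poly_facet)
  ultimately have "?L \<subseteq> affine hull poly_facet \<eta> \<kappa> i" "affine hull poly_facet \<eta> \<kappa> i \<subseteq> ?L"
    using hull_mono[of "?L \<inter> ?U" "poly_facet \<eta> \<kappa> i" affine]
      hull_minimal[of "poly_facet \<eta> \<kappa> i" ?L affine]
    by (simp_all add: affine_hyperplane affine_hull_eq[THEN iffD2])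
  then have "affine hull poly_facet \<eta> \<kappa> i = ?L" by blast
  then show "spans_hyperplane (poly_facet \<eta> \<kappa> i)"
    unfolding spans_hyperplane_def using nz by blast
next
  fix v assume v: "v extreme_point_of poly_set \<eta> \<kappa>"
  then have vP: "v \<in> poly_set \<eta> \<kappa>" by (simp add: extreme_point_of_def)
  let ?A = "facets_at \<eta> \<kappa> v"
  have "\<not> card ?A \<ge> 3"
  proof
    assume "card ?A \<ge> 3"
    then obtain B where B: "B \<subseteq> ?A" "card B = 3" by (meson obtain_subset_with_card_n)
    then obtain i j k where "B = {i, j, k}" "i \<noteq> j" "j \<noteq> k" "i \<noteq> k" by (auto simp: card_3_iff)
    then show False using triple[of i j k] vP B by (auto simp: facets_at_def mem_poly_facet)
  qed
  moreover have "\<not> card ?A \<le> 1"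
  proof
    assume "card ?A \<le> 1"
    then obtain i where i: "?A \<subseteq> {i}"
      by (metis card_le_Suc0_iff_eq finite One_nat_def subsetI singletonI insertI1)
    obtain y where "y \<noteq> 0" "orthogonal (\<eta> i) y"
      using orthogonal_to_vector_exists[of "\<eta> i"] dim by auto
    then show False
      using not_extreme_point_poly_set[OF vP, of y] i v by (auto simp: orthogonal_def)
  qed
  ultimately show "card ?A = DIM('a)" using dim by linarith
qed

section \<open>Combinatorics of simple polygons\<close>

text \<open>Two different facets are adjacent if they meet.\<close>

definition adjacent :: "('n::finite \<Rightarrow> 'a::euclidean_space) \<Rightarrow> real^'n \<Rightarrow> 'n \<Rightarrow> 'n \<Rightarrow> bool" where
  "adjacent \<eta> \<kappa> i j \<longleftrightarrow> i \<noteq> j \<and> poly_facet \<eta> \<kappa> i \<inter> poly_facet \<eta> \<kappa> j \<noteq> {}"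

lemma adjacent_sym: "adjacent \<eta> \<kappa> i j \<longleftrightarrow> adjacent \<eta> \<kappa> j i"
  by (auto simp: adjacent_def)

lemma adjacent_iff:
  "adjacent \<eta> \<kappa> i j \<longleftrightarrow> i \<noteq> j \<and> (\<exists>x\<in>poly_set \<eta> \<kappa>. \<forall>m\<in>{i, j}. \<eta> m \<bullet> x = \<kappa> $ m)"
proof -
  have "x \<in> poly_facet \<eta> \<kappa> i \<inter> poly_facet \<eta> \<kappa> j \<longleftrightarrow>
      x \<in> poly_set \<eta> \<kappa> \<and> (\<forall>m\<in>{i, j}. \<eta> m \<bullet> x = \<kappa> $ m)" for x
    by (auto simp: poly_facet_def)
  then show ?thesis unfolding adjacent_def by (metis ex_in_conv)
qed

text \<open>A simple two-dimensional polytope.\<close>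

locale simple_polygon =
  fixes \<eta> :: "'n::finite \<Rightarrow> 'a::euclidean_space" and \<kappa> :: "real^'n"
  assumes dim2: "DIM('a) = 2" and simple: "simple_polytope \<eta> \<kappa>"
begin

lemma bounded_poly: "bounded (poly_set \<eta> \<kappa>)"
  using simple by (simp add: simple_polytope_def is_polytope_def)

lemma facet_nonempty: "poly_facet \<eta> \<kappa> i \<noteq> {}"
proof
  assume e: "poly_facet \<eta> \<kappa> i = {}"
  obtain a b where "a \<noteq> 0" "affine hull poly_facet \<eta> \<kappa> i = {x. a \<bullet> x = b}"
    using simple unfolding simple_polytope_def is_polytope_def spans_hyperplane_def by blast
  then have "(b / (a \<bullet> a)) *\<^sub>R a \<in> affine hull poly_facet \<eta> \<kappa> i" by simp
  then show False by (simp add: e)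
qed

lemma conormal_nonzero: "\<eta> i \<noteq> 0"
proof
  assume z: "\<eta> i = 0"
  obtain x where "x \<in> poly_facet \<eta> \<kappa> i" using facet_nonempty by blast
  then have "poly_facet \<eta> \<kappa> i = poly_set \<eta> \<kappa>"
    using z by (auto simp: mem_poly_facet mem_poly_set)
  moreover have "affine hull poly_set \<eta> \<kappa> = UNIV"
    using simple by (simp add: simple_polytope_def is_polytope_def)
  moreover obtain a b where ab: "a \<noteq> 0" "affine hull poly_facet \<eta> \<kappa> i = {x. a \<bullet> x = b}"
    using simple unfolding simple_polytope_def is_polytope_def spans_hyperplane_def by blast
  ultimately have "((b + 1) / (a \<bullet> a)) *\<^sub>R a \<in> {x. a \<bullet> x = b}" by simp
  then show False using \<open>a \<noteq> 0\<close> by simp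
qed

lemma affine_hull_facet: "affine hull poly_facet \<eta> \<kappa> i = {x. \<eta> i \<bullet> x = \<kappa> $ i}"
proof -
  obtain a b where ab: "a \<noteq> 0" "affine hull poly_facet \<eta> \<kappa> i = {x. a \<bullet> x = b}"
    using simple unfolding simple_polytope_def is_polytope_def spans_hyperplane_def by blast
  let ?L = "{x. \<eta> i \<bullet> x = \<kappa> $ i}"
  have "aff_dim (poly_facet \<eta> \<kappa> i) = aff_dim ?L"
    using ab conormal_nonzero[of i] aff_dim_affine_hull[of "poly_facet \<eta> \<kappa> i"]
      aff_dim_hyperplane[of a b] by simp
  moreover have "poly_facet \<eta> \<kappa> i \<subseteq> ?L" by (auto simp: mem_poly_facet)
  ultimately have "affine hull poly_facet \<eta> \<kappa> i = affine hull ?L"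
    using aff_dim_psubset[of "poly_facet \<eta> \<kappa> i" ?L] hull_mono[of "poly_facet \<eta> \<kappa> i" ?L affine] by auto
  then show ?thesis by (simp add: affine_hyperplane affine_hull_eq[THEN iffD2])
qed

lemma aff_dim_facet: "aff_dim (poly_facet \<eta> \<kappa> i) = 1"
  using aff_dim_affine_hull[of "poly_facet \<eta> \<kappa> i"] aff_dim_hyperplane[OF conormal_nonzero, of i "\<kappa> $ i"] dim2
  by (simp add: affine_hull_facet)

lemma aff_dim_poly_set: "aff_dim (poly_set \<eta> \<kappa>) = 2"
  using simple dim2 aff_dim_eq_full[of "poly_set \<eta> \<kappa>"] by (simp add: simple_polytope_def is_polytope_def)

lemma interior_nonempty: "interior (poly_set \<eta> \<kappa>) \<noteq> {}"
proof -
  have aff: "affine hull poly_set \<eta> \<kappa> = UNIV"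
    using simple by (simp add: simple_polytope_def is_polytope_def)
  then have "poly_set \<eta> \<kappa> \<noteq> {}" by auto
  then have "rel_interior (poly_set \<eta> \<kappa>) \<noteq> {}" by (simp add: rel_interior_eq_empty)
  then show ?thesis using rel_interior_interior[OF aff] by simp
qed

lemma interior_strict:
  assumes "x \<in> interior (poly_set \<eta> \<kappa>)"
  shows "\<eta> i \<bullet> x < \<kappa> $ i"
proof -
  obtain e where e: "e > 0" "cball x e \<subseteq> poly_set \<eta> \<kappa>" using assms by (auto simp: mem_interior_cball)
  define y where "y = x + (e / norm (\<eta> i)) *\<^sub>R \<eta> i"
  have "y \<in> cball x e" using e(1) conormal_nonzero[of i] by (simp add: y_def dist_norm)
  then have "\<eta> i \<bullet> y \<le> \<kappa> $ i" using e by (auto simp: mem_poly_set)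
  moreover have "(e / norm (\<eta> i)) * (\<eta> i \<bullet> \<eta> i) > 0" using e(1) conormal_nonzero[of i] by simp
  ultimately show ?thesis by (simp add: y_def inner_add_right)
qed

lemma strict_point: obtains x where "\<forall>k. \<eta> k \<bullet> x < \<kappa> $ k"
proof -
  obtain x where "x \<in> interior (poly_set \<eta> \<kappa>)" using interior_nonempty by blast
  then show ?thesis by (intro that allI interior_strict)
qed

lemma no_recession: "(\<forall>k. \<eta> k \<bullet> y \<le> 0) \<Longrightarrow> y = 0"
proof -
  obtain x where "x \<in> interior (poly_set \<eta> \<kappa>)" using interior_nonempty by blast
  then have "x \<in> poly_set \<eta> \<kappa>" using interior_subset by blast
  then show "(\<forall>k. \<eta> k \<bullet> y \<le> 0) \<Longrightarrow> y = 0" by (rule bounded_imp_no_recession[OF bounded_poly])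
qed

lemma compact_poly_set: "compact (poly_set \<eta> \<kappa>')"
proof -
  have "bounded (poly_set \<eta> \<kappa>')" by (rule bounded_if_no_recession) (rule no_recession)
  then show ?thesis by (simp add: compact_eq_bounded_closed)
qed

lemma facet_segment:
  obtains p q where "p \<noteq> q" "poly_facet \<eta> \<kappa> i = closed_segment p q"
proof -
  let ?F = "poly_facet \<eta> \<kappa> i"
  have "compact ?F" unfolding poly_facet_def using compact_poly_set closed_hyperplane by (rule compact_Int_closed)
  moreover have "convex ?F" using poly_facet_face_of face_of_imp_convex by blast
  moreover have "collinear ?F" by (simp add: collinear_aff_dim aff_dim_facet)
  ultimately obtain p q where pq: "?F = closed_segment p q"
    using facet_nonempty compact_convex_collinear_segment by blast
  have "p \<noteq> q" using aff_dim_facet[of i] pq by auto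
  then show ?thesis using pq that by blast
qed

lemma facet_endpoint:
  assumes "poly_facet \<eta> \<kappa> i = closed_segment p q"
  shows "card (facets_at \<eta> \<kappa> p) = 2" "i \<in> facets_at \<eta> \<kappa> p" "p extreme_point_of poly_set \<eta> \<kappa>"
proof -
  have "p extreme_point_of poly_facet \<eta> \<kappa> i" using assms by (simp add: extreme_point_of_segment)
  then show e: "p extreme_point_of poly_set \<eta> \<kappa>"
    using extreme_point_of_face[OF poly_facet_face_of] by blast
  then show "card (facets_at \<eta> \<kappa> p) = 2"
    using simple dim2 by (simp add: simple_polytope_def)
  show "i \<in> facets_at \<eta> \<kappa> p" using assms by (simp add: facets_at_def)
qed

text \<open>This is where simplicity enters: a facet contained in another one would have an endpoint that
  lies on these two facets only, both in the same line, and so would not be a vertex.\<close>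

lemma facet_not_subset:
  assumes "k \<noteq> i"
  shows "\<not> poly_facet \<eta> \<kappa> i \<subseteq> poly_facet \<eta> \<kappa> k"
proof
  assume sub: "poly_facet \<eta> \<kappa> i \<subseteq> poly_facet \<eta> \<kappa> k"
  obtain p q where pq: "p \<noteq> q" "poly_facet \<eta> \<kappa> i = closed_segment p q" by (rule facet_segment)
  have "{i, k} \<subseteq> facets_at \<eta> \<kappa> p" using sub pq(2) by (auto simp: facets_at_def)
  then have at: "facets_at \<eta> \<kappa> p = {i, k}"
    using assms facet_endpoint(1)[OF pq(2)] card_subset_eq[of "facets_at \<eta> \<kappa> p" "{i, k}"] by simp
  have "\<eta> m \<bullet> (q - p) = 0" if "m \<in> {i, k}" for m
  proof -
    have "{p, q} \<subseteq> poly_facet \<eta> \<kappa> m" using that sub pq(2) by auto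
    then show ?thesis by (simp add: mem_poly_facet inner_diff_right)
  qed
  then have "\<not> p extreme_point_of poly_set \<eta> \<kappa>"
    using pq at by (intro not_extreme_point_poly_set[where y = "q - p"])
      (auto simp: mem_poly_set facets_at_def mem_poly_facet)
  then show False using facet_endpoint(3)[OF pq(2)] by blast
qed

lemma tight_inside_facet:
  assumes F: "poly_facet \<eta> \<kappa> i = closed_segment p q" and x: "x \<in> open_segment p q"
    and k: "k \<noteq> i"
  shows "\<eta> k \<bullet> x < \<kappa> $ k"
proof (rule ccontr)
  assume neg: "\<not> ?thesis"
  obtain u where u: "0 < u" "u < 1" "x = (1 - u) *\<^sub>R p + u *\<^sub>R q" using x by (auto simp: in_segment)
  have xF: "x \<in> poly_facet \<eta> \<kappa> k"
    using neg x F by (metis mem_poly_facet open_closed_segment antisym_conv2)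
  have "closed_segment p q \<subseteq> poly_facet \<eta> \<kappa> k"
  proof (rule subset_of_face_of[OF poly_facet_face_of])
    show "closed_segment p q \<subseteq> poly_set \<eta> \<kappa>" using F by (auto simp: poly_facet_def)
    have "p \<noteq> q" using x by auto
    then show "poly_facet \<eta> \<kappa> k \<inter> rel_interior (closed_segment p q) \<noteq> {}"
      using x xF by (auto simp: rel_interior_closed_segment)
  qed
  then show False using facet_not_subset[OF k] F by simp
qed

lemma facet_strict_point:
  obtains p where "\<eta> i \<bullet> p = \<kappa> $ i" "\<forall>k. k \<noteq> i \<longrightarrow> \<eta> k \<bullet> p < \<kappa> $ k"
proof -
  obtain p q where pq: "p \<noteq> q" "poly_facet \<eta> \<kappa> i = closed_segment p q" by (rule facet_segment)
  then obtain x where x: "x \<in> open_segment p q" by (meson ex_in_conv open_segment_eq_empty)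
  then have "x \<in> poly_facet \<eta> \<kappa> i" using pq(2) open_closed_segment by blast
  then show ?thesis using tight_inside_facet[OF pq(2) x] by (intro that[of x]) (simp_all add: mem_poly_facet)
qed

lemma conormals_not_proportional:
  assumes "i \<noteq> j" "v \<in> poly_facet \<eta> \<kappa> i" "v \<in> poly_facet \<eta> \<kappa> j"
  shows "\<nexists>c. \<eta> j = c *\<^sub>R \<eta> i"
proof
  assume "\<exists>c. \<eta> j = c *\<^sub>R \<eta> i"
  then obtain c where c: "\<eta> j = c *\<^sub>R \<eta> i" by blast
  obtain p where p: "\<eta> i \<bullet> p = \<kappa> $ i" "\<forall>k. k \<noteq> i \<longrightarrow> \<eta> k \<bullet> p < \<kappa> $ k" by (rule facet_strict_point)
  have "\<kappa> $ j = \<eta> j \<bullet> p" using assms(2,3) p(1) c by (simp add: mem_poly_facet)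
  then show False using p(2) assms(1) by fastforce
qed

lemma conormals_dual:
  assumes "adjacent \<eta> \<kappa> i j"
  obtains w where "\<eta> i \<bullet> w = a" "\<eta> j \<bullet> w = b"
proof -
  have "\<nexists>c. \<eta> j = c *\<^sub>R \<eta> i" using assms conormals_not_proportional unfolding adjacent_def by blast
  then show ?thesis
    using independent_functionals_2d[OF dim2 conormal_nonzero] that by blast
qed

lemma facets_at_vertex:
  assumes "i \<noteq> j" "v \<in> poly_facet \<eta> \<kappa> i" "v \<in> poly_facet \<eta> \<kappa> j"
  shows "v extreme_point_of poly_set \<eta> \<kappa>" "facets_at \<eta> \<kappa> v = {i, j}"
proof -
  have np: "\<nexists>c. \<eta> j = c *\<^sub>R \<eta> i" by (rule conormals_not_proportional[OF assms])
  show ext: "v extreme_point_of poly_set \<eta> \<kappa>"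
    unfolding extreme_point_of_def
  proof (intro conjI ballI notI)
    show "v \<in> poly_set \<eta> \<kappa>" using assms(2) by (simp add: poly_facet_def)
    fix a b assume ab: "a \<in> poly_set \<eta> \<kappa>" "b \<in> poly_set \<eta> \<kappa>" "v \<in> open_segment a b"
    have "{a, b} \<subseteq> poly_facet \<eta> \<kappa> m" if "v \<in> poly_facet \<eta> \<kappa> m" for m
      using poly_facet_face_of[of \<eta> \<kappa> m] ab that unfolding face_of_def by blast
    then have "\<eta> m \<bullet> (a - b) = 0" if "m \<in> {i, j}" for m
      using that assms by (auto simp: mem_poly_facet inner_diff_right)
    moreover have "a - b \<noteq> 0" using ab(3) by auto
    ultimately show False
      using orthogonal_parallel_2d[OF dim2 _ conormal_nonzero, of "a - b" i "\<eta> j"] np by auto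
  qed
  have "card (facets_at \<eta> \<kappa> v) = 2" using ext simple dim2 by (simp add: simple_polytope_def)
  moreover have "{i, j} \<subseteq> facets_at \<eta> \<kappa> v" using assms by (simp add: facets_at_def)
  ultimately show "facets_at \<eta> \<kappa> v = {i, j}"
    using assms(1) card_subset_eq[of "facets_at \<eta> \<kappa> v" "{i, j}"] by simp
qed

lemma adjacent_vertex:
  assumes "adjacent \<eta> \<kappa> i j"
  obtains v where "\<eta> i \<bullet> v = \<kappa> $ i" "\<eta> j \<bullet> v = \<kappa> $ j"
    "\<forall>k. k \<notin> {i, j} \<longrightarrow> \<eta> k \<bullet> v < \<kappa> $ k"
    "v extreme_point_of poly_set \<eta> \<kappa>" "facets_at \<eta> \<kappa> v = {i, j}"
proof -
  have ne: "i \<noteq> j" "poly_facet \<eta> \<kappa> i \<inter> poly_facet \<eta> \<kappa> j \<noteq> {}"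
    using assms by (simp_all add: adjacent_def)
  from ne(2) obtain v where v: "v \<in> poly_facet \<eta> \<kappa> i" "v \<in> poly_facet \<eta> \<kappa> j"
    by (metis IntE ex_in_conv)
  note vertex = facets_at_vertex[OF ne(1) v]
  have strict: "\<forall>k. k \<notin> {i, j} \<longrightarrow> \<eta> k \<bullet> v < \<kappa> $ k"
  proof (intro allI impI)
    fix k assume k: "k \<notin> {i, j}"
    have "v \<notin> poly_facet \<eta> \<kappa> k" using k vertex(2) by (auto simp: facets_at_def)
    then show "\<eta> k \<bullet> v < \<kappa> $ k" using v(1) by (auto simp: mem_poly_facet less_le)
  qed
  have tight: "\<eta> i \<bullet> v = \<kappa> $ i" "\<eta> j \<bullet> v = \<kappa> $ j"
    using v by (simp_all add: mem_poly_facet)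
  show ?thesis by (rule that[OF tight strict vertex])
qed

lemma card_adjacent: "card {j. adjacent \<eta> \<kappa> i j} = 2"
proof -
  obtain p q where pq: "p \<noteq> q" "poly_facet \<eta> \<kappa> i = closed_segment p q" by (rule facet_segment)
  then have qp: "poly_facet \<eta> \<kappa> i = closed_segment q p" by (simp add: closed_segment_commute)
  have ex: "\<exists>k. k \<noteq> i \<and> A = {i, k}" if "card A = 2" "i \<in> A" for A :: "'n set"
    using that by (auto simp: card_2_iff)
  obtain k where k: "k \<noteq> i" "facets_at \<eta> \<kappa> p = {i, k}"
    using ex facet_endpoint(1,2)[OF pq(2)] by blast
  obtain l where l: "l \<noteq> i" "facets_at \<eta> \<kappa> q = {i, l}"
    using ex facet_endpoint(1,2)[OF qp] by blast
  have pk: "p \<in> poly_facet \<eta> \<kappa> k" "q \<in> poly_facet \<eta> \<kappa> l"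
    using k l by (auto simp: facets_at_def)
  have "k \<noteq> l"
  proof
    assume "k = l"
    then have "closed_segment p q \<subseteq> poly_facet \<eta> \<kappa> k"
      using pk closed_segment_subset[of p _ q] face_of_imp_convex[OF poly_facet_face_of] by metis
    then show False using facet_not_subset[OF k(1)] pq(2) by simp
  qed
  moreover have "{j. adjacent \<eta> \<kappa> i j} = {k, l}"
  proof -
    have "j \<in> {k, l}" if "adjacent \<eta> \<kappa> i j" for j
    proof -
      obtain x where x: "j \<noteq> i" "x \<in> closed_segment p q" "x \<in> poly_facet \<eta> \<kappa> j"
        using \<open>adjacent \<eta> \<kappa> i j\<close> pq(2) by (auto simp: adjacent_def)
      have "x \<notin> open_segment p q"
        using tight_inside_facet[OF pq(2), of x j] x by (auto simp: mem_poly_facet)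
      then have "x = p \<or> x = q" using x(2) by (simp add: open_segment_def)
      then have "j \<in> facets_at \<eta> \<kappa> p \<or> j \<in> facets_at \<eta> \<kappa> q" using x(3) by (auto simp: facets_at_def)
      then show ?thesis using k l x(1) by auto
    qed
    moreover have "adjacent \<eta> \<kappa> i k" "adjacent \<eta> \<kappa> i l"
      using k l pk pq(2) by (auto simp: adjacent_def)
    ultimately show ?thesis by blast
  qed
  ultimately show ?thesis by simp
qed

lemma frontier_eq_facets: "frontier (poly_set \<eta> \<kappa>) = (\<Union>i. poly_facet \<eta> \<kappa> i)"
proof -
  have "x \<in> interior (poly_set \<eta> \<kappa>) \<longleftrightarrow> (\<forall>i. \<eta> i \<bullet> x < \<kappa> $ i)" for x
    using interior_strict strict_imp_interior by blast
  then have "x \<in> frontier (poly_set \<eta> \<kappa>) \<longleftrightarrow> (\<forall>k. \<eta> k \<bullet> x \<le> \<kappa> $ k) \<and> (\<exists>i. \<not> \<eta> i \<bullet> x < \<kappa> $ i)" for x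
    by (simp add: frontier_def mem_poly_set)
  then have "x \<in> frontier (poly_set \<eta> \<kappa>) \<longleftrightarrow> (\<exists>i. x \<in> poly_facet \<eta> \<kappa> i)" for x
    unfolding mem_poly_facet by (metis less_le)
  then show ?thesis by blast
qed

text \<open>The boundary of a convex polygon is connected, so it is not the union of two disjoint closed
  unions of facets.\<close>

lemma adjacent_connected:
  assumes "J \<noteq> {}" "J \<noteq> UNIV"
  obtains i j where "i \<in> J" "j \<notin> J" "adjacent \<eta> \<kappa> i j"
proof -
  let ?P = "poly_set \<eta> \<kappa>" and ?A = "\<Union>i\<in>J. poly_facet \<eta> \<kappa> i" and ?B = "\<Union>i\<in>-J. poly_facet \<eta> \<kappa> i"
  have "aff_dim ?P = 2"
    by (rule aff_dim_poly_set)
  then have "connected (rel_frontier ?P)"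
    using bounded_poly by (intro connected_sphere_gen) auto
  then have con: "connected (frontier ?P)"
    using interior_nonempty rel_frontier_nonempty_interior by metis
  have cl: "closed (poly_facet \<eta> \<kappa> i)" for i
    unfolding poly_facet_def by (intro closed_Int closed_hyperplane) simp
  have "closed ?A" "closed ?B" using cl by (auto intro!: closed_UN)
  moreover have "frontier ?P \<subseteq> ?A \<union> ?B" unfolding frontier_eq_facets by blast
  moreover have "?A \<inter> frontier ?P \<noteq> {}"
    unfolding frontier_eq_facets using facet_nonempty assms(1) by blast
  moreover have "?B \<inter> frontier ?P \<noteq> {}"
    unfolding frontier_eq_facets using facet_nonempty assms(2) by blast
  ultimately have "?A \<inter> ?B \<inter> frontier ?P \<noteq> {}"
    using connected_closedD[OF con, of ?A ?B] by blast
  then obtain i j where "i \<in> J" "j \<in> - J" "poly_facet \<eta> \<kappa> i \<inter> poly_facet \<eta> \<kappa> j \<noteq> {}" by blast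
  then show ?thesis using that[of i j] by (auto simp: adjacent_def)
qed

text \<open>Simple polygons and their adjacency relation are stable under small changes of the support
  numbers.\<close>

lemma eventually_same_type:
  "\<forall>\<^sub>F \<kappa>' in nhds \<kappa>. simple_polytope \<eta> \<kappa>' \<and> (\<forall>i j. adjacent \<eta> \<kappa>' i j \<longleftrightarrow> adjacent \<eta> \<kappa> i j)"
proof -
  obtain x0 where x0: "\<forall>k. \<eta> k \<bullet> x0 < \<kappa> $ k" by (rule strict_point)
  have E0: "\<forall>\<^sub>F \<kappa>' in nhds \<kappa>. \<exists>x. \<forall>k. \<eta> k \<bullet> x < \<kappa>' $ k"
    using eventually_contact[of "{}" \<eta> _ x0 \<kappa>] x0 by simp
  have E1: "\<forall>\<^sub>F \<kappa>' in nhds \<kappa>. \<forall>i. \<exists>p. \<eta> i \<bullet> p = \<kappa>' $ i \<and> (\<forall>k. k \<noteq> i \<longrightarrow> \<eta> k \<bullet> p < \<kappa>' $ k)"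
  proof (rule eventually_all_finite)
    fix i
    obtain p where p: "\<eta> i \<bullet> p = \<kappa> $ i" "\<forall>k. k \<noteq> i \<longrightarrow> \<eta> k \<bullet> p < \<kappa> $ k" by (rule facet_strict_point)
    show "\<forall>\<^sub>F \<kappa>' in nhds \<kappa>. \<exists>p. \<eta> i \<bullet> p = \<kappa>' $ i \<and> (\<forall>k. k \<noteq> i \<longrightarrow> \<eta> k \<bullet> p < \<kappa>' $ k)"
      using eventually_contact[of "{i}" \<eta> "\<lambda>_. (1 / (\<eta> i \<bullet> \<eta> i)) *\<^sub>R \<eta> i" p \<kappa>] p conormal_nonzero[of i]
      by simp
  qed
  have E2: "\<forall>\<^sub>F \<kappa>' in nhds \<kappa>. \<forall>i j k. i \<noteq> j \<and> i \<noteq> k \<and> j \<noteq> k \<longrightarrow>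
      \<not> (\<exists>x\<in>poly_set \<eta> \<kappa>'. \<forall>m\<in>{i, j, k}. \<eta> m \<bullet> x = \<kappa>' $ m)"
  proof (intro eventually_all_finite)
    fix i j k
    have no: "\<not> (\<exists>x\<in>poly_set \<eta> \<kappa>. \<forall>m\<in>{i, j, k}. \<eta> m \<bullet> x = \<kappa> $ m)" if d: "i \<noteq> j \<and> i \<noteq> k \<and> j \<noteq> k"
    proof
      assume "\<exists>x\<in>poly_set \<eta> \<kappa>. \<forall>m\<in>{i, j, k}. \<eta> m \<bullet> x = \<kappa> $ m"
      then obtain x where "x \<in> poly_set \<eta> \<kappa>" "\<forall>m\<in>{i, j, k}. \<eta> m \<bullet> x = \<kappa> $ m" by blast
      then have x: "x \<in> poly_facet \<eta> \<kappa> m" if "m \<in> {i, j, k}" for m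
        using that by (auto simp: mem_poly_facet mem_poly_set)
      then have "k \<in> facets_at \<eta> \<kappa> x" by (simp add: facets_at_def)
      moreover have "facets_at \<eta> \<kappa> x = {i, j}" using d x by (intro facets_at_vertex) auto
      ultimately show False using d by auto
    qed
    show "\<forall>\<^sub>F \<kappa>' in nhds \<kappa>. i \<noteq> j \<and> i \<noteq> k \<and> j \<noteq> k \<longrightarrow>
      \<not> (\<exists>x\<in>poly_set \<eta> \<kappa>'. \<forall>m\<in>{i, j, k}. \<eta> m \<bullet> x = \<kappa>' $ m)"
    proof (cases "i \<noteq> j \<and> i \<noteq> k \<and> j \<noteq> k")
      case True
      from eventually_no_contact[OF no_recession no[OF True]] show ?thesis
        by (rule eventually_mono) simp_all
    next
      case False then show ?thesis by (intro always_eventually) blast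
    qed
  qed
  have E3: "\<forall>\<^sub>F \<kappa>' in nhds \<kappa>. \<forall>i j. adjacent \<eta> \<kappa>' i j \<longleftrightarrow> adjacent \<eta> \<kappa> i j"
  proof (intro eventually_all_finite)
    fix i j
    show "\<forall>\<^sub>F \<kappa>' in nhds \<kappa>. adjacent \<eta> \<kappa>' i j \<longleftrightarrow> adjacent \<eta> \<kappa> i j"
    proof (cases "adjacent \<eta> \<kappa> i j")
      case True
      obtain v where v: "\<eta> i \<bullet> v = \<kappa> $ i" "\<eta> j \<bullet> v = \<kappa> $ j"
        "\<forall>k. k \<notin> {i, j} \<longrightarrow> \<eta> k \<bullet> v < \<kappa> $ k"
        "v extreme_point_of poly_set \<eta> \<kappa>" "facets_at \<eta> \<kappa> v = {i, j}"
        by (rule adjacent_vertex[OF True])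
      have ij: "i \<noteq> j" using True by (simp add: adjacent_def)
      obtain w1 where w1: "\<eta> i \<bullet> w1 = 1" "\<eta> j \<bullet> w1 = 0" using conormals_dual[OF True] .
      obtain w2 where w2: "\<eta> i \<bullet> w2 = 0" "\<eta> j \<bullet> w2 = 1" using conormals_dual[OF True] .
      have "\<forall>\<^sub>F \<kappa>' in nhds \<kappa>. \<exists>p'. (\<forall>m\<in>{i, j}. \<eta> m \<bullet> p' = \<kappa>' $ m) \<and>
          (\<forall>k. k \<notin> {i, j} \<longrightarrow> \<eta> k \<bullet> p' < \<kappa>' $ k)"
        by (rule eventually_contact[where W = "\<lambda>m. if m = i then w1 else w2" and p = v])
          (use ij w1 w2 v in auto)
      then show ?thesis
      proof (rule eventually_mono)
        fix \<kappa>' assume "\<exists>p'. (\<forall>m\<in>{i, j}. \<eta> m \<bullet> p' = \<kappa>' $ m) \<and> (\<forall>k. k \<notin> {i, j} \<longrightarrow> \<eta> k \<bullet> p' < \<kappa>' $ k)"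
        then obtain p' where p': "\<forall>m\<in>{i, j}. \<eta> m \<bullet> p' = \<kappa>' $ m" "\<And>k. k \<notin> {i, j} \<Longrightarrow> \<eta> k \<bullet> p' < \<kappa>' $ k"
          by blast
        have "p' \<in> poly_set \<eta> \<kappa>'" unfolding mem_poly_set using p' by (metis order.refl less_imp_le)
        then show "adjacent \<eta> \<kappa>' i j \<longleftrightarrow> adjacent \<eta> \<kappa> i j"
          using True ij p'(1) unfolding adjacent_iff by blast
      qed
    next
      case False
      show ?thesis
      proof (cases "i = j")
        case True then show ?thesis by (simp add: adjacent_def)
      next
        case ne: False
        then have "\<not> (\<exists>x\<in>poly_set \<eta> \<kappa>. \<forall>m\<in>{i, j}. \<eta> m \<bullet> x = \<kappa> $ m)"
          using False by (simp add: adjacent_iff)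
        from eventually_no_contact[OF no_recession this] show ?thesis
          by (rule eventually_mono) (use False in \<open>auto simp: adjacent_iff\<close>)
      qed
    qed
  qed
  from E0 E1 E2 E3 show ?thesis
  proof eventually_elim
    case (elim \<kappa>')
    from elim(1) obtain x where x: "\<forall>k. \<eta> k \<bullet> x < \<kappa>' $ k" by blast
    have "simple_polytope \<eta> \<kappa>'"
    proof (rule simple_polytopeI[OF dim2 conormal_nonzero])
      show "\<And>y. \<forall>k. \<eta> k \<bullet> y \<le> 0 \<Longrightarrow> y = 0" by (rule no_recession)
      show "\<And>k. \<eta> k \<bullet> x < \<kappa>' $ k" using x by blast
    qed (use elim(2,3) in \<open>simp_all only: simp_thms not_False_eq_True\<close>)
    then show ?case using elim(4) by blast
  qed
qed

lemma chamber_neighbourhood: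
  obtains e where "e > 0" "\<And>\<kappa>'. dist \<kappa>' \<kappa> < e \<Longrightarrow> \<kappa>' \<in> chamber \<eta> \<kappa>"
    "\<And>\<kappa>'. dist \<kappa>' \<kappa> < e \<Longrightarrow> simple_polytope \<eta> \<kappa>'"
    "\<And>\<kappa>' i j. dist \<kappa>' \<kappa> < e \<Longrightarrow> adjacent \<eta> \<kappa>' i j \<longleftrightarrow> adjacent \<eta> \<kappa> i j"
proof -
  obtain e where e: "e > 0" "\<And>\<kappa>'. dist \<kappa>' \<kappa> < e \<Longrightarrow>
      simple_polytope \<eta> \<kappa>' \<and> (\<forall>i j. adjacent \<eta> \<kappa>' i j \<longleftrightarrow> adjacent \<eta> \<kappa> i j)"
    using eventually_same_type unfolding eventually_nhds_metric by blast
  have ball: "ball \<kappa> e \<subseteq> chamber \<eta> \<kappa>"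
    unfolding chamber_def using e by (intro connected_component_maximal) (auto simp: dist_commute)
  show ?thesis
  proof (rule that[OF e(1)])
    show "\<kappa>' \<in> chamber \<eta> \<kappa>" if "dist \<kappa>' \<kappa> < e" for \<kappa>'
      using that ball by (auto simp: dist_commute)
  qed (simp_all add: e(2))
qed

end

lemma chamber_simple: "\<kappa>' \<in> chamber \<eta> \<kappa> \<Longrightarrow> simple_polytope \<eta> \<kappa>'"
  unfolding chamber_def using connected_component_subset by blast


section \<open>Area and moment\<close>

text \<open>The area of a polygon as a function of its support numbers.\<close>

definition area :: "('n::finite \<Rightarrow> 'a::euclidean_space) \<Rightarrow> real^'n \<Rightarrow> real" where
  "area \<eta> \<kappa> = measure lborel (poly_set \<eta> \<kappa>)"

text \<open>The integral of the position vector, that is, area times center of mass.\<close>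

definition moment :: "('n::finite \<Rightarrow> 'a::euclidean_space) \<Rightarrow> real^'n \<Rightarrow> 'a" where
  "moment \<eta> \<kappa> = (LINT x:poly_set \<eta> \<kappa>|lborel. x)"

lemma set_integrable_id_compact:
  fixes S :: "'a::euclidean_space set"
  shows "compact S \<Longrightarrow> set_integrable lborel S (\<lambda>x. x)"
  unfolding set_integrable_def by (rule borel_integrable_compact) (auto intro: continuous_intros)

lemma moment_additive:
  fixes A B :: "'a::euclidean_space set"
  assumes "compact A" "compact B"
  shows "(LINT x:A \<union> B|lborel. x) + (LINT x:A \<inter> B|lborel. x) = (LINT x:A|lborel. x) + (LINT x:B|lborel. x)"
proof -
  note i = set_integrable_id_compact[unfolded set_integrable_def]
  have "(LINT x:A \<union> B|lborel. x) + (LINT x:A \<inter> B|lborel. x)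
      = (LINT x|lborel. indicator (A \<union> B) x *\<^sub>R x + indicator (A \<inter> B) x *\<^sub>R x)"
    unfolding set_lebesgue_integral_def using assms
    by (subst Bochner_Integration.integral_add) (auto intro!: i compact_Un compact_Int)
  also have "\<dots> = (LINT x|lborel. indicator A x *\<^sub>R x + indicator B x *\<^sub>R x)"
    by (intro Bochner_Integration.integral_cong) (auto simp: indicator_def)
  also have "\<dots> = (LINT x:A|lborel. x) + (LINT x:B|lborel. x)"
    unfolding set_lebesgue_integral_def using assms
    by (subst Bochner_Integration.integral_add) (auto intro!: i)
  finally show ?thesis .
qed

lemma measure_less_open:
  fixes A B :: "'a::euclidean_space set"
  assumes "compact A" "compact B" "A \<subseteq> B" "open U" "x \<in> U" "U \<subseteq> B - A"
  shows "measure lborel A < measure lborel B"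
proof -
  obtain r where r: "r > 0" "cball x r \<subseteq> U" using assms(4,5) open_contains_cball by blast
  have fm: "A \<in> fmeasurable lborel" "B \<in> fmeasurable lborel" "cball x r \<in> fmeasurable lborel"
    using assms(1,2) by (auto intro: fmeasurable_compact)
  have "A \<inter> cball x r = {}" using r assms(6) by blast
  then have "measure lborel A + measure lborel (cball x r) = measure lborel (A \<union> cball x r)"
    using fm measure_Un3[OF fm(1,3)] by simp
  also have "\<dots> \<le> measure lborel B"
    using r assms(3,6) fm by (intro measure_mono_fmeasurable) auto
  finally show ?thesis using content_cball_pos[OF r(1), of x] by linarith
qed

text \<open>Behaviour of the area and of the center of mass under a measure preserving affine map
  \<open>x \<mapsto> f x + v\<close>.\<close>

lemma measure_preimage:
  fixes T :: "'a::euclidean_space \<Rightarrow> 'a"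
  assumes "T \<in> borel_measurable borel" "distr lborel borel T = lborel" "S \<in> sets borel"
  shows "measure lborel (T -` S) = measure lborel S"
proof -
  have "measure lborel S = measure (distr lborel borel T) S" by (simp add: assms(2))
  also have "\<dots> = measure lborel (T -` S)" using assms by (subst measure_distr) auto
  finally show ?thesis by simp
qed

lemma center_of_mass_affine:
  fixes f :: "'a::euclidean_space \<Rightarrow> 'a"
  assumes f: "linear f" and T: "distr lborel borel (\<lambda>x. f x + v) = lborel"
    and S: "compact S'" "closed S" "S' = (\<lambda>x. f x + v) -` S" "measure lborel S' \<noteq> 0"
  shows "center_of_mass S = f (center_of_mass S') + v"
proof -
  let ?T = "\<lambda>x. f x + v"
  have bl: "bounded_linear f" using f by (simp add: linear_conv_bounded_linear)
  have bm: "?T \<in> borel_measurable borel"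
    using f by (intro borel_measurable_continuous_onI continuous_intros linear_continuous_on bl)
  have Sb: "S \<in> sets borel" using S(2) by simp
  have meas: "measure lborel S' = measure lborel S"
    using measure_preimage[OF bm T Sb] S(3) by simp
  have int: "integrable lborel (\<lambda>x. indicator S' x *\<^sub>R x)"
    using set_integrable_id_compact[OF S(1)] by (simp add: set_integrable_def)
  have fin: "emeasure lborel S' < \<infinity>" using S(1) emeasure_compact_finite by blast
  have S'b: "S' \<in> sets lborel" using S(1) by (simp add: borel_compact)
  have "(LINT x:S|lborel. x) = (LINT x|distr lborel borel ?T. indicator S x *\<^sub>R x)"
    by (simp add: set_lebesgue_integral_def T)
  also have "\<dots> = (LINT x|lborel. indicator S (?T x) *\<^sub>R ?T x)"
    using bm Sb by (subst integral_distr) auto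
  also have "\<dots> = (LINT x|lborel. f (indicator S' x *\<^sub>R x) + indicator S' x *\<^sub>R v)"
    using S(3) by (intro Bochner_Integration.integral_cong)
      (auto simp: indicator_def linear_0[OF f])
  also have "\<dots> = (LINT x|lborel. f (indicator S' x *\<^sub>R x)) + (LINT x|lborel. indicator S' x *\<^sub>R v)"
    using fin S'b by (intro Bochner_Integration.integral_add integrable_bounded_linear[OF bl] int)
      (auto intro!: integrable_scaleR_left integrable_real_indicator)
  also have "(LINT x|lborel. f (indicator S' x *\<^sub>R x)) = f (LINT x:S'|lborel. x)"
    using integral_bounded_linear[OF bl int] by (simp add: set_lebesgue_integral_def)
  also have "(LINT x|lborel. indicator S' x *\<^sub>R v) = measure lborel S' *\<^sub>R v"
    using fin S'b by (subst integral_scaleR_left) auto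
  finally have "(LINT x:S|lborel. x) = f (LINT x:S'|lborel. x) + measure lborel S' *\<^sub>R v" .
  then show ?thesis
    using S(4) by (simp add: center_of_mass_def scaleR_add_right linear_cmul[OF f] flip: meas)
qed

section \<open>Moving facets\<close>

text \<open>The support numbers after facet \<open>i\<close> has been moved outwards by \<open>s\<close> (inwards if \<open>s < 0\<close>).\<close>

definition raise :: "real^'n::finite \<Rightarrow> 'n \<Rightarrow> real \<Rightarrow> real^'n" where
  "raise \<kappa> i s = \<kappa> + s *\<^sub>R axis i 1"

lemma raise_nth [simp]: "raise \<kappa> i s $ k = \<kappa> $ k + (if k = i then s else 0)"
  by (simp add: raise_def axis_def)

lemma raise_commute: "raise (raise \<kappa> i s) j t = raise (raise \<kappa> j t) i s"
  by (simp add: vec_eq_iff)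

lemma dist_raise: "dist (raise \<kappa> i s) \<kappa>' \<le> dist \<kappa> \<kappa>' + \<bar>s\<bar>"
proof -
  have "dist (raise \<kappa> i s) \<kappa> = \<bar>s\<bar>" by (simp add: raise_def dist_norm norm_axis_1)
  then show ?thesis using dist_triangle[of "raise \<kappa> i s" \<kappa>' \<kappa>] by simp
qed

lemma poly_set_raise_Int:
  assumes "i \<noteq> j" "s \<ge> 0" "t \<ge> 0"
  shows "poly_set \<eta> (raise \<kappa> i s) \<inter> poly_set \<eta> (raise \<kappa> j t) = poly_set \<eta> \<kappa>"
proof -
  have "x \<in> poly_set \<eta> (raise \<kappa> i s) \<and> x \<in> poly_set \<eta> (raise \<kappa> j t) \<longleftrightarrow> x \<in> poly_set \<eta> \<kappa>" for x
  proof (intro iffI conjI)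
    assume x: "x \<in> poly_set \<eta> (raise \<kappa> i s) \<and> x \<in> poly_set \<eta> (raise \<kappa> j t)"
    show "x \<in> poly_set \<eta> \<kappa>"
      unfolding mem_poly_set
    proof
      fix k
      have "\<eta> k \<bullet> x \<le> \<kappa> $ k + (if k = i then s else 0)" "\<eta> k \<bullet> x \<le> \<kappa> $ k + (if k = j then t else 0)"
        using x by (auto simp: mem_poly_set simp flip: raise_nth)
      then show "\<eta> k \<bullet> x \<le> \<kappa> $ k" using assms(1) by (auto split: if_splits)
    qed
  qed (use assms in \<open>auto simp: mem_poly_set add_increasing2\<close>)
  then show ?thesis by blast
qed

lemma poly_set_raise_mono: "s \<ge> 0 \<Longrightarrow> poly_set \<eta> \<kappa> \<subseteq> poly_set \<eta> (raise \<kappa> i s)"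
  by (auto simp: mem_poly_set add_increasing2)

text \<open>A point violating both original constraints lies, after the two facets have been moved so as to
  pass through it, on both of them; this is excluded if they stay disjoint.\<close>

lemma poly_set_raise_Un:
  assumes "i \<noteq> j" "s \<ge> 0" "t \<ge> 0"
    and no: "\<And>s' t'. 0 \<le> s' \<Longrightarrow> s' \<le> s \<Longrightarrow> 0 \<le> t' \<Longrightarrow> t' \<le> t \<Longrightarrow>
      \<not> adjacent \<eta> (raise (raise \<kappa> i s') j t') i j"
  shows "poly_set \<eta> (raise (raise \<kappa> i s) j t) = poly_set \<eta> (raise \<kappa> i s) \<union> poly_set \<eta> (raise \<kappa> j t)"
proof (intro subset_antisym subsetI)
  fix x assume "x \<in> poly_set \<eta> (raise \<kappa> i s) \<union> poly_set \<eta> (raise \<kappa> j t)"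
  then show "x \<in> poly_set \<eta> (raise (raise \<kappa> i s) j t)"
    using poly_set_raise_mono[of t \<eta> "raise \<kappa> i s" j] poly_set_raise_mono[of s \<eta> "raise \<kappa> j t" i] assms(2,3)
    by (auto simp: raise_commute[of \<kappa> j t i s])
next
  fix x assume "x \<in> poly_set \<eta> (raise (raise \<kappa> i s) j t)"
  then have x: "\<eta> k \<bullet> x \<le> \<kappa> $ k + (if k = i then s else 0) + (if k = j then t else 0)" for k
    by (simp add: mem_poly_set)
  show "x \<in> poly_set \<eta> (raise \<kappa> i s) \<union> poly_set \<eta> (raise \<kappa> j t)"
  proof (rule ccontr)
    assume out: "\<not> ?thesis"
    have i: "\<kappa> $ i < \<eta> i \<bullet> x"
    proof (rule ccontr)
      assume "\<not> ?thesis"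
      then have "\<eta> k \<bullet> x \<le> raise \<kappa> j t $ k" for k using x[of k] assms(1) by (cases "k = i") auto
      then show False using out by (simp add: mem_poly_set)
    qed
    have j: "\<kappa> $ j < \<eta> j \<bullet> x"
    proof (rule ccontr)
      assume "\<not> ?thesis"
      then have "\<eta> k \<bullet> x \<le> raise \<kappa> i s $ k" for k using x[of k] assms(1) by (cases "k = j") auto
      then show False using out by (simp add: mem_poly_set)
    qed
    let ?\<kappa>' = "raise (raise \<kappa> i (\<eta> i \<bullet> x - \<kappa> $ i)) j (\<eta> j \<bullet> x - \<kappa> $ j)"
    have "\<eta> k \<bullet> x \<le> ?\<kappa>' $ k" for k using x[of k] assms(1) by auto
    then have "x \<in> poly_set \<eta> ?\<kappa>'" by (simp add: mem_poly_set)
    moreover have "\<forall>m\<in>{i, j}. \<eta> m \<bullet> x = ?\<kappa>' $ m" using assms(1) by auto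
    ultimately have "adjacent \<eta> ?\<kappa>' i j" unfolding adjacent_iff using assms(1) by blast
    then show False using no i j x[of i] x[of j] assms(1) by auto
  qed
qed

context simple_polygon begin

lemma fmeasurable_poly_set: "poly_set \<eta> \<kappa>' \<in> fmeasurable lborel"
  using compact_poly_set by (rule fmeasurable_compact)

lemma area_pos: "0 < area \<eta> \<kappa>"
proof -
  obtain x where "x \<in> interior (poly_set \<eta> \<kappa>)" using interior_nonempty by blast
  then have "measure lborel ({}::'a set) < measure lborel (poly_set \<eta> \<kappa>)"
    using interior_subset compact_poly_set
    by (intro measure_less_open[where U = "interior (poly_set \<eta> \<kappa>)" and x = x]) auto
  then show ?thesis by (simp add: area_def)
qed

lemma area_raise_less:
  assumes "s > 0"
  shows "area \<eta> \<kappa> < area \<eta> (raise \<kappa> i s)"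
proof -
  obtain p where p: "\<eta> i \<bullet> p = \<kappa> $ i" "\<forall>k. k \<noteq> i \<longrightarrow> \<eta> k \<bullet> p < \<kappa> $ k" by (rule facet_strict_point)
  define U where "U = {x. \<kappa> $ i < \<eta> i \<bullet> x} \<inter> (\<Inter>k. {x. \<eta> k \<bullet> x < raise \<kappa> i s $ k})"
  have oU: "open U" unfolding U_def
    by (intro open_Int open_INT open_halfspace_lt open_halfspace_gt ballI) auto
  have "\<forall>\<^sub>F d in at_right 0. p + d *\<^sub>R \<eta> i \<in> (\<Inter>k. {x. \<eta> k \<bullet> x < raise \<kappa> i s $ k})"
  proof (rule topological_tendstoD)
    show "((\<lambda>d. p + d *\<^sub>R \<eta> i) \<longlongrightarrow> p + 0 *\<^sub>R \<eta> i) (at_right 0)" by (intro tendsto_intros)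
    show "open (\<Inter>k. {x. \<eta> k \<bullet> x < raise \<kappa> i s $ k})" by (intro open_INT open_halfspace_lt ballI) auto
    show "p + 0 *\<^sub>R \<eta> i \<in> (\<Inter>k. {x. \<eta> k \<bullet> x < raise \<kappa> i s $ k})" using p assms by auto
  qed
  moreover have "\<forall>\<^sub>F d in at_right 0. (d::real) > 0" by (rule eventually_at_right_less)
  ultimately have "\<forall>\<^sub>F d in at_right 0. p + d *\<^sub>R \<eta> i \<in> U"
  proof eventually_elim
    case (elim d)
    then have "d * (\<eta> i \<bullet> \<eta> i) > 0" using conormal_nonzero[of i] by simp
    then show ?case using elim p(1) by (simp add: U_def inner_add_right)
  qed
  then obtain d where d: "p + d *\<^sub>R \<eta> i \<in> U" using eventually_happens' trivial_limit_at_right_real by blast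
  have "U \<subseteq> poly_set \<eta> (raise \<kappa> i s) - poly_set \<eta> \<kappa>"
  proof
    fix x assume "x \<in> U"
    then have "\<kappa> $ i < \<eta> i \<bullet> x" "\<And>k. \<eta> k \<bullet> x < raise \<kappa> i s $ k" by (auto simp: U_def simp del: raise_nth)
    then show "x \<in> poly_set \<eta> (raise \<kappa> i s) - poly_set \<eta> \<kappa>"
      unfolding Diff_iff mem_poly_set by (meson less_imp_le not_le)
  qed
  then show ?thesis
    unfolding area_def using assms
    by (intro measure_less_open[OF compact_poly_set compact_poly_set poly_set_raise_mono oU d]) auto
qed

text \<open>The part of the polygon that appears near a common vertex when two adjacent facets are
  moved outwards simultaneously, but not when only one of them is.\<close>

lemma area_mixed_adjacent:
  assumes adj: "adjacent \<eta> \<kappa> i j" and "s > 0" "t > 0"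
  shows "area \<eta> (raise \<kappa> i s) + area \<eta> (raise \<kappa> j t) < area \<eta> (raise (raise \<kappa> i s) j t) + area \<eta> \<kappa>"
proof -
  have ij: "i \<noteq> j" using adj by (simp add: adjacent_def)
  obtain v where v: "\<eta> i \<bullet> v = \<kappa> $ i" "\<eta> j \<bullet> v = \<kappa> $ j"
    "\<forall>k. k \<notin> {i, j} \<longrightarrow> \<eta> k \<bullet> v < \<kappa> $ k"
    "v extreme_point_of poly_set \<eta> \<kappa>" "facets_at \<eta> \<kappa> v = {i, j}"
    by (rule adjacent_vertex[OF adj])
  obtain w where w: "\<eta> i \<bullet> w = 1" "\<eta> j \<bullet> w = 1" by (rule conormals_dual[OF adj])
  let ?\<kappa>' = "raise (raise \<kappa> i s) j t"
  let ?A = "poly_set \<eta> (raise \<kappa> i s)" and ?B = "poly_set \<eta> (raise \<kappa> j t)"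
  define W where "W = (\<Inter>k. {x. \<eta> k \<bullet> x < ?\<kappa>' $ k})"
  define U where "U = {x. \<kappa> $ i < \<eta> i \<bullet> x} \<inter> {x. \<kappa> $ j < \<eta> j \<bullet> x} \<inter> W"
  have oW: "open W" unfolding W_def by (intro open_INT open_halfspace_lt ballI) auto
  then have oU: "open U" unfolding U_def by (intro open_Int open_halfspace_gt)
  have "\<forall>\<^sub>F d in at_right 0. v + d *\<^sub>R w \<in> W"
  proof (rule topological_tendstoD)
    show "((\<lambda>d. v + d *\<^sub>R w) \<longlongrightarrow> v + 0 *\<^sub>R w) (at_right 0)" by (intro tendsto_intros)
    show "open W" by (rule oW)
    have "\<eta> k \<bullet> v < ?\<kappa>' $ k" for k
      using v(1-3) assms(2,3) ij by (cases "k \<in> {i, j}") auto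
    then show "v + 0 *\<^sub>R w \<in> W" by (simp add: W_def)
  qed
  moreover have "\<forall>\<^sub>F d in at_right 0. (d::real) > 0" by (rule eventually_at_right_less)
  ultimately have "\<forall>\<^sub>F d in at_right 0. v + d *\<^sub>R w \<in> U"
    by eventually_elim (simp add: U_def inner_add_right v(1,2) w)
  then obtain d where d: "v + d *\<^sub>R w \<in> U" using eventually_happens' trivial_limit_at_right_real by blast
  have sub: "?A \<union> ?B \<subseteq> poly_set \<eta> ?\<kappa>'"
    using poly_set_raise_mono[of t \<eta> "raise \<kappa> i s" j] poly_set_raise_mono[of s \<eta> "raise \<kappa> j t" i] assms(2,3)
    by (auto simp: raise_commute[of \<kappa> j t i s])
  have "U \<subseteq> poly_set \<eta> ?\<kappa>' - (?A \<union> ?B)"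
  proof
    fix x assume "x \<in> U"
    then have x: "\<kappa> $ i < \<eta> i \<bullet> x" "\<kappa> $ j < \<eta> j \<bullet> x" "\<And>k. \<eta> k \<bullet> x < ?\<kappa>' $ k"
      by (auto simp: U_def W_def simp del: raise_nth)
    have "x \<notin> ?A"
    proof
      assume "x \<in> ?A"
      then have "\<eta> j \<bullet> x \<le> raise \<kappa> i s $ j" unfolding mem_poly_set by blast
      then show False using x(2) ij by simp
    qed
    moreover have "x \<notin> ?B"
    proof
      assume "x \<in> ?B"
      then have "\<eta> i \<bullet> x \<le> raise \<kappa> j t $ i" unfolding mem_poly_set by blast
      then show False using x(1) ij by simp
    qed
    moreover have "x \<in> poly_set \<eta> ?\<kappa>'" unfolding mem_poly_set using x(3) less_imp_le by blast
    ultimately show "x \<in> poly_set \<eta> ?\<kappa>' - (?A \<union> ?B)" by blast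
  qed
  then have "measure lborel (?A \<union> ?B) < area \<eta> ?\<kappa>'"
    unfolding area_def
    by (intro measure_less_open[OF compact_Un[OF compact_poly_set compact_poly_set] compact_poly_set sub oU d])
  moreover have "measure lborel (?A \<union> ?B) = area \<eta> (raise \<kappa> i s) + area \<eta> (raise \<kappa> j t) - area \<eta> \<kappa>"
    unfolding area_def using assms(2,3) ij
    by (subst measure_Un3) (auto simp: fmeasurable_poly_set poly_set_raise_Int)
  ultimately show ?thesis by simp
qed

text \<open>The radius of a ball around \<open>\<kappa>\<close> in the chamber over which the adjacency of facets is
  constant.\<close>

definition radius :: real where
  "radius = (SOME e. e > 0 \<and> (\<forall>\<kappa>'. dist \<kappa>' \<kappa> < e \<longrightarrow> \<kappa>' \<in> chamber \<eta> \<kappa> \<and> simple_polytope \<eta> \<kappa>' \<and>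
      (\<forall>i j. adjacent \<eta> \<kappa>' i j \<longleftrightarrow> adjacent \<eta> \<kappa> i j)))"

lemma radius:
  shows radius_pos: "radius > 0"
    and radius_chamber: "dist \<kappa>' \<kappa> < radius \<Longrightarrow> \<kappa>' \<in> chamber \<eta> \<kappa>"
    and radius_simple: "dist \<kappa>' \<kappa> < radius \<Longrightarrow> simple_polytope \<eta> \<kappa>'"
    and radius_adjacent: "dist \<kappa>' \<kappa> < radius \<Longrightarrow> adjacent \<eta> \<kappa>' i j \<longleftrightarrow> adjacent \<eta> \<kappa> i j"
proof -
  have "radius > 0 \<and> (\<forall>\<kappa>'. dist \<kappa>' \<kappa> < radius \<longrightarrow> \<kappa>' \<in> chamber \<eta> \<kappa> \<and> simple_polytope \<eta> \<kappa>' \<and>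
      (\<forall>i j. adjacent \<eta> \<kappa>' i j \<longleftrightarrow> adjacent \<eta> \<kappa> i j))"
    unfolding radius_def by (rule someI_ex) (metis chamber_neighbourhood)
  then show "radius > 0" "dist \<kappa>' \<kappa> < radius \<Longrightarrow> \<kappa>' \<in> chamber \<eta> \<kappa>"
    "dist \<kappa>' \<kappa> < radius \<Longrightarrow> simple_polytope \<eta> \<kappa>'"
    "dist \<kappa>' \<kappa> < radius \<Longrightarrow> adjacent \<eta> \<kappa>' i j \<longleftrightarrow> adjacent \<eta> \<kappa> i j" by blast+
qed

lemma radius_polygon: "dist \<kappa>' \<kappa> < radius \<Longrightarrow> simple_polygon \<eta> \<kappa>'"
  using dim2 radius_simple by unfold_locales

lemma mixed_nonadjacent:
  assumes "i \<noteq> j" "\<not> adjacent \<eta> \<kappa> i j" "s \<ge> 0" "t \<ge> 0" "dist \<kappa>' \<kappa> + s + t < radius"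
  shows "area \<eta> (raise (raise \<kappa>' i s) j t) + area \<eta> \<kappa>' = area \<eta> (raise \<kappa>' i s) + area \<eta> (raise \<kappa>' j t)"
    and "moment \<eta> (raise (raise \<kappa>' i s) j t) + moment \<eta> \<kappa>' = moment \<eta> (raise \<kappa>' i s) + moment \<eta> (raise \<kappa>' j t)"
proof -
  have un: "poly_set \<eta> (raise (raise \<kappa>' i s) j t) = poly_set \<eta> (raise \<kappa>' i s) \<union> poly_set \<eta> (raise \<kappa>' j t)"
  proof (rule poly_set_raise_Un[OF assms(1,3,4)])
    fix s' t' assume st: "0 \<le> s'" "s' \<le> s" "0 \<le> t'" "t' \<le> t"
    have "dist (raise (raise \<kappa>' i s') j t') \<kappa> < radius"
      using dist_raise[of "raise \<kappa>' i s'" j t' \<kappa>] dist_raise[of \<kappa>' i s' \<kappa>] st assms(5) by linarith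
    then show "\<not> adjacent \<eta> (raise (raise \<kappa>' i s') j t') i j"
      using radius_adjacent assms(2) by blast
  qed
  have int: "poly_set \<eta> (raise \<kappa>' i s) \<inter> poly_set \<eta> (raise \<kappa>' j t) = poly_set \<eta> \<kappa>'"
    by (rule poly_set_raise_Int[OF assms(1,3,4)])
  show "area \<eta> (raise (raise \<kappa>' i s) j t) + area \<eta> \<kappa>' = area \<eta> (raise \<kappa>' i s) + area \<eta> (raise \<kappa>' j t)"
    unfolding area_def un using fmeasurable_poly_set
    by (subst measure_Un3) (auto simp: int)
  show "moment \<eta> (raise (raise \<kappa>' i s) j t) + moment \<eta> \<kappa>' = moment \<eta> (raise \<kappa>' i s) + moment \<eta> (raise \<kappa>' j t)"
    unfolding moment_def un using moment_additive[OF compact_poly_set compact_poly_set, of "raise \<kappa>' i s" "raise \<kappa>' j t"]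
    by (simp add: int)
qed

end

section \<open>Coefficients of mass linear functions\<close>

text \<open>The change of the support numbers under translation of the polygon by \<open>v\<close>.\<close>

definition shift_vec :: "('n::finite \<Rightarrow> 'a::euclidean_space) \<Rightarrow> 'a \<Rightarrow> real^'n" where
  "shift_vec \<eta> v = (\<chi> m. \<eta> m \<bullet> v)"

lemma shift_vec_nth [simp]: "shift_vec \<eta> v $ m = \<eta> m \<bullet> v"
  by (simp add: shift_vec_def)

lemma poly_set_shift: "(\<lambda>x. x + v) -` poly_set \<eta> (\<kappa> + shift_vec \<eta> v) = poly_set \<eta> \<kappa>"
  by (auto simp: mem_poly_set inner_add_right)

lemma lborel_distr_translation: "distr lborel borel (\<lambda>x. x + v) = lborel"
proof -
  have "(\<lambda>x. x + v) = (+) v" by (auto simp: add.commute)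
  then show ?thesis by (simp add: lborel_distr_plus)
qed

lemma area_shift: "area \<eta> (\<kappa> + shift_vec \<eta> v) = area \<eta> \<kappa>"
proof -
  have "measure lborel ((\<lambda>x. x + v) -` poly_set \<eta> (\<kappa> + shift_vec \<eta> v)) = measure lborel (poly_set \<eta> (\<kappa> + shift_vec \<eta> v))"
    by (rule measure_preimage) (auto simp: lborel_distr_translation)
  then show ?thesis by (simp add: area_def poly_set_shift)
qed

lemma (in simple_polygon) center_of_mass_shift:
  "center_of_mass (poly_set \<eta> (\<kappa> + shift_vec \<eta> v)) = center_of_mass (poly_set \<eta> \<kappa>) + v"
proof (rule center_of_mass_affine[where f = "\<lambda>x. x"])
  show "poly_set \<eta> \<kappa> = (\<lambda>x. x + v) -` poly_set \<eta> (\<kappa> + shift_vec \<eta> v)" by (simp add: poly_set_shift)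
  show "measure lborel (poly_set \<eta> \<kappa>) \<noteq> 0" using area_pos by (simp add: area_def)
qed (auto simp: compact_poly_set lborel_distr_translation linear_ident)

text \<open>A simple polygon with a linear form \<open>h\<close> whose value at the center of mass is an affine function
  of the support numbers in the chamber.\<close>

locale mass_linear_polygon = simple_polygon \<eta> \<kappa> for \<eta> :: "'n::finite \<Rightarrow> 'a::euclidean_space" and \<kappa> +
  fixes h :: 'a and \<gamma> :: "'n \<Rightarrow> real" and C :: real
  assumes mass_linear_eq: "\<kappa>' \<in> chamber \<eta> \<kappa> \<Longrightarrow>
    h \<bullet> center_of_mass (poly_set \<eta> \<kappa>') = (\<Sum>i\<in>UNIV. \<gamma> i * \<kappa>' $ i) + C"
begin

text \<open>The prescribed value of \<open>h\<close> at the center of mass.\<close>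

definition value_at :: "real^'n \<Rightarrow> real" where "value_at \<kappa>' = (\<Sum>i\<in>UNIV. \<gamma> i * \<kappa>' $ i) + C"

lemma value_at_raise: "value_at (raise \<kappa>' i s) = value_at \<kappa>' + s * \<gamma> i"
proof -
  have "(\<Sum>k\<in>UNIV. \<gamma> k * (if k = i then s else 0)) = s * \<gamma> i"
    by (simp add: if_distrib[of "(*) _"] cong: if_cong)
  then show ?thesis by (simp add: value_at_def distrib_left sum.distrib)
qed

lemma moment_eq:
  assumes "dist \<kappa>' \<kappa> < radius"
  shows "h \<bullet> moment \<eta> \<kappa>' = area \<eta> \<kappa>' * value_at \<kappa>'"
proof -
  have "area \<eta> \<kappa>' > 0" using simple_polygon.area_pos[OF radius_polygon[OF assms]] .
  then have "moment \<eta> \<kappa>' = area \<eta> \<kappa>' *\<^sub>R center_of_mass (poly_set \<eta> \<kappa>')"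
    by (simp add: moment_def center_of_mass_def area_def)
  then show ?thesis using mass_linear_eq[OF radius_chamber[OF assms]] by (simp add: value_at_def)
qed

text \<open>Mixed second difference of the product of area and value at the center of mass, for two facets
  for which the mixed differences of area and moment vanish.\<close>

lemma nonadjacent_relation:
  assumes "i \<noteq> j" "\<not> adjacent \<eta> \<kappa> i j" "s \<ge> 0" "t \<ge> 0" "dist \<kappa>' \<kappa> + s + t < radius"
  shows "s * \<gamma> i * (area \<eta> (raise \<kappa>' j t) - area \<eta> \<kappa>') + t * \<gamma> j * (area \<eta> (raise \<kappa>' i s) - area \<eta> \<kappa>') = 0"
proof -
  define a00 where "a00 = area \<eta> \<kappa>'"
  define a10 where "a10 = area \<eta> (raise \<kappa>' i s)"
  define a01 where "a01 = area \<eta> (raise \<kappa>' j t)"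
  define a11 where "a11 = area \<eta> (raise (raise \<kappa>' i s) j t)"
  define g where "g = value_at \<kappa>'"
  have d: "dist \<kappa>' \<kappa> < radius" "dist (raise \<kappa>' i s) \<kappa> < radius" "dist (raise \<kappa>' j t) \<kappa> < radius"
    "dist (raise (raise \<kappa>' i s) j t) \<kappa> < radius"
    using dist_raise[of \<kappa>' i s \<kappa>] dist_raise[of \<kappa>' j t \<kappa>] dist_raise[of "raise \<kappa>' i s" j t \<kappa>] assms(3-5)
    by linarith+
  have A: "a11 + a00 = a10 + a01"
    unfolding a00_def a01_def a10_def a11_def by (rule mixed_nonadjacent[OF assms])
  have "h \<bullet> moment \<eta> (raise (raise \<kappa>' i s) j t) + h \<bullet> moment \<eta> \<kappa>'
      = h \<bullet> moment \<eta> (raise \<kappa>' i s) + h \<bullet> moment \<eta> (raise \<kappa>' j t)"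
    using mixed_nonadjacent(2)[OF assms] by (simp flip: inner_add_right)
  then have M: "a11 * (g + s * \<gamma> i + t * \<gamma> j) + a00 * g = a10 * (g + s * \<gamma> i) + a01 * (g + t * \<gamma> j)"
    unfolding moment_eq[OF d(1)] moment_eq[OF d(2)] moment_eq[OF d(3)] moment_eq[OF d(4)]
    by (simp add: value_at_raise a00_def a01_def a10_def a11_def g_def)
  have a11: "a11 = a10 + a01 - a00" using A by simp
  have "s * \<gamma> i * (a01 - a00) + t * \<gamma> j * (a10 - a00) = 0"
    using M unfolding a11 by (simp add: algebra_simps)
  then show ?thesis by (simp add: a00_def a01_def a10_def)
qed

text \<open>Compare the given polygon with a small translate of it.\<close>

lemma linear_part_eq: "h = (\<Sum>i\<in>UNIV. \<gamma> i *\<^sub>R \<eta> i)"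
proof -
  define u where "u = h - (\<Sum>i\<in>UNIV. \<gamma> i *\<^sub>R \<eta> i)"
  have lim: "((\<lambda>t. \<kappa> + shift_vec \<eta> (t *\<^sub>R u)) \<longlongrightarrow> \<kappa> + shift_vec \<eta> (0 *\<^sub>R u)) (at_right 0)"
    unfolding shift_vec_def by (intro tendsto_intros)
  have "\<kappa> + shift_vec \<eta> (0 *\<^sub>R u) = \<kappa>" by (simp add: vec_eq_iff)
  then have "\<forall>\<^sub>F t in at_right 0. dist (\<kappa> + shift_vec \<eta> (t *\<^sub>R u)) \<kappa> < radius"
    using tendstoD[OF lim radius_pos] by simp
  moreover have "\<forall>\<^sub>F t in at_right 0. (t::real) > 0" by (rule eventually_at_right_less)
  ultimately obtain t where t: "dist (\<kappa> + shift_vec \<eta> (t *\<^sub>R u)) \<kappa> < radius" "t > 0"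
    using eventually_happens'[OF trivial_limit_at_right_real eventually_conj] by blast
  have "h \<bullet> (center_of_mass (poly_set \<eta> \<kappa>) + t *\<^sub>R u) = value_at (\<kappa> + shift_vec \<eta> (t *\<^sub>R u))"
    using mass_linear_eq[OF radius_chamber[OF t(1)]] by (simp add: center_of_mass_shift value_at_def)
  moreover have "h \<bullet> center_of_mass (poly_set \<eta> \<kappa>) = value_at \<kappa>"
    using mass_linear_eq[OF radius_chamber, of \<kappa>] radius_pos by (simp add: value_at_def)
  moreover have "value_at (\<kappa> + shift_vec \<eta> (t *\<^sub>R u)) = value_at \<kappa> + t * (\<Sum>i\<in>UNIV. \<gamma> i * (\<eta> i \<bullet> u))"
    by (simp add: value_at_def distrib_left sum.distrib sum_distrib_left mult.left_commute)
  ultimately have "t * (h \<bullet> u) = t * (\<Sum>i\<in>UNIV. \<gamma> i * (\<eta> i \<bullet> u))"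
    by (simp add: inner_add_right)
  then have "h \<bullet> u = (\<Sum>i\<in>UNIV. \<gamma> i *\<^sub>R \<eta> i) \<bullet> u" using t(2) by (simp add: inner_sum_left)
  then have "u \<bullet> u = 0" by (simp add: u_def inner_diff_left)
  then show ?thesis by (simp add: u_def)
qed

text \<open>A third facet adjacent to only one of two disjoint facets changes one of the two edge
  lengths but not the other, so that the linear relation between them is trivial.\<close>

lemma coefficients_vanish:
  assumes ij: "i \<noteq> j" "\<not> adjacent \<eta> \<kappa> i j" and k: "adjacent \<eta> \<kappa> k i" "k \<noteq> j" "\<not> adjacent \<eta> \<kappa> k j"
  shows "\<gamma> i = 0" "\<gamma> j = 0"
proof -
  define r where "r = radius / 4"
  have r: "r > 0" "3 * r < radius" using radius_pos by (simp_all add: r_def)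
  have dk: "dist (raise \<kappa> k r) \<kappa> \<le> r" using dist_raise[of \<kappa> k r \<kappa>] r(1) by simp
  define a where "a = area \<eta> \<kappa>"
  define ai where "ai = area \<eta> (raise \<kappa> i r)"
  define aj where "aj = area \<eta> (raise \<kappa> j r)"
  define ak where "ak = area \<eta> (raise \<kappa> k r)"
  define aki where "aki = area \<eta> (raise (raise \<kappa> k r) i r)"
  define akj where "akj = area \<eta> (raise (raise \<kappa> k r) j r)"
  have "r * \<gamma> i * (aj - a) + r * \<gamma> j * (ai - a) = 0"
    unfolding a_def ai_def aj_def by (rule nonadjacent_relation[OF ij]) (use r in auto)
  then have "r * (\<gamma> i * (aj - a) + \<gamma> j * (ai - a)) = 0" by (simp add: algebra_simps)
  then have R0: "\<gamma> i * (aj - a) + \<gamma> j * (ai - a) = 0" using r(1) by simp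
  have "r * \<gamma> i * (akj - ak) + r * \<gamma> j * (aki - ak) = 0"
    unfolding ak_def aki_def akj_def by (rule nonadjacent_relation[OF ij]) (use r dk in auto)
  then have "r * (\<gamma> i * (akj - ak) + \<gamma> j * (aki - ak)) = 0" by (simp add: algebra_simps)
  then have R1: "\<gamma> i * (akj - ak) + \<gamma> j * (aki - ak) = 0" using r(1) by simp
  have "akj + a = ak + aj"
    unfolding akj_def a_def ak_def aj_def by (rule mixed_nonadjacent(1)[OF k(2,3)]) (use r in auto)
  then have "akj - ak = aj - a" by simp
  then have "\<gamma> i * (aj - a) + \<gamma> j * (aki - ak) = 0" using R1 by simp
  then have "\<gamma> j * (aki - ak) - \<gamma> j * (ai - a) = 0" using R0 by linarith
  then have "\<gamma> j * ((aki - ak) - (ai - a)) = 0" by (simp add: right_diff_distrib)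
  moreover have "ak + ai < aki + a"
    unfolding ak_def ai_def aki_def a_def by (rule area_mixed_adjacent[OF k(1) r(1) r(1)])
  ultimately show "\<gamma> j = 0" by simp
  then have "\<gamma> i * (aj - a) = 0" using R0 by simp
  moreover have "a < aj" unfolding a_def aj_def by (rule area_raise_less[OF r(1)])
  ultimately show "\<gamma> i = 0" by simp
qed

text \<open>The growth of the area when facet \<open>i\<close> moves is affected by the position of another facet exactly
  if the latter is adjacent to \<open>i\<close>.\<close>

lemma increment_shift_nonadjacent:
  assumes "i \<noteq> j" "\<not> adjacent \<eta> \<kappa> i j" "s \<ge> 0" "dist \<kappa>' \<kappa> + 2 * \<bar>u\<bar> + s < radius"
  shows "area \<eta> (raise (raise \<kappa>' j u) i s) - area \<eta> (raise \<kappa>' j u) = area \<eta> (raise \<kappa>' i s) - area \<eta> \<kappa>'"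
proof (cases "u \<ge> 0")
  case True
  then have "area \<eta> (raise (raise \<kappa>' i s) j u) + area \<eta> \<kappa>' = area \<eta> (raise \<kappa>' i s) + area \<eta> (raise \<kappa>' j u)"
    using assms by (intro mixed_nonadjacent) auto
  then show ?thesis by (simp add: raise_commute[of \<kappa>' j u i s])
next
  case False
  let ?\<kappa>'' = "raise \<kappa>' j u"
  have "area \<eta> (raise (raise ?\<kappa>'' i s) j (-u)) + area \<eta> ?\<kappa>'' = area \<eta> (raise ?\<kappa>'' i s) + area \<eta> (raise ?\<kappa>'' j (-u))"
    using assms False dist_raise[of \<kappa>' j u \<kappa>] by (intro mixed_nonadjacent) auto
  moreover have "raise (raise ?\<kappa>'' i s) j (-u) = raise \<kappa>' i s" "raise ?\<kappa>'' j (-u) = \<kappa>'"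
    using assms(1) by (auto simp: vec_eq_iff)
  ultimately show ?thesis by simp
qed

lemma increment_shift_adjacent:
  assumes "adjacent \<eta> \<kappa> i j" "s > 0" "u \<noteq> 0" "\<bar>u\<bar> < radius"
  shows "area \<eta> (raise (raise \<kappa> j u) i s) - area \<eta> (raise \<kappa> j u) \<noteq> area \<eta> (raise \<kappa> i s) - area \<eta> \<kappa>"
proof (cases "u > 0")
  case True
  then have "area \<eta> (raise \<kappa> i s) + area \<eta> (raise \<kappa> j u) < area \<eta> (raise (raise \<kappa> i s) j u) + area \<eta> \<kappa>"
    using assms by (intro area_mixed_adjacent)
  then show ?thesis by (simp add: raise_commute[of \<kappa> j u i s])
next
  case False
  let ?\<kappa>' = "raise \<kappa> j u"
  have d: "dist ?\<kappa>' \<kappa> < radius" using dist_raise[of \<kappa> j u \<kappa>] assms(4) by simp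
  have ij: "i \<noteq> j" using assms(1) by (simp add: adjacent_def)
  have "area \<eta> (raise ?\<kappa>' i s) + area \<eta> (raise ?\<kappa>' j (-u)) < area \<eta> (raise (raise ?\<kappa>' i s) j (-u)) + area \<eta> ?\<kappa>'"
    using False assms radius_adjacent[OF d]
    by (intro simple_polygon.area_mixed_adjacent[OF radius_polygon[OF d]]) auto
  moreover have "raise (raise ?\<kappa>' i s) j (-u) = raise \<kappa> i s" "raise ?\<kappa>' j (-u) = \<kappa>"
    using ij by (auto simp: vec_eq_iff)
  ultimately show ?thesis by simp
qed

text \<open>Opposite facets \<open>i\<close>, \<open>j\<close> of a quadrilateral. The relation between \<open>\<gamma> i\<close> and \<open>\<gamma> j\<close>, for two step sizes of
  facet \<open>i\<close>, shows that the area grows by the same amount in two consecutive steps. A translation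
  along the neighbour \<open>k\<close> moves facet \<open>i\<close> back after the first step, at the cost of moving \<open>j\<close>, which does
  not matter, and \<open>l\<close> by a multiple of \<open>b\<close>; as the growth is unchanged, \<open>b = 0\<close>, which means that \<open>l\<close> is parallel to \<open>k\<close>.\<close>

lemma neighbours_parallel:
  assumes univ: "UNIV = {i, j, k, l}" and dist: "i \<noteq> j" "k \<noteq> l" "j \<noteq> l" "j \<noteq> k"
    and adj: "\<not> adjacent \<eta> \<kappa> i j" "adjacent \<eta> \<kappa> i k" "adjacent \<eta> \<kappa> i l"
    and nz: "\<gamma> i \<noteq> 0 \<or> \<gamma> j \<noteq> 0"
  obtains c where "\<eta> l = c *\<^sub>R \<eta> k"
proof -
  obtain w where w: "\<eta> i \<bullet> w = 1" "\<eta> k \<bullet> w = 0" by (rule conormals_dual[OF adj(2)])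
  define b where "b = \<eta> l \<bullet> w"
  define d where "d = \<eta> j \<bullet> w"
  define s where "s = radius / (4 + 2 * \<bar>b\<bar> + 2 * \<bar>d\<bar>)"
  have den: "4 + 2 * \<bar>b\<bar> + 2 * \<bar>d\<bar> > 0" by (smt (verit))
  then have s: "s > 0" "s * (4 + 2 * \<bar>b\<bar> + 2 * \<bar>d\<bar>) = radius" using radius_pos by (simp_all add: s_def)
  have sb: "s * \<bar>b\<bar> \<ge> 0" "s * \<bar>d\<bar> \<ge> 0" using s(1) by simp_all
  have s': "4 * s + 2 * (s * \<bar>b\<bar>) + 2 * (s * \<bar>d\<bar>) = radius" using s(2) by (simp add: algebra_simps)
  have small: "3 * s < radius" "s * \<bar>b\<bar> + 2 * (s * \<bar>d\<bar>) + s < radius" "s * \<bar>b\<bar> < radius"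
    using s' sb s(1) by linarith+
  define a where "a = area \<eta> \<kappa>"
  define ai where "ai = area \<eta> (raise \<kappa> i s)"
  define ai2 where "ai2 = area \<eta> (raise \<kappa> i (2 * s))"
  define aj where "aj = area \<eta> (raise \<kappa> j s)"
  have neq: "i \<noteq> k" "i \<noteq> l" using adj(2,3) by (auto simp: adjacent_def)
  have "s * \<gamma> i * (aj - a) + s * \<gamma> j * (ai - a) = 0"
    unfolding a_def ai_def aj_def by (rule nonadjacent_relation[OF dist(1) adj(1)]) (use s(1) small(1) in auto)
  then have "s * (\<gamma> i * (aj - a) + \<gamma> j * (ai - a)) = 0" by (simp add: algebra_simps)
  then have R1: "\<gamma> i * (aj - a) + \<gamma> j * (ai - a) = 0" using s(1) by simp
  have "(2 * s) * \<gamma> i * (aj - a) + s * \<gamma> j * (ai2 - a) = 0"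
    unfolding a_def ai2_def aj_def by (rule nonadjacent_relation[OF dist(1) adj(1)]) (use s(1) small(1) in auto)
  then have "s * (2 * (\<gamma> i * (aj - a)) + \<gamma> j * (ai2 - a)) = 0" by (simp add: algebra_simps)
  then have "2 * (\<gamma> i * (aj - a)) + \<gamma> j * (ai2 - a) = 0" using s(1) by simp
  then have "\<gamma> j * ((ai2 - ai) - (ai - a)) = 0" using R1 by (simp add: algebra_simps)
  moreover have "\<gamma> j \<noteq> 0"
  proof
    assume "\<gamma> j = 0"
    then have "\<gamma> i * (aj - a) = 0" using R1 by simp
    moreover have "a < aj" unfolding a_def aj_def by (rule area_raise_less[OF s(1)])
    ultimately show False using nz \<open>\<gamma> j = 0\<close> by simp
  qed
  ultimately have even: "ai2 - ai = ai - a" by simp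
  \<comment> \<open>Translation by \<open>s *\<^sub>R w\<close> takes \<open>\<kappa>1\<close> to the support numbers after the first step.\<close>
  define \<kappa>2 where "\<kappa>2 = raise \<kappa> l (- (s * b))"
  define \<kappa>1 where "\<kappa>1 = raise \<kappa>2 j (- (s * d))"
  have all4: "(\<forall>x. P x) \<longleftrightarrow> P i \<and> P j \<and> P k \<and> P l" for P
    using univ by (metis UNIV_I empty_iff insert_iff)
  have T: "raise \<kappa> i s = \<kappa>1 + shift_vec \<eta> (s *\<^sub>R w)" "raise \<kappa> i (2 * s) = raise \<kappa>1 i s + shift_vec \<eta> (s *\<^sub>R w)"
    unfolding vec_eq_iff all4 \<kappa>1_def \<kappa>2_def using w dist neq
    by (auto simp: b_def d_def)
  have b0: "b = 0"
  proof (rule ccontr)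
    assume "b \<noteq> 0"
    have "dist \<kappa>2 \<kappa> \<le> s * \<bar>b\<bar>"
      using dist_raise[of \<kappa> l "- (s * b)" \<kappa>] s(1) by (simp add: \<kappa>2_def abs_mult)
    then have "dist \<kappa>2 \<kappa> + 2 * \<bar>- (s * d)\<bar> + s < radius"
      using s(1) small(2) by (simp add: abs_mult)
    then have "area \<eta> (raise \<kappa>1 i s) - area \<eta> \<kappa>1 = area \<eta> (raise \<kappa>2 i s) - area \<eta> \<kappa>2"
      unfolding \<kappa>1_def
      by (intro increment_shift_nonadjacent[OF dist(1) adj(1)]) (use s(1) in simp)
    moreover have "area \<eta> (raise \<kappa>2 i s) - area \<eta> \<kappa>2 \<noteq> ai - a"
      unfolding \<kappa>2_def ai_def a_def
      by (rule increment_shift_adjacent[OF adj(3) s(1)]) (use s(1) small(3) \<open>b \<noteq> 0\<close> in \<open>auto simp: abs_mult\<close>)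
    moreover have "area \<eta> (raise \<kappa>1 i s) - area \<eta> \<kappa>1 = ai2 - ai"
      unfolding ai2_def ai_def T by (simp add: area_shift)
    ultimately show False using even by simp
  qed
  have "w \<noteq> 0" using w(1) by auto
  then show ?thesis
    using orthogonal_parallel_2d[OF dim2 _ conormal_nonzero w(2), of "\<eta> l"] b0 that by (auto simp: b_def)
qed

end

section \<open>Polygons with few sides\<close>

context simple_polygon begin

lemma two_neighbours:
  obtains k l where "k \<noteq> l" "k \<noteq> i" "l \<noteq> i" "\<forall>j. adjacent \<eta> \<kappa> i j \<longleftrightarrow> j = k \<or> j = l"
proof -
  obtain k l where kl: "{j. adjacent \<eta> \<kappa> i j} = {k, l}" "k \<noteq> l"
    using card_adjacent[of i] by (auto simp: card_2_iff)
  then have eq: "\<forall>j. adjacent \<eta> \<kappa> i j \<longleftrightarrow> j = k \<or> j = l" by blast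
  then have "k \<noteq> i" "l \<noteq> i" by (auto simp: adjacent_def)
  then show ?thesis by (rule that[OF kl(2) _ _ eq])
qed

lemma three_le_facets: "3 \<le> CARD('n)"
proof -
  obtain i :: 'n where True by blast
  obtain k l where kl: "k \<noteq> l" "k \<noteq> i" "l \<noteq> i" "\<forall>j. adjacent \<eta> \<kappa> i j \<longleftrightarrow> j = k \<or> j = l"
    by (rule two_neighbours[of i])
  then have "card {i, k, l} = 3" by auto
  then show ?thesis using card_mono[of UNIV "{i, k, l}"] by simp
qed

lemma triangle_adjacent:
  assumes "CARD('n) = 3" "i \<noteq> j"
  shows "adjacent \<eta> \<kappa> i j"
proof -
  have "{j. adjacent \<eta> \<kappa> i j} \<subseteq> UNIV - {i}" by (auto simp: adjacent_def)
  moreover have "card (UNIV - {i}) = 2" using assms(1) by (simp add: card_Diff_singleton)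
  ultimately have "{j. adjacent \<eta> \<kappa> i j} = UNIV - {i}"
    using card_adjacent[of i] by (intro card_subset_eq) auto
  then show ?thesis using assms(2) by blast
qed

lemma quadrilateral_structure:
  assumes "CARD('n) = 4"
  obtains j k l where "UNIV = {i, j, k, l}" "distinct [i, j, k, l]"
    "\<not> adjacent \<eta> \<kappa> i j" "\<not> adjacent \<eta> \<kappa> k l"
    "adjacent \<eta> \<kappa> i k" "adjacent \<eta> \<kappa> i l" "adjacent \<eta> \<kappa> j k" "adjacent \<eta> \<kappa> j l"
proof -
  obtain k l where kl: "k \<noteq> l" "k \<noteq> i" "l \<noteq> i" "\<forall>j. adjacent \<eta> \<kappa> i j \<longleftrightarrow> j = k \<or> j = l"
    by (rule two_neighbours[of i])
  have "card (UNIV - {i, k, l}) = 1" using assms kl by (subst card_Diff_subset) auto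
  then obtain j where "UNIV - {i, k, l} = {j}" by (auto simp: card_1_singleton_iff)
  then have univ: "UNIV = {i, j, k, l}" and j: "j \<noteq> i" "j \<noteq> k" "j \<noteq> l" by auto
  have nij: "\<not> adjacent \<eta> \<kappa> i j" using kl(4) j by blast
  have "{m. adjacent \<eta> \<kappa> j m} \<subseteq> {k, l}"
    using univ nij adjacent_sym[of \<eta> \<kappa> i j] by (auto simp: adjacent_def)
  then have "{m. adjacent \<eta> \<kappa> j m} = {k, l}"
    using card_adjacent[of j] kl(1) by (intro card_subset_eq) auto
  then have jkl: "adjacent \<eta> \<kappa> j k" "adjacent \<eta> \<kappa> j l" by auto
  have "\<not> adjacent \<eta> \<kappa> k l"
  proof
    assume "adjacent \<eta> \<kappa> k l"
    then have "{i, j, l} \<subseteq> {m. adjacent \<eta> \<kappa> k m}"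
      using kl(4) jkl adjacent_sym[of \<eta> \<kappa>] by blast
    then have "card {i, j, l} \<le> 2" using card_adjacent[of k] by (metis card_mono finite)
    then show False using kl j by simp
  qed
  then show ?thesis using that[OF univ] kl j nij jkl by auto
qed

text \<open>If \<open>i\<close> and \<open>j\<close> had the same two neighbours, then these four facets would have no further
  neighbours, and there would be no other facets by connectedness.\<close>

lemma large_polygon_neighbours:
  assumes "5 \<le> CARD('n)"
  obtains j where "j \<noteq> i" "\<not> adjacent \<eta> \<kappa> i j" "{k. adjacent \<eta> \<kappa> i k} \<noteq> {k. adjacent \<eta> \<kappa> j k}"
proof -
  obtain k l where kl: "k \<noteq> l" "k \<noteq> i" "l \<noteq> i" "\<forall>j. adjacent \<eta> \<kappa> i j \<longleftrightarrow> j = k \<or> j = l"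
    by (rule two_neighbours[of i])
  have "card {i, k, l} \<le> 3" by (simp add: card_insert_if)
  then have "{i, k, l} \<noteq> UNIV" using assms by auto
  then obtain j where j: "j \<notin> {i, k, l}" by blast
  have "{k. adjacent \<eta> \<kappa> i k} \<noteq> {k. adjacent \<eta> \<kappa> j k}"
  proof
    assume eq: "{k. adjacent \<eta> \<kappa> i k} = {k. adjacent \<eta> \<kappa> j k}"
    have jm: "adjacent \<eta> \<kappa> j m \<longleftrightarrow> m = k \<or> m = l" for m using eq kl(4) by blast
    have two: "{m. adjacent \<eta> \<kappa> x m} = {i, j}" if "x = k \<or> x = l" for x
    proof -
      have "{i, j} \<subseteq> {m. adjacent \<eta> \<kappa> x m}" using that kl(4) jm adjacent_sym[of \<eta> \<kappa>] by blast
      moreover have "card {i, j} = 2" using j by auto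
      ultimately show ?thesis using card_adjacent[of x] by (metis card_subset_eq finite)
    qed
    have "card {i, j, k, l} \<le> 4" by (simp add: card_insert_if)
    then have "{i, j, k, l} \<noteq> UNIV" using assms by auto
    then obtain a b where ab: "a \<in> {i, j, k, l}" "b \<notin> {i, j, k, l}" "adjacent \<eta> \<kappa> a b"
      using adjacent_connected[of "{i, j, k, l}"] by blast
    then consider "a = i" | "a = j" | "a = k \<or> a = l" by blast
    then show False
    proof cases
      case 1 then show ?thesis using ab kl(4) by blast
    next
      case 2 then show ?thesis using ab jm by blast
    next
      case 3 then show ?thesis using ab two[OF 3] by blast
    qed
  qed
  then show ?thesis using that j kl(4) by auto
qed

end

lemma (in mass_linear_polygon) large_polygon_coefficients:
  assumes "5 \<le> CARD('n)"
  shows "\<gamma> i = 0"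
proof -
  obtain j where j: "j \<noteq> i" "\<not> adjacent \<eta> \<kappa> i j" "{k. adjacent \<eta> \<kappa> i k} \<noteq> {k. adjacent \<eta> \<kappa> j k}"
    by (rule large_polygon_neighbours[OF assms])
  have "\<not> {k. adjacent \<eta> \<kappa> i k} \<subseteq> {k. adjacent \<eta> \<kappa> j k}"
    using j(3) card_adjacent[of i] card_adjacent[of j] card_subset_eq[of "{k. adjacent \<eta> \<kappa> j k}" "{k. adjacent \<eta> \<kappa> i k}"]
    by auto
  then obtain k where k: "adjacent \<eta> \<kappa> i k" "\<not> adjacent \<eta> \<kappa> j k" by blast
  show ?thesis
  proof (rule coefficients_vanish(1))
    show "i \<noteq> j" "\<not> adjacent \<eta> \<kappa> i j" using j by auto
    show "adjacent \<eta> \<kappa> k i" "\<not> adjacent \<eta> \<kappa> k j" using k adjacent_sym[of \<eta> \<kappa>] by blast+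
    show "k \<noteq> j" using k j by blast
  qed
qed

section \<open>Facet reflections\<close>

text \<open>A direction \<open>w\<close> along which all conormals except \<open>\<eta> i\<close> and \<open>\<eta> j\<close> vanish, while these two take
  values of opposite sign. The vector \<open>w\<close> is scaled to have pairing 1 with \<open>\<eta> i\<close>, and \<open>c\<close> is
  chosen such that \<open>\<eta> i + c *\<^sub>R \<eta> j\<close> vanishes on \<open>w\<close>. These data define an affine map, for arbitrary
  support numbers, that exchanges the facets \<open>i\<close> and \<open>j\<close> and preserves all others.\<close>

locale facet_reflection = simple_polygon \<eta> \<kappa> for \<eta> :: "'n::finite \<Rightarrow> 'a::euclidean_space" and \<kappa> +
  fixes i j :: 'n and w :: 'a and c :: real
  assumes distinct: "i \<noteq> j" and pos: "c > 0"
    and i_w: "\<eta> i \<bullet> w = 1" and j_w: "c * (\<eta> j \<bullet> w) = -1"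
    and others_w: "k \<noteq> i \<Longrightarrow> k \<noteq> j \<Longrightarrow> \<eta> k \<bullet> w = 0"

context simple_polygon begin

text \<open>The two signs are opposite because a bounded polygon contains no ray.\<close>

lemma facet_reflection_exists:
  assumes "i \<noteq> j" "w \<noteq> 0" and others: "\<And>k. k \<noteq> i \<Longrightarrow> k \<noteq> j \<Longrightarrow> \<eta> k \<bullet> w = 0"
  obtains w' c where "facet_reflection \<eta> \<kappa> i j w' c"
proof -
  have "\<not> (\<forall>k. \<eta> k \<bullet> w \<le> 0)" using no_recession assms(2) by blast
  then obtain k where "\<eta> k \<bullet> w > 0" by (auto simp: not_le)
  then have pos: "\<eta> i \<bullet> w > 0 \<or> \<eta> j \<bullet> w > 0" using others[of k] by (cases "k = i"; cases "k = j") auto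
  have "\<not> (\<forall>k. \<eta> k \<bullet> (-w) \<le> 0)" using no_recession[of "-w"] assms(2) by auto
  then obtain k where "\<eta> k \<bullet> w < 0" by (auto simp: not_le)
  then have neg: "\<eta> i \<bullet> w < 0 \<or> \<eta> j \<bullet> w < 0" using others[of k] by (cases "k = i"; cases "k = j") auto
  define a where "a = \<eta> i \<bullet> w"
  define b where "b = \<eta> j \<bullet> w"
  have ab: "a \<noteq> 0" "b \<noteq> 0" "- a / b > 0"
    using pos neg by (auto simp: a_def b_def zero_less_divide_iff divide_less_0_iff)
  show ?thesis
  proof (rule that[of "(1 / a) *\<^sub>R w" "- a / b"])
    show "facet_reflection \<eta> \<kappa> i j ((1 / a) *\<^sub>R w) (- a / b)"
    proof unfold_locales
      show "\<eta> i \<bullet> (1 / a) *\<^sub>R w = 1" using ab by (simp add: a_def)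
      show "(- a / b) * (\<eta> j \<bullet> (1 / a) *\<^sub>R w) = - 1" using ab by (auto simp flip: b_def)
    qed (use assms ab in auto)
  qed
qed

end

lemma image_eq_involution:
  assumes "\<And>x. r (r x) = x" "\<And>x. x \<in> A \<Longrightarrow> r x \<in> B" "\<And>x. x \<in> B \<Longrightarrow> r x \<in> A"
  shows "r ` A = B"
proof (intro subset_antisym subsetI)
  fix x assume "x \<in> B"
  then show "x \<in> r ` A" using assms(1)[of x] assms(3)[of x] by (intro image_eqI[of x r "r x"]) simp_all
qed (use assms(2) in auto)

context facet_reflection begin

text \<open>The linear form that changes sign under the reflection.\<close>

definition d :: 'a where "d = \<eta> i - c *\<^sub>R \<eta> j"

text \<open>The linear part: the skew reflection that negates \<open>w\<close> and fixes the kernel of \<open>d\<close>.\<close>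

definition lin :: "'a \<Rightarrow> 'a" where "lin x = x - (d \<bullet> x) *\<^sub>R w"

text \<open>The affine reflection for the support numbers \<open>\<kappa>'\<close>.\<close>

definition reflect :: "real^'n \<Rightarrow> 'a \<Rightarrow> 'a" where "reflect \<kappa>' x = lin x + (\<kappa>' $ i - c * \<kappa>' $ j) *\<^sub>R w"

lemma d_w: "d \<bullet> w = 2" using i_w j_w by (simp add: d_def inner_diff_left)

lemma linear_lin: "linear lin"
  unfolding lin_def by (intro linearI) (simp_all add: inner_add_right algebra_simps)

lemma lin_lin [simp]: "lin (lin x) = x"
  by (simp add: lin_def inner_diff_right d_w algebra_simps)

lemma adjoint_lin: "adjoint lin y = y - (w \<bullet> y) *\<^sub>R d"
proof -
  have "adjoint lin = (\<lambda>y. y - (w \<bullet> y) *\<^sub>R d)"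
    by (rule adjoint_unique)
      (simp add: lin_def inner_diff_left inner_diff_right inner_commute)
  then show ?thesis by simp
qed

lemma adjoint_lin_i: "adjoint lin (\<eta> i) = c *\<^sub>R \<eta> j"
  using i_w by (simp add: adjoint_lin d_def inner_commute)

lemma reflect_reflect [simp]: "reflect \<kappa>' (reflect \<kappa>' x) = x"
proof -
  have eq: "reflect \<kappa>' y = y + (\<kappa>' $ i - c * \<kappa>' $ j - d \<bullet> y) *\<^sub>R w" for y
    by (simp add: reflect_def lin_def scaleR_diff_left)
  show ?thesis by (simp add: eq inner_add_right d_w flip: scaleR_add_left)
qed

lemma inner_reflect:
  "\<eta> i \<bullet> reflect \<kappa>' x - \<kappa>' $ i = c * (\<eta> j \<bullet> x - \<kappa>' $ j)"
  "c * (\<eta> j \<bullet> reflect \<kappa>' x - \<kappa>' $ j) = \<eta> i \<bullet> x - \<kappa>' $ i"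
  "k \<noteq> i \<Longrightarrow> k \<noteq> j \<Longrightarrow> \<eta> k \<bullet> reflect \<kappa>' x = \<eta> k \<bullet> x"
proof -
  have dx: "d \<bullet> x = \<eta> i \<bullet> x - c * (\<eta> j \<bullet> x)" by (simp add: d_def inner_diff_left)
  show "\<eta> i \<bullet> reflect \<kappa>' x - \<kappa>' $ i = c * (\<eta> j \<bullet> x - \<kappa>' $ j)"
    by (simp add: reflect_def lin_def inner_diff_right inner_add_right i_w dx algebra_simps)
  have "c * (\<eta> j \<bullet> reflect \<kappa>' x) = c * (\<eta> j \<bullet> x) + (\<kappa>' $ i - c * \<kappa>' $ j - d \<bullet> x) * (c * (\<eta> j \<bullet> w))"
    by (simp add: reflect_def lin_def inner_diff_right inner_add_right algebra_simps)
  then show "c * (\<eta> j \<bullet> reflect \<kappa>' x - \<kappa>' $ j) = \<eta> i \<bullet> x - \<kappa>' $ i"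
    unfolding j_w dx by (simp add: algebra_simps)
  show "\<eta> k \<bullet> reflect \<kappa>' x = \<eta> k \<bullet> x" if "k \<noteq> i" "k \<noteq> j"
    using others_w[OF that] by (simp add: reflect_def lin_def inner_diff_right inner_add_right)
qed

lemma reflect_tight:
  "\<eta> i \<bullet> reflect \<kappa>' x \<le> \<kappa>' $ i \<longleftrightarrow> \<eta> j \<bullet> x \<le> \<kappa>' $ j"
  "\<eta> j \<bullet> reflect \<kappa>' x \<le> \<kappa>' $ j \<longleftrightarrow> \<eta> i \<bullet> x \<le> \<kappa>' $ i"
proof -
  have "\<eta> i \<bullet> reflect \<kappa>' x \<le> \<kappa>' $ i \<longleftrightarrow> c * (\<eta> j \<bullet> x - \<kappa>' $ j) \<le> 0" for x
    using inner_reflect(1)[of \<kappa>' x] by linarith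
  then show *: "\<eta> i \<bullet> reflect \<kappa>' x \<le> \<kappa>' $ i \<longleftrightarrow> \<eta> j \<bullet> x \<le> \<kappa>' $ j" for x
    using pos by (simp add: mult_le_0_iff)
  show "\<eta> j \<bullet> reflect \<kappa>' x \<le> \<kappa>' $ j \<longleftrightarrow> \<eta> i \<bullet> x \<le> \<kappa>' $ i"
    using *[of "reflect \<kappa>' x"] by simp
qed

lemma reflect_poly_set: "reflect \<kappa>' x \<in> poly_set \<eta> \<kappa>' \<longleftrightarrow> x \<in> poly_set \<eta> \<kappa>'"
proof -
  have "(\<forall>k. \<eta> k \<bullet> reflect \<kappa>' x \<le> \<kappa>' $ k) \<longleftrightarrow> (\<forall>k. \<eta> k \<bullet> x \<le> \<kappa>' $ k)"
    using reflect_tight inner_reflect(3) by (metis (no_types, lifting))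
  then show ?thesis by (simp add: mem_poly_set)
qed

lemma reflect_image_poly_set: "reflect \<kappa>' ` poly_set \<eta> \<kappa>' = poly_set \<eta> \<kappa>'"
  by (rule image_eq_involution) (simp_all add: reflect_poly_set)

lemma symmetry_reflect: "symmetry_of (poly_set \<eta> \<kappa>') lin (reflect \<kappa>')"
  unfolding symmetry_of_def using linear_lin reflect_image_poly_set by (auto simp: reflect_def)

lemma reflect_poly_facet:
  "reflect \<kappa>' ` poly_facet \<eta> \<kappa>' i = poly_facet \<eta> \<kappa>' j"
  "reflect \<kappa>' ` poly_facet \<eta> \<kappa>' j = poly_facet \<eta> \<kappa>' i"
proof -
  have ij: "reflect \<kappa>' x \<in> poly_facet \<eta> \<kappa>' j" if "x \<in> poly_facet \<eta> \<kappa>' i" for x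
  proof -
    have "\<eta> i \<bullet> x = \<kappa>' $ i" "x \<in> poly_set \<eta> \<kappa>'" using that by (auto simp: poly_facet_def)
    then show ?thesis using inner_reflect(2)[of \<kappa>' x] pos reflect_poly_set by (simp add: poly_facet_def)
  qed
  have ji: "reflect \<kappa>' x \<in> poly_facet \<eta> \<kappa>' i" if "x \<in> poly_facet \<eta> \<kappa>' j" for x
  proof -
    have "\<eta> j \<bullet> x = \<kappa>' $ j" "x \<in> poly_set \<eta> \<kappa>'" using that by (auto simp: poly_facet_def)
    then show ?thesis using inner_reflect(1)[of \<kappa>' x] reflect_poly_set by (simp add: poly_facet_def)
  qed
  show "reflect \<kappa>' ` poly_facet \<eta> \<kappa>' i = poly_facet \<eta> \<kappa>' j"
    using ij ji by (intro image_eq_involution) simp_all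
  show "reflect \<kappa>' ` poly_facet \<eta> \<kappa>' j = poly_facet \<eta> \<kappa>' i"
    using ij ji by (intro image_eq_involution) simp_all
qed

lemma distr_reflect: "distr lborel borel (\<lambda>x. lin x + v) = lborel"
  by (rule lborel_distr_affine_involution[OF dim2 linear_lin]) simp

text \<open>The center of mass is fixed by the reflection, which determines its pairing with \<open>d\<close>.\<close>

lemma inner_center_of_mass:
  assumes "simple_polytope \<eta> \<kappa>'"
  shows "d \<bullet> center_of_mass (poly_set \<eta> \<kappa>') = \<kappa>' $ i - c * \<kappa>' $ j"
proof -
  interpret P: simple_polygon \<eta> \<kappa>' using dim2 assms by unfold_locales
  let ?v = "(\<kappa>' $ i - c * \<kappa>' $ j) *\<^sub>R w" and ?z = "center_of_mass (poly_set \<eta> \<kappa>')"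
  have "?z = lin ?z + ?v"
  proof (rule center_of_mass_affine[OF linear_lin distr_reflect])
    show "poly_set \<eta> \<kappa>' = (\<lambda>x. lin x + ?v) -` poly_set \<eta> \<kappa>'"
      using reflect_poly_set by (auto simp: reflect_def)
    show "measure lborel (poly_set \<eta> \<kappa>') \<noteq> 0" using P.area_pos by (simp add: area_def)
  qed (auto simp: compact_poly_set)
  then have "d \<bullet> ?z = d \<bullet> (lin ?z + ?v)" by simp
  also have "\<dots> = - (d \<bullet> ?z) + 2 * (\<kappa>' $ i - c * \<kappa>' $ j)"
    by (simp add: lin_def inner_diff_right inner_add_right d_w)
  finally show ?thesis by simp
qed

lemma mass_linear_d: "mass_linear \<eta> \<kappa> (\<lambda>x. d \<bullet> x)"
  unfolding mass_linear_def
proof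
  show "\<exists>h. affine_with_linear_part h (\<lambda>x. d \<bullet> x)"
    unfolding affine_with_linear_part_def by (intro exI[of _ d] exI[of _ 0]) simp
  show "\<exists>\<gamma> C. \<forall>\<kappa>'\<in>chamber \<eta> \<kappa>. d \<bullet> center_of_mass (poly_set \<eta> \<kappa>') = (\<Sum>k\<in>UNIV. \<gamma> k * \<kappa>' $ k) + C"
  proof (intro exI[of _ "\<lambda>k. (if k = i then 1 else 0) - c * (if k = j then 1 else 0)"] exI[of _ 0] ballI)
    fix \<kappa>' assume "\<kappa>' \<in> chamber \<eta> \<kappa>"
    have "(\<Sum>k\<in>UNIV. ((if k = i then 1 else 0) - c * (if k = j then 1 else 0)) * \<kappa>' $ k)
      = (\<Sum>k\<in>UNIV. (if k = i then \<kappa>' $ k else 0)) - (\<Sum>k\<in>UNIV. (if k = j then c * \<kappa>' $ k else 0))"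
      unfolding sum_subtractf[symmetric] by (intro sum.cong) (auto simp: algebra_simps)
    then show "d \<bullet> center_of_mass (poly_set \<eta> \<kappa>')
      = (\<Sum>k\<in>UNIV. ((if k = i then 1 else 0) - c * (if k = j then 1 else 0)) * \<kappa>' $ k) + 0"
      using inner_center_of_mass[OF chamber_simple[OF \<open>\<kappa>' \<in> chamber \<eta> \<kappa>\<close>]] by simp
  qed
qed

lemma not_constant_d: "\<not> (\<lambda>x. d \<bullet> x) constant_on UNIV"
proof
  assume "(\<lambda>x. d \<bullet> x) constant_on UNIV"
  then obtain b where "\<forall>x. d \<bullet> x = b" by (auto simp: constant_on_def)
  then have "d \<bullet> w = d \<bullet> 0" by metis
  then show False by (simp add: d_w)
qed

lemma area_raise_reflect:
  assumes "c = 1"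
  shows "area \<eta> (raise \<kappa> i s) = area \<eta> (raise \<kappa> j s)"
proof -
  have "reflect \<kappa> x \<in> poly_set \<eta> (raise \<kappa> i s) \<longleftrightarrow> x \<in> poly_set \<eta> (raise \<kappa> j s)" for x
  proof -
    have i: "\<eta> i \<bullet> reflect \<kappa> x = \<kappa> $ i + (\<eta> j \<bullet> x - \<kappa> $ j)" and j: "\<eta> j \<bullet> reflect \<kappa> x = \<kappa> $ j + (\<eta> i \<bullet> x - \<kappa> $ i)"
      using inner_reflect(1,2)[of \<kappa> x] assms by simp_all
    have "(\<forall>k. \<eta> k \<bullet> reflect \<kappa> x \<le> raise \<kappa> i s $ k) \<longleftrightarrow>
      \<eta> i \<bullet> reflect \<kappa> x \<le> \<kappa> $ i + s \<and> \<eta> j \<bullet> reflect \<kappa> x \<le> \<kappa> $ j \<and> (\<forall>k. k \<noteq> i \<longrightarrow> k \<noteq> j \<longrightarrow> \<eta> k \<bullet> reflect \<kappa> x \<le> \<kappa> $ k)"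
      using distinct by (auto split: if_splits)
    also have "\<dots> \<longleftrightarrow> \<eta> j \<bullet> x \<le> \<kappa> $ j + s \<and> \<eta> i \<bullet> x \<le> \<kappa> $ i \<and> (\<forall>k. k \<noteq> i \<longrightarrow> k \<noteq> j \<longrightarrow> \<eta> k \<bullet> x \<le> \<kappa> $ k)"
      unfolding i j using inner_reflect(3)[of _ \<kappa> x] by auto
    also have "\<dots> \<longleftrightarrow> (\<forall>k. \<eta> k \<bullet> x \<le> raise \<kappa> j s $ k)"
      using distinct by (auto split: if_splits)
    finally show ?thesis by (simp only: mem_poly_set)
  qed
  then have "reflect \<kappa> -` poly_set \<eta> (raise \<kappa> i s) = poly_set \<eta> (raise \<kappa> j s)" by blast
  moreover have "reflect \<kappa> \<in> borel_measurable borel"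
    unfolding reflect_def using linear_lin
    by (intro borel_measurable_continuous_onI continuous_intros linear_continuous_on) (simp add: linear_conv_bounded_linear)
  then have "measure lborel (reflect \<kappa> -` poly_set \<eta> (raise \<kappa> i s)) = measure lborel (poly_set \<eta> (raise \<kappa> i s))"
    using distr_reflect by (intro measure_preimage) (auto simp: reflect_def[abs_def])
  ultimately show ?thesis by (simp add: area_def)
qed

end

text \<open>Two symmetries with the same linear part differ by a translation that preserves a nonempty
  compact set; a point of the set farthest in the direction of the translation cannot be moved
  further, so the translation is trivial.\<close>

lemma symmetry_of_unique:
  fixes S :: "'a::euclidean_space set"
  assumes "compact S" "S \<noteq> {}" "symmetry_of S f a" "symmetry_of S f b"
  shows "a = b"
proof -
  obtain v v' where v: "\<And>x. a x = f x + v" "a ` S = S" and v': "\<And>x. b x = f x + v'" "b ` S = S"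
    using assms(3,4) unfolding symmetry_of_def by blast
  define u where "u = v' - v"
  have shift: "x + u \<in> S" if "x \<in> S" for x
  proof -
    have "x \<in> a ` S" using that by (simp add: v(2))
    then obtain y where "y \<in> S" "x = a y" by blast
    then have "b y \<in> b ` S" "b y = x + u" by (simp_all add: v(1) v'(1) u_def)
    then have "b y \<in> S" "b y = x + u" by (simp_all add: v'(2))
    then show ?thesis by simp
  qed
  have "continuous_on S ((\<bullet>) u)" by (intro continuous_intros)
  then obtain x where x: "x \<in> S" "\<forall>y\<in>S. u \<bullet> y \<le> u \<bullet> x"
    using continuous_attains_sup[OF assms(1,2)] by blast
  have "u \<bullet> (x + u) \<le> u \<bullet> x" using x(2) shift[OF x(1)] by blast
  then have "u \<bullet> u \<le> 0" by (simp add: inner_add_right)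
  then have "u = 0" by (metis inner_gt_zero_iff not_le)
  then show ?thesis by (auto simp: v(1) v'(1) u_def)
qed

context facet_reflection begin

lemma robust_symmetry_lin: "lin \<in> G \<Longrightarrow> robust_symmetry G \<eta> \<kappa> lin"
  unfolding robust_symmetry_def using linear_lin symmetry_reflect by blast

lemma equivalent_facets_compose:
  assumes G: "lin \<in> G" "\<And>g. g \<in> G \<Longrightarrow> lin \<circ> g \<in> G"
    and xy: "(x, y) \<in> equivalent_facets G \<eta> \<kappa>"
    and yz: "\<And>\<kappa>'. reflect \<kappa>' ` poly_facet \<eta> \<kappa>' y = poly_facet \<eta> \<kappa>' z"
  shows "(x, z) \<in> equivalent_facets G \<eta> \<kappa>"
proof -
  obtain g where g: "robust_symmetry G \<eta> \<kappa> g"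
    "\<And>\<kappa>' a. \<kappa>' \<in> chamber \<eta> \<kappa> \<Longrightarrow> symmetry_of (poly_set \<eta> \<kappa>') g a \<Longrightarrow> a ` poly_facet \<eta> \<kappa>' x = poly_facet \<eta> \<kappa>' y"
    using xy unfolding equivalent_facets_def by blast
  have comp: "symmetry_of (poly_set \<eta> \<kappa>') (lin \<circ> g) (reflect \<kappa>' \<circ> a)"
    if a: "symmetry_of (poly_set \<eta> \<kappa>') g a" for \<kappa>' a
  proof -
    obtain v where v: "linear g" "\<And>x. a x = g x + v" "a ` poly_set \<eta> \<kappa>' = poly_set \<eta> \<kappa>'"
      using a unfolding symmetry_of_def by blast
    have "(reflect \<kappa>' \<circ> a) x = (lin \<circ> g) x + (lin v + (\<kappa>' $ i - c * \<kappa>' $ j) *\<^sub>R w)" for x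
      by (simp add: reflect_def v(2) linear_add[OF linear_lin])
    moreover have "(reflect \<kappa>' \<circ> a) ` poly_set \<eta> \<kappa>' = poly_set \<eta> \<kappa>'"
      unfolding image_comp[symmetric] v(3) by (rule reflect_image_poly_set)
    ultimately show ?thesis
      unfolding symmetry_of_def using linear_compose[OF v(1) linear_lin] by blast
  qed
  have g': "g \<in> G" "linear g" "\<And>\<kappa>'. \<kappa>' \<in> chamber \<eta> \<kappa> \<Longrightarrow> \<exists>a. symmetry_of (poly_set \<eta> \<kappa>') g a"
    using g(1) unfolding robust_symmetry_def by blast+
  have "robust_symmetry G \<eta> \<kappa> (lin \<circ> g)"
    unfolding robust_symmetry_def using G(2)[OF g'(1)] linear_compose[OF g'(2) linear_lin] g'(3) comp by blast
  moreover have "b ` poly_facet \<eta> \<kappa>' x = poly_facet \<eta> \<kappa>' z"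
    if \<kappa>': "\<kappa>' \<in> chamber \<eta> \<kappa>" and b: "symmetry_of (poly_set \<eta> \<kappa>') (lin \<circ> g) b" for \<kappa>' b
  proof -
    interpret P: simple_polygon \<eta> \<kappa>' using dim2 chamber_simple[OF \<kappa>'] by unfold_locales
    obtain a where a: "symmetry_of (poly_set \<eta> \<kappa>') g a" using g'(3)[OF \<kappa>'] by blast
    have "poly_set \<eta> \<kappa>' \<noteq> {}" using P.interior_nonempty interior_subset by blast
    then have "b = reflect \<kappa>' \<circ> a"
      using symmetry_of_unique[OF compact_poly_set _ b comp[OF a]] by blast
    then show ?thesis using g(2)[OF \<kappa>' a] yz by (metis image_comp)
  qed
  ultimately show ?thesis unfolding equivalent_facets_def by blast
qed

text \<open>Composition with the reflection shows that every class is invariant under exchanging \<open>i\<close> and \<open>j\<close>.\<close>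

lemma class_swap:
  assumes "lin \<in> G" "\<And>g. g \<in> G \<Longrightarrow> lin \<circ> g \<in> G" "I \<in> UNIV // equivalent_facets G \<eta> \<kappa>"
  shows "i \<in> I \<longleftrightarrow> j \<in> I"
proof -
  obtain x where "I = equivalent_facets G \<eta> \<kappa> `` {x}" using assms(3) by (auto simp: quotient_def)
  then show ?thesis
    using equivalent_facets_compose[OF assms(1,2) _ reflect_poly_facet(1)]
      equivalent_facets_compose[OF assms(1,2) _ reflect_poly_facet(2)] by auto
qed

end

section \<open>Normalized and primitive conormals\<close>

lemma (in simple_polygon) positively_proportional_conormals:
  assumes "\<eta> m = c *\<^sub>R \<eta> j" "c > 0"
  shows "m = j"
proof (rule ccontr)
  assume "m \<noteq> j"
  obtain p where p: "\<eta> j \<bullet> p = \<kappa> $ j" "\<forall>k. k \<noteq> j \<longrightarrow> \<eta> k \<bullet> p < \<kappa> $ k" by (rule facet_strict_point)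
  obtain q where q: "\<eta> m \<bullet> q = \<kappa> $ m" "\<forall>k. k \<noteq> m \<longrightarrow> \<eta> k \<bullet> q < \<kappa> $ k" by (rule facet_strict_point)
  have "\<eta> m \<bullet> p < \<kappa> $ m" using p(2) \<open>m \<noteq> j\<close> by blast
  then have "c * \<kappa> $ j < \<kappa> $ m" using p(1) assms(1) by simp
  moreover have "\<eta> j \<bullet> q < \<kappa> $ j" using q(2) \<open>m \<noteq> j\<close> by metis
  then have "c * (\<eta> j \<bullet> q) < c * \<kappa> $ j" using assms(2) by simp
  then have "\<kappa> $ m < c * \<kappa> $ j" using q(1) assms(1) by simp
  ultimately show False by simp
qed

text \<open>The adjoint of the linear part takes \<open>\<eta> i\<close> to \<open>c *\<^sub>R \<eta> j\<close>, and two conormals are never positively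
  proportional.\<close>

lemma (in facet_reflection) normalized_factor:
  assumes "normalized UNIV \<eta> \<kappa>"
  shows "c = 1"
proof -
  obtain m where m: "adjoint lin (\<eta> i) = \<eta> m"
    using assms robust_symmetry_lin[of UNIV] unfolding normalized_def by blast
  then have eq: "\<eta> m = c *\<^sub>R \<eta> j" by (simp add: adjoint_lin_i)
  then have "m = j" using pos by (rule positively_proportional_conormals)
  then have "(c - 1) *\<^sub>R \<eta> j = 0" using eq by (simp add: scaleR_diff_left)
  then show ?thesis using conormal_nonzero by simp
qed

lemma int_span_pair:
  assumes "a \<noteq> b"
  shows "x \<in> int_span {a, b} \<longleftrightarrow> (\<exists>m n :: int. x = of_int m *\<^sub>R a + of_int n *\<^sub>R b)"
proof
  assume "x \<in> int_span {a, b}"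
  then obtain f :: "'a \<Rightarrow> int" where "x = (\<Sum>b\<in>{a, b}. of_int (f b) *\<^sub>R b)"
    unfolding int_span_def by blast
  then have "x = of_int (f a) *\<^sub>R a + of_int (f b) *\<^sub>R b" using assms by simp
  then show "\<exists>m n :: int. x = of_int m *\<^sub>R a + of_int n *\<^sub>R b" by blast
next
  assume "\<exists>m n :: int. x = of_int m *\<^sub>R a + of_int n *\<^sub>R b"
  then obtain m n :: int where "x = of_int m *\<^sub>R a + of_int n *\<^sub>R b" by blast
  then have "x = (\<Sum>e\<in>{a, b}. of_int ((\<lambda>e. if e = a then m else n) e) *\<^sub>R e)" using assms by simp
  then show "x \<in> int_span {a, b}"
    unfolding int_span_def by (intro CollectI exI[of _ "\<lambda>e. if e = a then m else n"]) simp
qed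

lemma lattice_maps_compose:
  assumes "f \<in> lattice_maps L" "g \<in> lattice_maps L"
  shows "f \<circ> g \<in> lattice_maps L"
proof -
  have lin: "linear f" "linear g" and bij: "bij_betw (adjoint f) L L" "bij_betw (adjoint g) L L"
    using assms by (auto simp: lattice_maps_def)
  have "adjoint (f \<circ> g) = adjoint g \<circ> adjoint f"
    by (rule adjoint_unique) (simp add: adjoint_works[OF lin(1)] adjoint_works[OF lin(2)] inner_commute)
  then show ?thesis
    using bij_betw_trans[OF bij] linear_compose[OF lin(2,1)] by (simp add: lattice_maps_def)
qed

context facet_reflection begin

text \<open>All facets other than \<open>i\<close> and \<open>j\<close> are parallel to each other, so that the two neighbours of any of
  them are \<open>i\<close> and \<open>j\<close>.\<close>

lemma other_facet_adjacent:
  assumes "k \<noteq> i" "k \<noteq> j"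
  shows "adjacent \<eta> \<kappa> k i" "adjacent \<eta> \<kappa> k j"
proof -
  have "m \<in> {i, j}" if a: "adjacent \<eta> \<kappa> k m" for m
  proof (rule ccontr)
    assume m: "m \<notin> {i, j}"
    obtain z where "\<eta> k \<bullet> z = 0" "\<eta> m \<bullet> z = 1" by (rule conormals_dual[OF a])
    have "w \<noteq> 0" using i_w by auto
    have "\<exists>a. \<eta> m = a *\<^sub>R \<eta> k"
      using others_w assms m by (intro orthogonal_parallel_2d[OF dim2 \<open>w \<noteq> 0\<close> conormal_nonzero]) auto
    then show False using \<open>\<eta> k \<bullet> z = 0\<close> \<open>\<eta> m \<bullet> z = 1\<close> by auto
  qed
  then have "{m. adjacent \<eta> \<kappa> k m} \<subseteq> {i, j}" by blast
  moreover have "card {i, j} = card {m. adjacent \<eta> \<kappa> k m}" using distinct by (simp add: card_adjacent)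
  ultimately have "{m. adjacent \<eta> \<kappa> k m} = {i, j}" by (intro card_subset_eq) auto
  then show "adjacent \<eta> \<kappa> k i" "adjacent \<eta> \<kappa> k j" by auto
qed

lemma adjoint_lin_other: "k \<noteq> i \<Longrightarrow> k \<noteq> j \<Longrightarrow> adjoint lin (\<eta> k) = \<eta> k"
  using others_w by (simp add: adjoint_lin inner_commute)

lemma linear_adjoint_lin: "linear (adjoint lin)"
  by (rule adjoint_linear[OF linear_lin])

lemma adjoint_lin_involution: "adjoint lin (adjoint lin y) = y"
proof -
  have "w \<bullet> d = 2" using d_w by (simp add: inner_commute)
  then show ?thesis by (simp add: adjoint_lin inner_diff_right algebra_simps flip: scaleR_2)
qed

text \<open>For a facet \<open>k\<close> different from \<open>i\<close> and \<open>j\<close>, both \<open>\<eta> k, \<eta> i\<close> and \<open>\<eta> k, \<eta> j\<close> are bases of the lattice. Hence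
  \<open>\<eta> j\<close> is congruent to an invertible integer multiple of \<open>\<eta> i\<close> modulo \<open>\<eta> k\<close>; the multiple is negative, so it is
  \<open>-1\<close>. The adjoint of the linear part exchanges the two bases and thus preserves the lattice.\<close>

lemma smooth_factor:
  assumes "smooth_polytope L \<eta> \<kappa>"
  shows "c = 1" "lin \<in> lattice_maps L"
proof -
  have "card {i, j} < CARD('n)" using three_le_facets distinct by simp
  then have "{i, j} \<noteq> UNIV" by auto
  then obtain k where k: "k \<noteq> i" "k \<noteq> j" by blast
  note adj = other_facet_adjacent[OF k]
  have ne: "\<eta> k \<noteq> \<eta> m" if a: "adjacent \<eta> \<kappa> k m" for m
  proof -
    obtain z where "\<eta> k \<bullet> z = 0" "\<eta> m \<bullet> z = 1" by (rule conormals_dual[OF a])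
    then show ?thesis by auto
  qed
  have L: "L = int_span {\<eta> k, \<eta> m}" if a: "adjacent \<eta> \<kappa> k m" for m
  proof -
    obtain v where v: "\<eta> k \<bullet> v = \<kappa> $ k" "\<eta> m \<bullet> v = \<kappa> $ m"
      "\<forall>l. l \<notin> {k, m} \<longrightarrow> \<eta> l \<bullet> v < \<kappa> $ l"
      "v extreme_point_of poly_set \<eta> \<kappa>" "facets_at \<eta> \<kappa> v = {k, m}"
      by (rule adjacent_vertex[OF a])
    then have "lattice_basis (\<eta> ` {k, m}) L" using assms unfolding smooth_polytope_def by metis
    then show ?thesis by (simp add: lattice_basis_def)
  qed
  have Li: "x \<in> L \<longleftrightarrow> (\<exists>m n :: int. x = of_int m *\<^sub>R \<eta> k + of_int n *\<^sub>R \<eta> i)" for x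
    using int_span_pair[OF ne[OF adj(1)]] L[OF adj(1)] by simp
  have Lj: "x \<in> L \<longleftrightarrow> (\<exists>m n :: int. x = of_int m *\<^sub>R \<eta> k + of_int n *\<^sub>R \<eta> j)" for x
    using int_span_pair[OF ne[OF adj(2)]] L[OF adj(2)] by simp
  have "\<eta> i = of_int 0 *\<^sub>R \<eta> k + of_int 1 *\<^sub>R \<eta> i" "\<eta> j = of_int 0 *\<^sub>R \<eta> k + of_int 1 *\<^sub>R \<eta> j" by simp_all
  then have "\<eta> i \<in> L" "\<eta> j \<in> L" using Li Lj by blast+
  then obtain m n m' n' :: int where mn: "\<eta> j = of_int m *\<^sub>R \<eta> k + of_int n *\<^sub>R \<eta> i"
    "\<eta> i = of_int m' *\<^sub>R \<eta> k + of_int n' *\<^sub>R \<eta> j" using Li Lj by metis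
  have kw: "\<eta> k \<bullet> w = 0" using others_w k by simp
  have n: "\<eta> j \<bullet> w = of_int n" using arg_cong[OF mn(1), of "\<lambda>x. x \<bullet> w"] kw i_w by (simp add: inner_add_left)
  moreover have "1 = of_int n' * (\<eta> j \<bullet> w)"
    using arg_cong[OF mn(2), of "\<lambda>x. x \<bullet> w"] kw i_w by (simp add: inner_add_left)
  ultimately have "real_of_int (n' * n) = real_of_int 1" by simp
  then have "n' * n = 1" by (simp only: of_int_eq_iff)
  then have "n = 1 \<or> n = -1" by (metis mult.commute zmult_eq_1_iff)
  moreover have "c * of_int n = -1" using j_w n by simp
  ultimately show c: "c = 1" using pos by auto
  have i_to_j: "adjoint lin (\<eta> i) = \<eta> j" by (subst adjoint_lin_i) (simp add: c)
  have sub: "adjoint lin x \<in> L" if x: "x \<in> L" for x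
  proof -
    obtain a b :: int where "x = of_int a *\<^sub>R \<eta> k + of_int b *\<^sub>R \<eta> i" using x Li by blast
    then have "adjoint lin x = of_int a *\<^sub>R \<eta> k + of_int b *\<^sub>R \<eta> j"
      by (simp add: linear_add[OF linear_adjoint_lin] linear_cmul[OF linear_adjoint_lin]
          adjoint_lin_other[OF k] i_to_j)
    then show ?thesis using Lj by blast
  qed
  have "bij_betw (adjoint lin) L L"
    by (rule bij_betw_byWitness[where f' = "adjoint lin"]) (auto simp: adjoint_lin_involution sub)
  then show "lin \<in> lattice_maps L" by (simp add: lattice_maps_def linear_lin)
qed

end

section \<open>Mass linear functions on triangles and trapezoids\<close>

context mass_linear_polygon begin

lemma nonzero_imp_few_facets:
  assumes "h \<noteq> 0"
  shows "CARD('n) = 3 \<or> CARD('n) = 4 \<and> (\<exists>k l c. k \<noteq> l \<and> \<eta> l = c *\<^sub>R \<eta> k)"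
proof -
  have "\<exists>i. \<gamma> i \<noteq> 0"
  proof (rule ccontr)
    assume "\<nexists>i. \<gamma> i \<noteq> 0"
    then show False using assms linear_part_eq by simp
  qed
  then obtain i where i: "\<gamma> i \<noteq> 0" by blast
  then have "\<not> 5 \<le> CARD('n)" using large_polygon_coefficients by blast
  then consider "CARD('n) = 3" | "CARD('n) = 4" using three_le_facets by linarith
  then show ?thesis
  proof cases
    case 2
    obtain j k l where q: "UNIV = {i, j, k, l}" "distinct [i, j, k, l]"
      "\<not> adjacent \<eta> \<kappa> i j" "\<not> adjacent \<eta> \<kappa> k l"
      "adjacent \<eta> \<kappa> i k" "adjacent \<eta> \<kappa> i l" "adjacent \<eta> \<kappa> j k" "adjacent \<eta> \<kappa> j l"
      by (rule quadrilateral_structure[OF 2])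
    obtain c where "\<eta> l = c *\<^sub>R \<eta> k"
      by (rule neighbours_parallel[OF q(1) _ _ _ _ q(3,5,6)]) (use q(2) i in auto)
    then show ?thesis using 2 q(2) by auto
  qed simp
qed

text \<open>In a quadrilateral, the coefficients of two opposite facets either both vanish, or are
  negatives of each other and the two facets are exchanged by a facet reflection.\<close>

lemma opposite_coefficients:
  assumes univ: "UNIV = {i, j, k, l}" and dist: "distinct [i, j, k, l]"
    and adj: "\<not> adjacent \<eta> \<kappa> i j" "adjacent \<eta> \<kappa> i k" "adjacent \<eta> \<kappa> i l"
    and unit: "\<forall>w c. facet_reflection \<eta> \<kappa> i j w c \<longrightarrow> c = 1"
  shows "\<gamma> i = 0 \<and> \<gamma> j = 0 \<or> \<gamma> i + \<gamma> j = 0 \<and> (\<exists>w. facet_reflection \<eta> \<kappa> i j w 1)"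
proof (cases "\<gamma> i \<noteq> 0 \<or> \<gamma> j \<noteq> 0")
  case True
  obtain a where a: "\<eta> l = a *\<^sub>R \<eta> k"
    by (rule neighbours_parallel[OF univ _ _ _ _ adj]) (use dist True in auto)
  obtain w0 where w0: "w0 \<noteq> 0" "orthogonal (\<eta> k) w0"
    using orthogonal_to_vector_exists[of "\<eta> k"] dim2 by auto
  have others: "m = k \<or> m = l" if "m \<noteq> i" "m \<noteq> j" for m using that univ by blast
  have "\<eta> m \<bullet> w0 = 0" if "m \<noteq> i" "m \<noteq> j" for m
    using others[OF that] a w0(2) by (auto simp: orthogonal_def)
  then obtain w c where F: "facet_reflection \<eta> \<kappa> i j w c"
    using facet_reflection_exists[of i j w0] w0(1) dist by (metis distinct_length_2_or_more)
  then have F1: "facet_reflection \<eta> \<kappa> i j w 1" using unit by blast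
  define s where "s = radius / 3"
  have s: "s > 0" "s + s < radius" using radius_pos by (simp_all add: s_def)
  have "s * \<gamma> i * (area \<eta> (raise \<kappa> j s) - area \<eta> \<kappa>) + s * \<gamma> j * (area \<eta> (raise \<kappa> i s) - area \<eta> \<kappa>) = 0"
    by (rule nonadjacent_relation[OF _ adj(1)]) (use s dist in auto)
  moreover have "area \<eta> (raise \<kappa> i s) = area \<eta> (raise \<kappa> j s)"
    by (rule facet_reflection.area_raise_reflect[OF F1]) simp
  ultimately have "s * (area \<eta> (raise \<kappa> i s) - area \<eta> \<kappa>) * (\<gamma> i + \<gamma> j) = 0" by (simp add: algebra_simps)
  moreover have "area \<eta> \<kappa> < area \<eta> (raise \<kappa> i s)" by (rule area_raise_less[OF s(1)])
  ultimately have "\<gamma> i + \<gamma> j = 0" using s(1) by simp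
  then show ?thesis using F1 by blast
qed simp

end

lemma (in simple_polygon) triangle_reflection:
  assumes "(UNIV :: 'n set) = {i, j, k}" "distinct [i, j, k]"
  obtains w c where "facet_reflection \<eta> \<kappa> i j w c"
proof -
  obtain w0 where w0: "w0 \<noteq> 0" "orthogonal (\<eta> k) w0"
    using orthogonal_to_vector_exists[of "\<eta> k"] dim2 by auto
  have others: "m = k" if "m \<noteq> i" "m \<noteq> j" for m using that assms(1) by blast
  have "\<eta> m \<bullet> w0 = 0" if "m \<noteq> i" "m \<noteq> j" for m
    using others[OF that] w0(2) by (auto simp: orthogonal_def)
  then show ?thesis
    using facet_reflection_exists[of i j w0] w0(1) assms(2) that by (metis distinct_length_2_or_more)
qed

lemma (in facet_reflection) sum_conormals_orthogonal:
  assumes "c = 1"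
  shows "(\<Sum>m\<in>UNIV. \<eta> m) \<bullet> w = 0"
proof -
  have "(\<Sum>m\<in>UNIV. \<eta> m \<bullet> w) = (\<Sum>m\<in>{i, j}. \<eta> m \<bullet> w)"
    by (rule sum.mono_neutral_right) (auto simp: others_w)
  also have "\<dots> = 0" using distinct i_w j_w assms by simp
  finally show ?thesis by (simp add: inner_sum_left)
qed

text \<open>The sum of the conormals vanishes along the directions of all three reflections, so it would
  otherwise be parallel to every conormal.\<close>

lemma (in simple_polygon) triangle_sum_conormals:
  assumes univ: "(UNIV :: 'n set) = {i, j, k}" and dist: "distinct [i, j, k]"
    and unit: "\<forall>i j w c. facet_reflection \<eta> \<kappa> i j w c \<longrightarrow> c = 1"
  shows "(\<Sum>m\<in>UNIV. \<eta> m) = 0"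
proof (rule ccontr)
  let ?s = "\<Sum>m\<in>UNIV. \<eta> m"
  assume s: "?s \<noteq> 0"
  have par: "\<exists>a. \<eta> z = a *\<^sub>R ?s" if u: "UNIV = {x, y, z}" "distinct [x, y, z]" for x y z
  proof -
    obtain w c where F: "facet_reflection \<eta> \<kappa> x y w c" by (rule triangle_reflection[OF u])
    interpret F: facet_reflection \<eta> \<kappa> x y w c by (rule F)
    have w: "w \<noteq> 0" using F.i_w by auto
    have "?s \<bullet> w = 0" using F unit by (intro F.sum_conormals_orthogonal) blast
    moreover have "\<eta> z \<bullet> w = 0" using F.others_w u(2) by auto
    ultimately show ?thesis by (intro orthogonal_parallel_2d[OF dim2 w s])
  qed
  obtain a where a: "\<eta> k = a *\<^sub>R ?s" using par[of i j k] univ dist by auto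
  have "UNIV = {k, j, i}" "distinct [k, j, i]" using univ dist by auto
  from par[OF this] obtain b where b: "\<eta> i = b *\<^sub>R ?s" by blast
  have "card (UNIV::'n set) = 3" unfolding univ using dist by simp
  then have adj: "adjacent \<eta> \<kappa> k i" using triangle_adjacent[of k i] dist by auto
  obtain z where "\<eta> k \<bullet> z = 0" "\<eta> i \<bullet> z = 1" by (rule conormals_dual[OF adj])
  then show False using a b conormal_nonzero[of k] by auto
qed

lemma (in mass_linear_polygon) inessential_coefficients:
  assumes h: "h \<noteq> 0"
    and unit: "\<forall>i j w c. facet_reflection \<eta> \<kappa> i j w c \<longrightarrow> c = 1"
    and swap: "\<forall>i j w c. facet_reflection \<eta> \<kappa> i j w c \<longrightarrow>
      (\<forall>I \<in> UNIV // equivalent_facets G \<eta> \<kappa>. i \<in> I \<longleftrightarrow> j \<in> I)"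
  shows "\<exists>\<beta>. h = (\<Sum>i\<in>UNIV. \<beta> i *\<^sub>R \<eta> i) \<and>
    (\<forall>I \<in> UNIV // equivalent_facets G \<eta> \<kappa>. (\<Sum>i\<in>I. \<beta> i) = 0)"
  using nonzero_imp_few_facets[OF h]
proof (elim disjE conjE)
  assume "CARD('n) = 3"
  then obtain i j k where univ: "(UNIV::'n set) = {i, j, k}" and dist: "distinct [i, j, k]"
    by (auto simp: card_3_iff)
  \<comment> \<open>All facets are equivalent, so the coefficients have to be shifted to have sum zero; this does
    not affect \<open>h\<close> because the conormals sum to zero.\<close>
  define \<mu> where "\<mu> = (\<Sum>m\<in>UNIV. \<gamma> m) / 3"
  show ?thesis
  proof (intro exI conjI ballI)
    have "(\<Sum>m\<in>UNIV. (\<gamma> m - \<mu>) *\<^sub>R \<eta> m) = h - \<mu> *\<^sub>R (\<Sum>m\<in>UNIV. \<eta> m)"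
      by (simp add: scaleR_diff_left sum_subtractf scaleR_sum_right linear_part_eq)
    then show "h = (\<Sum>m\<in>UNIV. (\<gamma> m - \<mu>) *\<^sub>R \<eta> m)"
      using triangle_sum_conormals[OF univ dist unit] by simp
    fix I assume I: "I \<in> UNIV // equivalent_facets G \<eta> \<kappa>"
    have sw: "x \<in> I \<longleftrightarrow> y \<in> I" if u: "UNIV = {x, y, z}" "distinct [x, y, z]" for x y z
    proof -
      obtain w c where "facet_reflection \<eta> \<kappa> x y w c" by (rule triangle_reflection[OF u])
      then show ?thesis using swap I by blast
    qed
    have "i \<in> I \<longleftrightarrow> j \<in> I" using sw[of i j k] univ dist by auto
    moreover have "j \<in> I \<longleftrightarrow> k \<in> I" using sw[of j k i] univ dist by auto
    moreover have "x = i \<or> x = j \<or> x = k" for x using univ by blast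
    ultimately have "x \<in> I \<longleftrightarrow> i \<in> I" for x by metis
    then have "I = {} \<or> I = UNIV" by blast
    moreover have "(\<Sum>m\<in>UNIV. \<gamma> m - \<mu>) = 0"
      using \<open>CARD('n) = 3\<close> by (simp add: sum_subtractf \<mu>_def)
    ultimately show "(\<Sum>m\<in>I. \<gamma> m - \<mu>) = 0" by auto
  qed
next
  assume "CARD('n) = 4"
  obtain i :: 'n where True by blast
  obtain j k l where q: "UNIV = {i, j, k, l}" "distinct [i, j, k, l]"
    "\<not> adjacent \<eta> \<kappa> i j" "\<not> adjacent \<eta> \<kappa> k l"
    "adjacent \<eta> \<kappa> i k" "adjacent \<eta> \<kappa> i l" "adjacent \<eta> \<kappa> j k" "adjacent \<eta> \<kappa> j l"
    by (rule quadrilateral_structure[OF \<open>CARD('n) = 4\<close>])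
  show ?thesis
  proof (intro exI conjI ballI)
    show "h = (\<Sum>i\<in>UNIV. \<gamma> i *\<^sub>R \<eta> i)" by (rule linear_part_eq)
    fix I assume I: "I \<in> UNIV // equivalent_facets G \<eta> \<kappa>"
    let ?g = "\<lambda>m. if m \<in> I then \<gamma> m else 0"
    have pair: "?g x + ?g y = 0"
      if alt: "\<gamma> x = 0 \<and> \<gamma> y = 0 \<or> \<gamma> x + \<gamma> y = 0 \<and> (\<exists>w. facet_reflection \<eta> \<kappa> x y w 1)" for x y
    proof (cases "\<gamma> x = 0 \<and> \<gamma> y = 0")
      case False
      then obtain w where w: "\<gamma> x + \<gamma> y = 0" "facet_reflection \<eta> \<kappa> x y w 1" using alt by blast
      have "x \<in> I \<longleftrightarrow> y \<in> I" using swap I w(2) by blast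
      then show ?thesis using w(1) by simp
    qed simp
    have ij: "?g i + ?g j = 0"
      by (rule pair[OF opposite_coefficients[OF q(1,2,3,5,6)]]) (use unit in blast)
    have q': "UNIV = {k, l, i, j}" "distinct [k, l, i, j]" "adjacent \<eta> \<kappa> k i" "adjacent \<eta> \<kappa> k j"
      using q adjacent_sym[of \<eta> \<kappa>] by auto
    have kl: "?g k + ?g l = 0"
      by (rule pair[OF opposite_coefficients[OF q'(1,2) q(4) q'(3,4)]]) (use unit in blast)
    have "(\<Sum>m\<in>I. \<gamma> m) = (\<Sum>m\<in>UNIV. ?g m)" by (rule sum.mono_neutral_cong_left) auto
    also have "\<dots> = (?g i + ?g j) + (?g k + ?g l)"
      unfolding q(1) using q(2) by (simp add: algebra_simps)
    finally show "(\<Sum>m\<in>I. \<gamma> m) = 0" unfolding ij kl by simp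
  qed
qed

section \<open>Sides of a polygon\<close>

context simple_polygon begin

lemma sides_eq: "sides (poly_set \<eta> \<kappa>) = range (poly_facet \<eta> \<kappa>)"
proof (intro subset_antisym subsetI)
  let ?P = "poly_set \<eta> \<kappa>"
  fix F assume "F \<in> range (poly_facet \<eta> \<kappa>)"
  then obtain i where "F = poly_facet \<eta> \<kappa> i" by blast
  then show "F \<in> sides ?P"
    using poly_facet_face_of facet_nonempty aff_dim_facet aff_dim_poly_set
    by (simp add: sides_def facet_of_def)
next
  let ?P = "poly_set \<eta> \<kappa>"
  fix G assume "G \<in> sides ?P"
  then have G: "G face_of ?P" "G \<noteq> {}" "aff_dim G = 1"
    using aff_dim_poly_set by (simp_all add: sides_def facet_of_def)
  have GP: "G \<subseteq> ?P" and cG: "convex G" using G(1) face_of_imp_subset face_of_imp_convex by blast+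
  then obtain x where x: "x \<in> rel_interior G" using G(2) rel_interior_eq_empty by blast
  have "G \<noteq> ?P" using G(3) aff_dim_poly_set by auto
  then have "G \<inter> interior ?P = {}" using G(1) face_of_disjoint_interior by blast
  moreover have "x \<in> G" using x rel_interior_subset by blast
  ultimately have "x \<in> frontier ?P" using GP by (auto simp: frontier_def)
  then obtain i where "x \<in> poly_facet \<eta> \<kappa> i" unfolding frontier_eq_facets by blast
  then have sub: "G \<subseteq> poly_facet \<eta> \<kappa> i"
    using x by (intro subset_of_face_of[OF poly_facet_face_of GP]) blast
  have "poly_facet \<eta> \<kappa> i \<subseteq> ?P" by (auto simp: poly_facet_def)
  then have "G face_of poly_facet \<eta> \<kappa> i" using G(1) sub by (rule face_of_subset[rotated 2])
  moreover have "convex (poly_facet \<eta> \<kappa> i)" using poly_facet_face_of face_of_imp_convex by blast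
  ultimately have "G = poly_facet \<eta> \<kappa> i"
    using face_of_aff_dim_lt[of "poly_facet \<eta> \<kappa> i" G] G(3) aff_dim_facet[of i] by auto
  then show "G \<in> range (poly_facet \<eta> \<kappa>)" by blast
qed

lemma inj_facet: "inj (poly_facet \<eta> \<kappa>)"
  by (rule injI) (metis facet_not_subset order.refl)

lemma polygon_with_iff: "polygon_with k (poly_set \<eta> \<kappa>) \<longleftrightarrow> k = CARD('n)"
proof -
  have "polytope (poly_set \<eta> \<kappa>)"
    using polyhedron_poly_set bounded_poly polytope_eq_bounded_polyhedron by blast
  moreover have "card (sides (poly_set \<eta> \<kappa>)) = CARD('n)"
    unfolding sides_eq using inj_facet by (rule card_image)
  ultimately show ?thesis by (auto simp: polygon_with_def aff_dim_poly_set)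
qed

lemma parallel_sides_iff:
  "parallel_sides (poly_facet \<eta> \<kappa> i) (poly_facet \<eta> \<kappa> j) \<longleftrightarrow> i \<noteq> j \<and> (\<exists>c. \<eta> j = c *\<^sub>R \<eta> i)"
proof -
  let ?L = "\<lambda>i. {x. \<eta> i \<bullet> x = \<kappa> $ i}"
  have "affine_parallel (?L i) (?L j) \<longleftrightarrow> (\<exists>c. \<eta> j = c *\<^sub>R \<eta> i)"
  proof
    assume "affine_parallel (?L i) (?L j)"
    then obtain a where a: "?L j = (+) a ` ?L i" by (auto simp: affine_parallel_def)
    obtain y where y: "y \<noteq> 0" "orthogonal (\<eta> i) y"
      using orthogonal_to_vector_exists[of "\<eta> i"] dim2 by auto
    obtain p where p: "\<eta> i \<bullet> p = \<kappa> $ i" using facet_strict_point[of i] by metis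
    then have "p \<in> ?L i" "p + y \<in> ?L i" using y(2) by (auto simp: orthogonal_def inner_add_right)
    then have "a + p \<in> ?L j" "a + (p + y) \<in> ?L j" unfolding a by blast+
    then have "\<eta> j \<bullet> y = 0" by (simp add: inner_add_right)
    then show "\<exists>c. \<eta> j = c *\<^sub>R \<eta> i"
      using y by (intro orthogonal_parallel_2d[OF dim2 y(1) conormal_nonzero]) (auto simp: orthogonal_def)
  next
    assume "\<exists>c. \<eta> j = c *\<^sub>R \<eta> i"
    then obtain c where c: "\<eta> j = c *\<^sub>R \<eta> i" by blast
    then have c0: "c \<noteq> 0" using conormal_nonzero[of j] by auto
    define a where "a = ((\<kappa> $ j / c - \<kappa> $ i) / (\<eta> i \<bullet> \<eta> i)) *\<^sub>R \<eta> i"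
    have a: "\<eta> i \<bullet> a = \<kappa> $ j / c - \<kappa> $ i" using conormal_nonzero[of i] by (simp add: a_def)
    have "y \<in> ?L j \<longleftrightarrow> y - a \<in> ?L i" for y
      using c0 by (auto simp: c a inner_diff_right field_simps)
    then have iff: "y \<in> ?L j \<longleftrightarrow> y - a \<in> ?L i" for y .
    have "?L j = (+) a ` ?L i"
    proof (intro subset_antisym subsetI)
      fix y assume "y \<in> ?L j"
      then show "y \<in> (+) a ` ?L i" using iff[of y] by (intro image_eqI[of y _ "y - a"]) simp_all
    next
      fix y assume "y \<in> (+) a ` ?L i"
      then obtain x where "y = a + x" "x \<in> ?L i" by blast
      then show "y \<in> ?L j" using iff[of y] by simp
    qed
    then show "affine_parallel (?L i) (?L j)" by (auto simp: affine_parallel_def)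
  qed
  moreover have "poly_facet \<eta> \<kappa> i \<noteq> poly_facet \<eta> \<kappa> j \<longleftrightarrow> i \<noteq> j" using inj_facet by (auto dest: injD)
  ultimately show ?thesis by (simp add: parallel_sides_def affine_hull_facet)
qed

lemma triangle_iff: "is_triangle (poly_set \<eta> \<kappa>) \<longleftrightarrow> CARD('n) = 3"
  by (auto simp: is_triangle_def polygon_with_iff)

lemma trapezoid_iff:
  "is_trapezoid (poly_set \<eta> \<kappa>) \<longleftrightarrow> CARD('n) = 4 \<and> (\<exists>k l c. k \<noteq> l \<and> \<eta> l = c *\<^sub>R \<eta> k)"
  unfolding is_trapezoid_def polygon_with_iff sides_eq by (auto simp: parallel_sides_iff)

lemma parallelogram_imp_trapezoid:
  "is_parallelogram (poly_set \<eta> \<kappa>) \<Longrightarrow> is_trapezoid (poly_set \<eta> \<kappa>)"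
  unfolding is_trapezoid_def is_parallelogram_def sides_eq by blast

lemma few_facets_reflection:
  assumes "CARD('n) = 3 \<or> CARD('n) = 4 \<and> (\<exists>k l c. k \<noteq> l \<and> \<eta> l = c *\<^sub>R \<eta> k)"
  obtains i j w c where "facet_reflection \<eta> \<kappa> i j w c"
  using assms
proof (elim disjE conjE exE)
  assume "CARD('n) = 3"
  then obtain i j k where "(UNIV::'n set) = {i, j, k}" "distinct [i, j, k]" by (auto simp: card_3_iff)
  then show thesis using triangle_reflection that by metis
next
  fix k l c assume n: "CARD('n) = 4" and kl: "k \<noteq> l" and c: "\<eta> l = c *\<^sub>R \<eta> k"
  have "card (UNIV - {k, l}) = 2" using n kl by (subst card_Diff_subset) auto
  then obtain i j where ij: "UNIV - {k, l} = {i, j}" "i \<noteq> j" by (auto simp: card_2_iff)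
  obtain w0 where w0: "w0 \<noteq> 0" "orthogonal (\<eta> k) w0"
    using orthogonal_to_vector_exists[of "\<eta> k"] dim2 by auto
  have others: "m = k \<or> m = l" if "m \<noteq> i" "m \<noteq> j" for m using that ij(1) by blast
  have "\<eta> m \<bullet> w0 = 0" if "m \<noteq> i" "m \<noteq> j" for m
    using others[OF that] w0(2) c by (auto simp: orthogonal_def)
  then show thesis using facet_reflection_exists[OF ij(2) w0(1)] that by metis
qed

lemma mass_linear_polygonI:
  assumes "mass_linear \<eta> \<kappa> H" "\<not> H constant_on UNIV"
  obtains h \<gamma> C where "affine_with_linear_part h H" "h \<noteq> 0" "mass_linear_polygon \<eta> \<kappa> h \<gamma> C"
proof -
  obtain h where h: "affine_with_linear_part h H" using assms(1) unfolding mass_linear_def by blast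
  then obtain c0 where c0: "\<And>x. H x = h \<bullet> x + c0" unfolding affine_with_linear_part_def by blast
  obtain \<gamma> C where ml: "\<And>\<kappa>'. \<kappa>' \<in> chamber \<eta> \<kappa> \<Longrightarrow>
      H (center_of_mass (poly_set \<eta> \<kappa>')) = (\<Sum>i\<in>UNIV. \<gamma> i * \<kappa>' $ i) + C"
    using assms(1) unfolding mass_linear_def by blast
  have "h \<noteq> 0" using assms(2) c0 by (auto simp: constant_on_def)
  moreover have "mass_linear_polygon \<eta> \<kappa> h \<gamma> (C - c0)"
    by unfold_locales (use ml in \<open>simp add: c0 algebra_simps\<close>)
  ultimately show ?thesis using that h by blast
qed

lemma mass_linear_exists_iff:
  "(\<exists>H. mass_linear \<eta> \<kappa> H \<and> \<not> H constant_on UNIV) \<longleftrightarrow>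
    is_triangle (poly_set \<eta> \<kappa>) \<or> is_trapezoid (poly_set \<eta> \<kappa>) \<or> is_parallelogram (poly_set \<eta> \<kappa>)"
  (is "?E \<longleftrightarrow> _")
proof -
  have "?E \<longleftrightarrow> CARD('n) = 3 \<or> CARD('n) = 4 \<and> (\<exists>k l c. k \<noteq> l \<and> \<eta> l = c *\<^sub>R \<eta> k)"
  proof
    assume ?E
    then obtain H where "mass_linear \<eta> \<kappa> H" "\<not> H constant_on UNIV" by blast
    then obtain h \<gamma> C where "h \<noteq> 0" "mass_linear_polygon \<eta> \<kappa> h \<gamma> C" by (rule mass_linear_polygonI)
    then show "CARD('n) = 3 \<or> CARD('n) = 4 \<and> (\<exists>k l c. k \<noteq> l \<and> \<eta> l = c *\<^sub>R \<eta> k)"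
      using mass_linear_polygon.nonzero_imp_few_facets by blast
  next
    assume "CARD('n) = 3 \<or> CARD('n) = 4 \<and> (\<exists>k l c. k \<noteq> l \<and> \<eta> l = c *\<^sub>R \<eta> k)"
    then obtain i j w c where F: "facet_reflection \<eta> \<kappa> i j w c" by (rule few_facets_reflection)
    show ?E
      using facet_reflection.mass_linear_d[OF F] facet_reflection.not_constant_d[OF F] by blast
  qed
  then show ?thesis unfolding triangle_iff[symmetric] trapezoid_iff[symmetric]
    using parallelogram_imp_trapezoid by blast
qed

lemma inessentialI:
  assumes H: "mass_linear \<eta> \<kappa> H" "\<not> H constant_on UNIV"
    and unit: "\<And>i j w c. facet_reflection \<eta> \<kappa> i j w c \<Longrightarrow> c = 1"
    and lin: "\<And>i j w c. facet_reflection \<eta> \<kappa> i j w c \<Longrightarrow> facet_reflection.lin \<eta> i j w c \<in> G"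
    and comp: "\<And>f g. f \<in> G \<Longrightarrow> g \<in> G \<Longrightarrow> f \<circ> g \<in> G"
  shows "inessential G \<eta> \<kappa> H"
proof -
  obtain h \<gamma> C where h: "affine_with_linear_part h H" "h \<noteq> 0" "mass_linear_polygon \<eta> \<kappa> h \<gamma> C"
    using H by (rule mass_linear_polygonI)
  have "i \<in> I \<longleftrightarrow> j \<in> I" if F: "facet_reflection \<eta> \<kappa> i j w c" and I: "I \<in> UNIV // equivalent_facets G \<eta> \<kappa>"
    for i j w c I
    using facet_reflection.class_swap[OF F lin[OF F] comp[OF lin[OF F]] I] .
  then have "\<exists>\<beta>. h = (\<Sum>i\<in>UNIV. \<beta> i *\<^sub>R \<eta> i) \<and>
    (\<forall>I \<in> UNIV // equivalent_facets G \<eta> \<kappa>. (\<Sum>i\<in>I. \<beta> i) = 0)"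
    using unit by (intro mass_linear_polygon.inessential_coefficients[OF h(3,2)]) blast+
  then show ?thesis unfolding inessential_def using h(1) by blast
qed

end

section \<open>Conclusion\<close>

theorem theorem1p3:
  fixes \<eta> :: "'n::finite \<Rightarrow> 'a::euclidean_space" and \<kappa> :: "real ^ 'n"
  assumes "DIM('a) = 2"
  shows
    "(simple_polytope \<eta> \<kappa> \<longrightarrow>
        ((\<exists>H. mass_linear \<eta> \<kappa> H \<and> \<not> H constant_on UNIV) \<longleftrightarrow>
           is_triangle (poly_set \<eta> \<kappa>) \<or> is_trapezoid (poly_set \<eta> \<kappa>) \<or> is_parallelogram (poly_set \<eta> \<kappa>)) \<and>
        (normalized UNIV \<eta> \<kappa> \<longrightarrow>
           (\<forall>H. mass_linear \<eta> \<kappa> H \<and> \<not> H constant_on UNIV \<longrightarrow> inessential UNIV \<eta> \<kappa> H))) \<and>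
     (\<forall>L. integer_lattice L \<and> smooth_polytope L \<eta> \<kappa> \<longrightarrow>
        ((\<exists>H. mass_linear \<eta> \<kappa> H \<and> \<not> H constant_on UNIV) \<longleftrightarrow>
           is_triangle (poly_set \<eta> \<kappa>) \<or> is_trapezoid (poly_set \<eta> \<kappa>) \<or> is_parallelogram (poly_set \<eta> \<kappa>)) \<and>
        (\<forall>H. mass_linear \<eta> \<kappa> H \<and> \<not> H constant_on UNIV \<longrightarrow>
           inessential (lattice_maps L) \<eta> \<kappa> H))"
proof (intro conjI allI impI)
  assume S: "simple_polytope \<eta> \<kappa>"
  interpret simple_polygon \<eta> \<kappa> using assms S by unfold_locales
  show "(\<exists>H. mass_linear \<eta> \<kappa> H \<and> \<not> H constant_on UNIV) \<longleftrightarrow>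
           is_triangle (poly_set \<eta> \<kappa>) \<or> is_trapezoid (poly_set \<eta> \<kappa>) \<or> is_parallelogram (poly_set \<eta> \<kappa>)"
    by (rule mass_linear_exists_iff)
  fix H assume N: "normalized UNIV \<eta> \<kappa>" and H: "mass_linear \<eta> \<kappa> H \<and> \<not> H constant_on UNIV"
  show "inessential UNIV \<eta> \<kappa> H"
    using H facet_reflection.normalized_factor[OF _ N] by (intro inessentialI) auto
next
  fix L assume S: "integer_lattice L \<and> smooth_polytope L \<eta> \<kappa>"
  then have "simple_polytope \<eta> \<kappa>" by (simp add: smooth_polytope_def)
  then interpret simple_polygon \<eta> \<kappa> using assms by unfold_locales
  show "(\<exists>H. mass_linear \<eta> \<kappa> H \<and> \<not> H constant_on UNIV) \<longleftrightarrow>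
           is_triangle (poly_set \<eta> \<kappa>) \<or> is_trapezoid (poly_set \<eta> \<kappa>) \<or> is_parallelogram (poly_set \<eta> \<kappa>)"
    by (rule mass_linear_exists_iff)
  fix H assume H: "mass_linear \<eta> \<kappa> H \<and> \<not> H constant_on UNIV"
  show "inessential (lattice_maps L) \<eta> \<kappa> H"
    using H S by (intro inessentialI lattice_maps_compose)
      (auto intro: facet_reflection.smooth_factor)
qed

end
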